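(* Let $(\mathcal C,\otimes,1)$ be an abelian, closed symmetric monoidal category that is locally finitely generated and such that filtered colimits commute with finite limits in $A\text{-}Mod$ for every $A\in Comm(\mathcal C)$. Let $A\in Comm(\mathcal C)$ be a Noetherian, integral commutative monoid object. Then every finitely generated $K(A)$-module is isomorphic to a direct sum $K(A)^q$ for some integer $q\geq 0$.
   Context: $Comm(\mathcal C)$ is the category of commutative monoid objects of $(\mathcal C,\otimes,1)$; for $A\in Comm(\mathcal C)$, $A\text{-}Mod$ is the category of $A$-module objects in $\mathcal C$, which is abelian and closed symmetric monoidal under $\otimes_A$. The (small) colimits used below are assumed to exist. $M\in A\text{-}Mod$ is finitely generated if $Hom_{A\text{-}Mod}(M,-)$ preserves filtered colimits of monomorphisms (filtered systems with monomorphic transition maps); $M$ is finitely presented if $M\cong colim(0\longleftarrow A^m\overset{q}{\longrightarrow}A^n)$ (i.e. $M\cong Coker(q)$) for some morphism $q:A^m\to A^n$ of finite free $A$-modules. "$\mathcal C$ is locally finitely generated" means: for every $A\in Comm(\mathcal C)$, every $M\in A\text{-}Mod$ is the filtered colimit of its finitely generated submodules. Put $\mathcal E(A):=Hom_{A\text{-}Mod}(A,A)$, a commutative ring, functorial in $A$: $g:A\to B$ induces $\mathcal E(g):\mathcal E(A)\to\mathcal E(B)$, $s\mapsto s\otimes_AB$. $A$ is integral if $\mathcal E(A)$ is an integral domain; $A$ is Noetherian if, for $M\in A\text{-}Mod$, $M$ is finitely generated if and only if $M$ is finitely presented. For $A$ integral and $0\neq s\in\mathcal E(A)$, $A_s:=colim(A\overset{s}{\to}A\overset{s}{\to}\cdots)$,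 a commutative $A$-algebra object, universal among $A\to B$ in $Comm(\mathcal C)$ sending $s$ to a unit of $\mathcal E(B)$; and $K(A):=colim_{s\in\mathcal E(A)\setminus\{0\}}A_s$ (filtered colimit along the canonical maps $A_s\to A_{st}$), an object of $Comm(\mathcal C)$ universal among $g:A\to B$ in $Comm(\mathcal C)$ with $\mathcal E(g)(s)$ a unit for all $0\neq s\in\mathcal E(A)$. *)

theory Defs
  imports "HOL-Algebra.Ring" "HOL-Library.Equipollence"
begin

section \<open>Categories, diagrams, limits and colimits\<close>

text \<open>
  Categories are given by hom-sets. An arrow does not have to determine its source and target, so
  that arrows of modules can be arrows of the underlying category; every notion below that depends
  on source or target (monic, iso, arrow part of a diagram, ...) therefore mentions the objects.
\<close>

record ('o, 'm) cat =
  Ob :: "'o set"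
  Hom :: "'o \<Rightarrow> 'o \<Rightarrow> 'm set"
  Idn :: "'o \<Rightarrow> 'm"
  Cmp :: "'m \<Rightarrow> 'm \<Rightarrow> 'm"  (infixr "\<cdot>\<index>" 70)

locale category =
  fixes C :: "('o, 'm, 'x) cat_scheme" (structure)
  assumes idn_in: "X \<in> Ob C \<Longrightarrow> Idn C X \<in> Hom C X X"
    and cmp_in: "\<lbrakk>X \<in> Ob C; Y \<in> Ob C; Z \<in> Ob C; f \<in> Hom C X Y; g \<in> Hom C Y Z\<rbrakk> \<Longrightarrow> g \<cdot> f \<in> Hom C X Z"
    and idn_right: "\<lbrakk>X \<in> Ob C; Y \<in> Ob C; f \<in> Hom C X Y\<rbrakk> \<Longrightarrow> f \<cdot> Idn C X = f"
    and idn_left: "\<lbrakk>X \<in> Ob C; Y \<in> Ob C; f \<in> Hom C X Y\<rbrakk> \<Longrightarrow> Idn C Y \<cdot> f = f"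
    and cmp_assoc: "\<lbrakk>W \<in> Ob C; X \<in> Ob C; Y \<in> Ob C; Z \<in> Ob C;
      f \<in> Hom C W X; g \<in> Hom C X Y; h \<in> Hom C Y Z\<rbrakk> \<Longrightarrow> (h \<cdot> g) \<cdot> f = h \<cdot> (g \<cdot> f)"

definition monic :: "('o, 'm, 'x) cat_scheme \<Rightarrow> 'o \<Rightarrow> 'o \<Rightarrow> 'm \<Rightarrow> bool" where
  "monic D X Y f \<longleftrightarrow> f \<in> Hom D X Y \<and>
     (\<forall>W\<in>Ob D. \<forall>g\<in>Hom D W X. \<forall>h\<in>Hom D W X. f \<cdot>\<^bsub>D\<^esub> g = f \<cdot>\<^bsub>D\<^esub> h \<longrightarrow> g = h)"

definition epic :: "('o, 'm, 'x) cat_scheme \<Rightarrow> 'o \<Rightarrow> 'o \<Rightarrow> 'm \<Rightarrow> bool" where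
  "epic D X Y f \<longleftrightarrow> f \<in> Hom D X Y \<and>
     (\<forall>Z\<in>Ob D. \<forall>g\<in>Hom D Y Z. \<forall>h\<in>Hom D Y Z. g \<cdot>\<^bsub>D\<^esub> f = h \<cdot>\<^bsub>D\<^esub> f \<longrightarrow> g = h)"

definition iso_arr :: "('o, 'm, 'x) cat_scheme \<Rightarrow> 'o \<Rightarrow> 'o \<Rightarrow> 'm \<Rightarrow> bool" where
  "iso_arr D X Y f \<longleftrightarrow> f \<in> Hom D X Y \<and>
     (\<exists>g\<in>Hom D Y X. g \<cdot>\<^bsub>D\<^esub> f = Idn D X \<and> f \<cdot>\<^bsub>D\<^esub> g = Idn D Y)"

definition isomorphic :: "('o, 'm, 'x) cat_scheme \<Rightarrow> 'o \<Rightarrow> 'o \<Rightarrow> bool" where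
  "isomorphic D X Y \<longleftrightarrow> (\<exists>f. iso_arr D X Y f)"

definition is_coproduct ::
  "('o, 'm, 'x) cat_scheme \<Rightarrow> 'i set \<Rightarrow> ('i \<Rightarrow> 'o) \<Rightarrow> 'o \<Rightarrow> ('i \<Rightarrow> 'm) \<Rightarrow> bool" where
  "is_coproduct D I X P inc \<longleftrightarrow> P \<in> Ob D \<and> (\<forall>i\<in>I. inc i \<in> Hom D (X i) P) \<and>
     (\<forall>N\<in>Ob D. \<forall>n. (\<forall>i\<in>I. n i \<in> Hom D (X i) N) \<longrightarrow>
        (\<exists>!h. h \<in> Hom D P N \<and> (\<forall>i\<in>I. h \<cdot>\<^bsub>D\<^esub> inc i = n i)))"

text \<open>\<open>P\<close> is a direct sum \<open>X\<^sup>n\<close> of \<open>n\<close> copies of \<open>X\<close>; for \<open>n = 0\<close> it is an initial (zero) object.\<close>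

definition is_power :: "('o, 'm, 'x) cat_scheme \<Rightarrow> 'o \<Rightarrow> nat \<Rightarrow> 'o \<Rightarrow> bool" where
  "is_power D X n P \<longleftrightarrow> (\<exists>inc. is_coproduct D {..<n} (\<lambda>_. X) P inc)"

definition diagram ::
  "('i, 'k, 'y) cat_scheme \<Rightarrow> ('o, 'm, 'x) cat_scheme \<Rightarrow> ('i \<Rightarrow> 'o) \<Rightarrow> ('i \<Rightarrow> 'i \<Rightarrow> 'k \<Rightarrow> 'm) \<Rightarrow> bool" where
  "diagram J D Fo Fm \<longleftrightarrow>
     (\<forall>i\<in>Ob J. Fo i \<in> Ob D) \<and>
     (\<forall>i\<in>Ob J. \<forall>j\<in>Ob J. \<forall>u\<in>Hom J i j. Fm i j u \<in> Hom D (Fo i) (Fo j)) \<and>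
     (\<forall>i\<in>Ob J. Fm i i (Idn J i) = Idn D (Fo i)) \<and>
     (\<forall>i\<in>Ob J. \<forall>j\<in>Ob J. \<forall>k\<in>Ob J. \<forall>u\<in>Hom J i j. \<forall>v\<in>Hom J j k.
        Fm i k (v \<cdot>\<^bsub>J\<^esub> u) = Fm j k v \<cdot>\<^bsub>D\<^esub> Fm i j u)"

definition cocone ::
  "('i, 'k, 'y) cat_scheme \<Rightarrow> ('o, 'm, 'x) cat_scheme \<Rightarrow> ('i \<Rightarrow> 'o) \<Rightarrow> ('i \<Rightarrow> 'i \<Rightarrow> 'k \<Rightarrow> 'm)
     \<Rightarrow> 'o \<Rightarrow> ('i \<Rightarrow> 'm) \<Rightarrow> bool" where
  "cocone J D Fo Fm L l \<longleftrightarrow> L \<in> Ob D \<and> (\<forall>i\<in>Ob J. l i \<in> Hom D (Fo i) L) \<and>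
     (\<forall>i\<in>Ob J. \<forall>j\<in>Ob J. \<forall>u\<in>Hom J i j. l j \<cdot>\<^bsub>D\<^esub> Fm i j u = l i)"

definition is_colimit ::
  "('i, 'k, 'y) cat_scheme \<Rightarrow> ('o, 'm, 'x) cat_scheme \<Rightarrow> ('i \<Rightarrow> 'o) \<Rightarrow> ('i \<Rightarrow> 'i \<Rightarrow> 'k \<Rightarrow> 'm)
     \<Rightarrow> 'o \<Rightarrow> ('i \<Rightarrow> 'm) \<Rightarrow> bool" where
  "is_colimit J D Fo Fm L l \<longleftrightarrow> cocone J D Fo Fm L l \<and>
     (\<forall>N n. cocone J D Fo Fm N n \<longrightarrow>
        (\<exists>!h. h \<in> Hom D L N \<and> (\<forall>i\<in>Ob J. h \<cdot>\<^bsub>D\<^esub> l i = n i)))"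

definition cone ::
  "('i, 'k, 'y) cat_scheme \<Rightarrow> ('o, 'm, 'x) cat_scheme \<Rightarrow> ('i \<Rightarrow> 'o) \<Rightarrow> ('i \<Rightarrow> 'i \<Rightarrow> 'k \<Rightarrow> 'm)
     \<Rightarrow> 'o \<Rightarrow> ('i \<Rightarrow> 'm) \<Rightarrow> bool" where
  "cone J D Fo Fm L p \<longleftrightarrow> L \<in> Ob D \<and> (\<forall>i\<in>Ob J. p i \<in> Hom D L (Fo i)) \<and>
     (\<forall>i\<in>Ob J. \<forall>j\<in>Ob J. \<forall>u\<in>Hom J i j. Fm i j u \<cdot>\<^bsub>D\<^esub> p i = p j)"

definition is_limit ::
  "('i, 'k, 'y) cat_scheme \<Rightarrow> ('o, 'm, 'x) cat_scheme \<Rightarrow> ('i \<Rightarrow> 'o) \<Rightarrow> ('i \<Rightarrow> 'i \<Rightarrow> 'k \<Rightarrow> 'm)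
     \<Rightarrow> 'o \<Rightarrow> ('i \<Rightarrow> 'm) \<Rightarrow> bool" where
  "is_limit J D Fo Fm L p \<longleftrightarrow> cone J D Fo Fm L p \<and>
     (\<forall>N n. cone J D Fo Fm N n \<longrightarrow>
        (\<exists>!h. h \<in> Hom D N L \<and> (\<forall>i\<in>Ob J. p i \<cdot>\<^bsub>D\<^esub> h = n i)))"


section \<open>Size, filtered colimits, finite generation\<close>

text \<open>
  The type \<open>'u\<close> plays the role of a universe: a set (of any type) is small if its cardinality is
  strictly smaller than that of \<open>'u\<close>. Up to isomorphism a small category is thus one whose objects
  and arrows are elements of \<open>'u\<close>, so \<open>('u, 'u) cat\<close> is the type over which index categories range.
  With \<open>'u\<close> of inaccessible cardinality this is the usual notion for a Grothendieck universe; only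
  that countable sets are small is ever required of \<open>'u\<close>.
\<close>

definition small_set :: "'u itself \<Rightarrow> 'a set \<Rightarrow> bool" where
  "small_set U S \<longleftrightarrow> S \<prec> (UNIV :: 'u set)"

definition small_cat :: "'u itself \<Rightarrow> ('i, 'k, 'y) cat_scheme \<Rightarrow> bool" where
  "small_cat U J \<longleftrightarrow> category J \<and> small_set U (Ob J) \<and>
     (\<forall>i\<in>Ob J. \<forall>j\<in>Ob J. small_set U (Hom J i j))"

definition locally_small :: "'u itself \<Rightarrow> ('o, 'm, 'x) cat_scheme \<Rightarrow> bool" where
  "locally_small U C \<longleftrightarrow> (\<forall>X\<in>Ob C. \<forall>Y\<in>Ob C. small_set U (Hom C X Y))"

definition filtered :: "('i, 'k, 'y) cat_scheme \<Rightarrow> bool" where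
  "filtered J \<longleftrightarrow> Ob J \<noteq> {} \<and>
     (\<forall>i\<in>Ob J. \<forall>j\<in>Ob J. \<exists>k\<in>Ob J. Hom J i k \<noteq> {} \<and> Hom J j k \<noteq> {}) \<and>
     (\<forall>i\<in>Ob J. \<forall>j\<in>Ob J. \<forall>u\<in>Hom J i j. \<forall>v\<in>Hom J i j.
        \<exists>k\<in>Ob J. \<exists>w\<in>Hom J j k. w \<cdot>\<^bsub>J\<^esub> u = w \<cdot>\<^bsub>J\<^esub> v)"

definition has_filtered_colimits :: "'u itself \<Rightarrow> ('o, 'm, 'x) cat_scheme \<Rightarrow> bool" where
  "has_filtered_colimits U D \<longleftrightarrow>
     (\<forall>(J :: ('u, 'u) cat) Fo Fm. small_cat U J \<and> filtered J \<and> diagram J D Fo Fm \<longrightarrow>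
        (\<exists>L l. is_colimit J D Fo Fm L l))"

text \<open>
  The colimit of a diagram of sets is the quotient of its disjoint union by the equivalence relation
  generated by \<open>(i, x) \<sim> (j, Sm i j u x)\<close>. The predicate \<open>set_colimit\<close> says that the cocone \<open>l\<close>
  with vertex \<open>L\<close> induces a bijection from this quotient to \<open>L\<close>.
\<close>

definition set_colimit_step ::
  "('i, 'k, 'y) cat_scheme \<Rightarrow> ('i \<Rightarrow> 'a set) \<Rightarrow> ('i \<Rightarrow> 'i \<Rightarrow> 'k \<Rightarrow> 'a \<Rightarrow> 'a) \<Rightarrow> ('i \<times> 'a) rel" where
  "set_colimit_step J S Sm =
     {((i, x), (j, Sm i j u x)) | i j u x. i \<in> Ob J \<and> j \<in> Ob J \<and> u \<in> Hom J i j \<and> x \<in> S i}"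

definition set_colimit_classes ::
  "('i, 'k, 'y) cat_scheme \<Rightarrow> ('i \<Rightarrow> 'a set) \<Rightarrow> ('i \<Rightarrow> 'i \<Rightarrow> 'k \<Rightarrow> 'a \<Rightarrow> 'a) \<Rightarrow> ('i \<times> 'a) set set" where
  "set_colimit_classes J S Sm =
     Sigma (Ob J) S // (set_colimit_step J S Sm \<union> (set_colimit_step J S Sm)\<inverse>)\<^sup>*"

definition set_colimit ::
  "('i, 'k, 'y) cat_scheme \<Rightarrow> ('i \<Rightarrow> 'a set) \<Rightarrow> ('i \<Rightarrow> 'i \<Rightarrow> 'k \<Rightarrow> 'a \<Rightarrow> 'a)
     \<Rightarrow> 'a set \<Rightarrow> ('i \<Rightarrow> 'a \<Rightarrow> 'a) \<Rightarrow> bool" where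
  "set_colimit J S Sm L l \<longleftrightarrow>
     bij_betw (\<lambda>c. the_elem ((\<lambda>(i, x). l i x) ` c)) (set_colimit_classes J S Sm) L"

text \<open>\<open>M\<close> is finitely generated if \<open>Hom(M, -)\<close> preserves small filtered colimits of monomorphisms.\<close>

definition finitely_generated :: "'u itself \<Rightarrow> ('o, 'm, 'x) cat_scheme \<Rightarrow> 'o \<Rightarrow> bool" where
  "finitely_generated U D M \<longleftrightarrow>
     (\<forall>(J :: ('u, 'u) cat) Fo Fm L l.
        small_cat U J \<and> filtered J \<and> diagram J D Fo Fm \<and>
        (\<forall>i\<in>Ob J. \<forall>j\<in>Ob J. \<forall>u\<in>Hom J i j. monic D (Fo i) (Fo j) (Fm i j u)) \<and>
        is_colimit J D Fo Fm L l \<longrightarrow>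
        set_colimit J (\<lambda>i. Hom D M (Fo i)) (\<lambda>i j u g. Fm i j u \<cdot>\<^bsub>D\<^esub> g)
          (Hom D M L) (\<lambda>i g. l i \<cdot>\<^bsub>D\<^esub> g))"

definition fg_subobjects :: "'u itself \<Rightarrow> ('o, 'm, 'x) cat_scheme \<Rightarrow> 'o \<Rightarrow> ('o \<times> 'm) set" where
  "fg_subobjects U D M = {(N, e). N \<in> Ob D \<and> monic D N M e \<and> finitely_generated U D N}"

definition subobject_cat ::
  "('o, 'm, 'x) cat_scheme \<Rightarrow> ('o \<times> 'm) set \<Rightarrow> ('o \<times> 'm, 'm) cat" where
  "subobject_cat D S =
     \<lparr>Ob = S,
      Hom = (\<lambda>(N, e) (N', e'). {f \<in> Hom D N N'. e' \<cdot>\<^bsub>D\<^esub> f = e}),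
      Idn = (\<lambda>(N, e). Idn D N),
      Cmp = Cmp D\<rparr>"

text \<open>
  Every object is the (small) filtered colimit of its finitely generated subobjects. Subobjects are
  isomorphism classes of monomorphisms, so the system is indexed by a small set \<open>S\<close> of monomorphisms
  containing a representative of each of these classes.
\<close>

definition generated_by_fg_subobjects :: "'u itself \<Rightarrow> ('o, 'm, 'x) cat_scheme \<Rightarrow> bool" where
  "generated_by_fg_subobjects U D \<longleftrightarrow>
     (\<forall>M\<in>Ob D. \<exists>S \<subseteq> fg_subobjects U D M.
        (\<forall>(N, e) \<in> fg_subobjects U D M. \<exists>(N', e') \<in> S. \<exists>f. iso_arr D N N' f \<and> e' \<cdot>\<^bsub>D\<^esub> f = e) \<and>
        small_cat U (subobject_cat D S) \<and> filtered (subobject_cat D S) \<and>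
        is_colimit (subobject_cat D S) D fst (\<lambda>_ _ f. f) M snd)"

definition prod_cat ::
  "('i, 'k, 'y) cat_scheme \<Rightarrow> ('a, 'b, 'z) cat_scheme \<Rightarrow> ('i \<times> 'a, 'k \<times> 'b) cat" where
  "prod_cat J F =
     \<lparr>Ob = Ob J \<times> Ob F,
      Hom = (\<lambda>(i, a) (j, b). Hom J i j \<times> Hom F a b),
      Idn = (\<lambda>(i, a). (Idn J i, Idn F a)),
      Cmp = (\<lambda>(u, v) (u', v'). (u \<cdot>\<^bsub>J\<^esub> u', v \<cdot>\<^bsub>F\<^esub> v'))\<rparr>"

definition finite_cat :: "('i, 'k, 'y) cat_scheme \<Rightarrow> bool" where
  "finite_cat F \<longleftrightarrow> category F \<and> finite (Ob F) \<and> (\<forall>a\<in>Ob F. \<forall>b\<in>Ob F. finite (Hom F a b))"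

text \<open>
  Commutation of filtered colimits with finite limits: let \<open>X\<close> be a diagram over \<open>J \<times> F\<close> with \<open>J\<close>
  small filtered and \<open>F\<close> finite, let \<open>Co a = colim\<^sub>i X (i, a)\<close> with legs \<open>c i a\<close> and
  \<open>Li i = lim\<^sub>a X (i, a)\<close> with projections \<open>p i a\<close>, let \<open>P = lim\<^sub>a Co a\<close> and \<open>Q = colim\<^sub>i Li i\<close>.
  Then the canonical arrow \<open>h : Q \<rightarrow> P\<close>, i.e. the unique one with
  \<open>\<pi> a \<cdot> h \<cdot> \<iota> i = c i a \<cdot> p i a\<close>, is an isomorphism.
\<close>

definition filtered_colimits_commute_finite_limits ::
  "'u itself \<Rightarrow> ('o, 'm, 'x) cat_scheme \<Rightarrow> bool" where
  "filtered_colimits_commute_finite_limits U D \<longleftrightarrow>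
     (\<forall>(J :: ('u, 'u) cat) (F :: (nat, nat) cat) Xo Xm Co Cm c Li Lm p P \<pi> Q \<iota>.
        small_cat U J \<and> filtered J \<and> finite_cat F \<and> diagram (prod_cat J F) D Xo Xm \<and>
        (\<forall>a\<in>Ob F. is_colimit J D (\<lambda>i. Xo (i, a)) (\<lambda>i j u. Xm (i, a) (j, a) (u, Idn F a))
                    (Co a) (\<lambda>i. c i a)) \<and>
        diagram F D Co Cm \<and>
        (\<forall>i\<in>Ob J. \<forall>a\<in>Ob F. \<forall>b\<in>Ob F. \<forall>v\<in>Hom F a b.
           Cm a b v \<cdot>\<^bsub>D\<^esub> c i a = c i b \<cdot>\<^bsub>D\<^esub> Xm (i, a) (i, b) (Idn J i, v)) \<and>
        (\<forall>i\<in>Ob J. is_limit F D (\<lambda>a. Xo (i, a)) (\<lambda>a b v. Xm (i, a) (i, b) (Idn J i, v))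
                    (Li i) (\<lambda>a. p i a)) \<and>
        diagram J D Li Lm \<and>
        (\<forall>i\<in>Ob J. \<forall>j\<in>Ob J. \<forall>u\<in>Hom J i j. \<forall>a\<in>Ob F.
           p j a \<cdot>\<^bsub>D\<^esub> Lm i j u = Xm (i, a) (j, a) (u, Idn F a) \<cdot>\<^bsub>D\<^esub> p i a) \<and>
        is_limit F D Co Cm P \<pi> \<and> is_colimit J D Li Lm Q \<iota> \<longrightarrow>
        (\<exists>h. iso_arr D Q P h \<and>
           (\<forall>i\<in>Ob J. \<forall>a\<in>Ob F. \<pi> a \<cdot>\<^bsub>D\<^esub> h \<cdot>\<^bsub>D\<^esub> \<iota> i = c i a \<cdot>\<^bsub>D\<^esub> p i a)))"


section \<open>Abelian categories\<close>

record ('o, 'm) abcat = "('o, 'm) cat" +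
  Zero :: "'o \<Rightarrow> 'o \<Rightarrow> 'm"
  Plus :: "'m \<Rightarrow> 'm \<Rightarrow> 'm"

definition hom_group :: "('o, 'm, 'x) abcat_scheme \<Rightarrow> 'o \<Rightarrow> 'o \<Rightarrow> 'm monoid" where
  "hom_group C X Y = \<lparr>carrier = Hom C X Y, mult = Plus C, one = Zero C X Y\<rparr>"

locale preadditive_category = category C for C :: "('o, 'm, 'x) abcat_scheme" (structure) +
  assumes hom_comm_group: "\<lbrakk>X \<in> Ob C; Y \<in> Ob C\<rbrakk> \<Longrightarrow> comm_group (hom_group C X Y)"
    and cmp_plus_right: "\<lbrakk>X \<in> Ob C; Y \<in> Ob C; Z \<in> Ob C;
      f \<in> Hom C X Y; g \<in> Hom C X Y; h \<in> Hom C Y Z\<rbrakk> \<Longrightarrow> h \<cdot> Plus C f g = Plus C (h \<cdot> f) (h \<cdot> g)"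
    and cmp_plus_left: "\<lbrakk>X \<in> Ob C; Y \<in> Ob C; Z \<in> Ob C;
      f \<in> Hom C X Y; g \<in> Hom C Y Z; h \<in> Hom C Y Z\<rbrakk> \<Longrightarrow> Plus C g h \<cdot> f = Plus C (g \<cdot> f) (h \<cdot> f)"

definition is_kernel ::
  "('o, 'm, 'x) abcat_scheme \<Rightarrow> 'o \<Rightarrow> 'o \<Rightarrow> 'm \<Rightarrow> 'o \<Rightarrow> 'm \<Rightarrow> bool" where
  "is_kernel C X Y f K k \<longleftrightarrow> K \<in> Ob C \<and> k \<in> Hom C K X \<and> f \<cdot>\<^bsub>C\<^esub> k = Zero C K Y \<and>
     (\<forall>W\<in>Ob C. \<forall>g\<in>Hom C W X. f \<cdot>\<^bsub>C\<^esub> g = Zero C W Y \<longrightarrow> (\<exists>!h. h \<in> Hom C W K \<and> k \<cdot>\<^bsub>C\<^esub> h = g))"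

definition is_cokernel ::
  "('o, 'm, 'x) abcat_scheme \<Rightarrow> 'o \<Rightarrow> 'o \<Rightarrow> 'm \<Rightarrow> 'o \<Rightarrow> 'm \<Rightarrow> bool" where
  "is_cokernel C X Y f K k \<longleftrightarrow> K \<in> Ob C \<and> k \<in> Hom C Y K \<and> k \<cdot>\<^bsub>C\<^esub> f = Zero C X K \<and>
     (\<forall>W\<in>Ob C. \<forall>g\<in>Hom C Y W. g \<cdot>\<^bsub>C\<^esub> f = Zero C X W \<longrightarrow> (\<exists>!h. h \<in> Hom C K W \<and> h \<cdot>\<^bsub>C\<^esub> k = g))"

locale abelian_category = preadditive_category C for C :: "('o, 'm, 'x) abcat_scheme" (structure) +
  assumes zero_object: "\<exists>Z\<in>Ob C. \<forall>X\<in>Ob C. (\<exists>!f. f \<in> Hom C X Z) \<and> (\<exists>!f. f \<in> Hom C Z X)"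
    and biproducts: "\<lbrakk>X \<in> Ob C; Y \<in> Ob C\<rbrakk> \<Longrightarrow>
      \<exists>P\<in>Ob C. \<exists>i\<in>Hom C X P. \<exists>j\<in>Hom C Y P. \<exists>p\<in>Hom C P X. \<exists>q\<in>Hom C P Y.
        p \<cdot> i = Idn C X \<and> q \<cdot> j = Idn C Y \<and> Plus C (i \<cdot> p) (j \<cdot> q) = Idn C P"
    and kernels: "\<lbrakk>X \<in> Ob C; Y \<in> Ob C; f \<in> Hom C X Y\<rbrakk> \<Longrightarrow> \<exists>K k. is_kernel C X Y f K k"
    and cokernels: "\<lbrakk>X \<in> Ob C; Y \<in> Ob C; f \<in> Hom C X Y\<rbrakk> \<Longrightarrow> \<exists>K k. is_cokernel C X Y f K k"
    and monic_kernel: "\<lbrakk>X \<in> Ob C; Y \<in> Ob C; monic C X Y f\<rbrakk> \<Longrightarrow>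
      \<exists>Z\<in>Ob C. \<exists>g\<in>Hom C Y Z. is_kernel C Y Z g X f"
    and epic_cokernel: "\<lbrakk>X \<in> Ob C; Y \<in> Ob C; epic C X Y f\<rbrakk> \<Longrightarrow>
      \<exists>Z\<in>Ob C. \<exists>g\<in>Hom C Z X. is_cokernel C Z X g Y f"

definition endomorphism_ring :: "('o, 'm, 'x) abcat_scheme \<Rightarrow> 'o \<Rightarrow> 'm ring" where
  "endomorphism_ring D X =
     \<lparr>carrier = Hom D X X, mult = Cmp D, one = Idn D X, zero = Zero D X X, add = Plus D\<rparr>"

text \<open>\<open>M\<close> is the cokernel of an arrow \<open>A\<^sup>m \<rightarrow> A\<^sup>n\<close>.\<close>

definition finitely_presented :: "('o, 'm, 'x) abcat_scheme \<Rightarrow> 'o \<Rightarrow> 'o \<Rightarrow> bool" where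
  "finitely_presented D A M \<longleftrightarrow>
     (\<exists>m n P Q. is_power D A m P \<and> is_power D A n Q \<and>
        (\<exists>q\<in>Hom D P Q. \<exists>e. is_cokernel D P Q q M e))"


section \<open>Closed symmetric monoidal categories\<close>

record ('o, 'm) moncat = "('o, 'm) abcat" +
  Tensor :: "'o \<Rightarrow> 'o \<Rightarrow> 'o"  (infixr "\<boxtimes>\<index>" 75)
  Tensor_arr :: "'m \<Rightarrow> 'm \<Rightarrow> 'm"  (infixr "\<star>\<index>" 75)
  Unit_ob :: "'o"
  Asc :: "'o \<Rightarrow> 'o \<Rightarrow> 'o \<Rightarrow> 'm"
  Lun :: "'o \<Rightarrow> 'm"
  Run :: "'o \<Rightarrow> 'm"
  Brd :: "'o \<Rightarrow> 'o \<Rightarrow> 'm"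

locale symmetric_monoidal_category = category C for C :: "('o, 'm, 'x) moncat_scheme" (structure) +
  assumes unit_ob: "Unit_ob C \<in> Ob C"
    and tensor_ob: "\<lbrakk>X \<in> Ob C; Y \<in> Ob C\<rbrakk> \<Longrightarrow> X \<boxtimes> Y \<in> Ob C"
    and tensor_in: "\<lbrakk>X \<in> Ob C; Y \<in> Ob C; X' \<in> Ob C; Y' \<in> Ob C; f \<in> Hom C X Y; f' \<in> Hom C X' Y'\<rbrakk>
      \<Longrightarrow> f \<star> f' \<in> Hom C (X \<boxtimes> X') (Y \<boxtimes> Y')"
    and tensor_idn: "\<lbrakk>X \<in> Ob C; Y \<in> Ob C\<rbrakk> \<Longrightarrow> Idn C X \<star> Idn C Y = Idn C (X \<boxtimes> Y)"
    and tensor_cmp: "\<lbrakk>X \<in> Ob C; Y \<in> Ob C; Z \<in> Ob C; X' \<in> Ob C; Y' \<in> Ob C; Z' \<in> Ob C;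
      f \<in> Hom C X Y; g \<in> Hom C Y Z; f' \<in> Hom C X' Y'; g' \<in> Hom C Y' Z'\<rbrakk>
      \<Longrightarrow> (g \<cdot> f) \<star> (g' \<cdot> f') = (g \<star> g') \<cdot> (f \<star> f')"
    and asc_iso: "\<lbrakk>X \<in> Ob C; Y \<in> Ob C; Z \<in> Ob C\<rbrakk>
      \<Longrightarrow> iso_arr C ((X \<boxtimes> Y) \<boxtimes> Z) (X \<boxtimes> (Y \<boxtimes> Z)) (Asc C X Y Z)"
    and asc_natural: "\<lbrakk>X \<in> Ob C; Y \<in> Ob C; Z \<in> Ob C; X' \<in> Ob C; Y' \<in> Ob C; Z' \<in> Ob C;
      f \<in> Hom C X X'; g \<in> Hom C Y Y'; h \<in> Hom C Z Z'\<rbrakk>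
      \<Longrightarrow> Asc C X' Y' Z' \<cdot> ((f \<star> g) \<star> h) = (f \<star> (g \<star> h)) \<cdot> Asc C X Y Z"
    and lun_iso: "X \<in> Ob C \<Longrightarrow> iso_arr C (Unit_ob C \<boxtimes> X) X (Lun C X)"
    and lun_natural: "\<lbrakk>X \<in> Ob C; Y \<in> Ob C; f \<in> Hom C X Y\<rbrakk>
      \<Longrightarrow> Lun C Y \<cdot> (Idn C (Unit_ob C) \<star> f) = f \<cdot> Lun C X"
    and run_iso: "X \<in> Ob C \<Longrightarrow> iso_arr C (X \<boxtimes> Unit_ob C) X (Run C X)"
    and run_natural: "\<lbrakk>X \<in> Ob C; Y \<in> Ob C; f \<in> Hom C X Y\<rbrakk>
      \<Longrightarrow> Run C Y \<cdot> (f \<star> Idn C (Unit_ob C)) = f \<cdot> Run C X"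
    and pentagon: "\<lbrakk>W \<in> Ob C; X \<in> Ob C; Y \<in> Ob C; Z \<in> Ob C\<rbrakk>
      \<Longrightarrow> Asc C W X (Y \<boxtimes> Z) \<cdot> Asc C (W \<boxtimes> X) Y Z =
          (Idn C W \<star> Asc C X Y Z) \<cdot> Asc C W (X \<boxtimes> Y) Z \<cdot> (Asc C W X Y \<star> Idn C Z)"
    and triangle: "\<lbrakk>X \<in> Ob C; Y \<in> Ob C\<rbrakk>
      \<Longrightarrow> (Idn C X \<star> Lun C Y) \<cdot> Asc C X (Unit_ob C) Y = Run C X \<star> Idn C Y"
    and brd_in: "\<lbrakk>X \<in> Ob C; Y \<in> Ob C\<rbrakk> \<Longrightarrow> Brd C X Y \<in> Hom C (X \<boxtimes> Y) (Y \<boxtimes> X)"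
    and brd_natural: "\<lbrakk>X \<in> Ob C; Y \<in> Ob C; X' \<in> Ob C; Y' \<in> Ob C; f \<in> Hom C X X'; g \<in> Hom C Y Y'\<rbrakk>
      \<Longrightarrow> Brd C X' Y' \<cdot> (f \<star> g) = (g \<star> f) \<cdot> Brd C X Y"
    and brd_symmetric: "\<lbrakk>X \<in> Ob C; Y \<in> Ob C\<rbrakk> \<Longrightarrow> Brd C Y X \<cdot> Brd C X Y = Idn C (X \<boxtimes> Y)"
    and brd_unit: "X \<in> Ob C \<Longrightarrow> Lun C X \<cdot> Brd C X (Unit_ob C) = Run C X"
    and hexagon: "\<lbrakk>X \<in> Ob C; Y \<in> Ob C; Z \<in> Ob C\<rbrakk>
      \<Longrightarrow> Asc C Y Z X \<cdot> Brd C X (Y \<boxtimes> Z) \<cdot> Asc C X Y Z =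
          (Idn C Y \<star> Brd C X Z) \<cdot> Asc C Y X Z \<cdot> (Brd C X Y \<star> Idn C Z)"

locale closed_symmetric_monoidal_category =
  symmetric_monoidal_category C for C :: "('o, 'm, 'x) moncat_scheme" (structure) +
  assumes internal_hom: "\<lbrakk>X \<in> Ob C; Y \<in> Ob C\<rbrakk>
      \<Longrightarrow> \<exists>H\<in>Ob C. \<exists>ev\<in>Hom C (H \<boxtimes> X) Y. \<forall>Z\<in>Ob C. \<forall>f\<in>Hom C (Z \<boxtimes> X) Y.
            \<exists>!g. g \<in> Hom C Z H \<and> ev \<cdot> (g \<star> Idn C X) = f"

locale abelian_closed_symmetric_monoidal_category =
  abelian_category C + closed_symmetric_monoidal_category C
  for C :: "('o, 'm, 'x) moncat_scheme" (structure)


section \<open>Commutative monoid objects and modules\<close>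

record ('o, 'm) monoid_object =
  Carr :: 'o
  Mu :: 'm
  Eta :: 'm

definition comm_monoid_object ::
  "('o, 'm, 'x) moncat_scheme \<Rightarrow> ('o, 'm) monoid_object \<Rightarrow> bool" where
  "comm_monoid_object C A \<longleftrightarrow>
     (let X = Carr A; \<mu> = Mu A; \<eta> = Eta A in
       X \<in> Ob C \<and> \<mu> \<in> Hom C (X \<boxtimes>\<^bsub>C\<^esub> X) X \<and> \<eta> \<in> Hom C (Unit_ob C) X \<and>
       \<mu> \<cdot>\<^bsub>C\<^esub> (\<mu> \<star>\<^bsub>C\<^esub> Idn C X) = \<mu> \<cdot>\<^bsub>C\<^esub> (Idn C X \<star>\<^bsub>C\<^esub> \<mu>) \<cdot>\<^bsub>C\<^esub> Asc C X X X \<and>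
       \<mu> \<cdot>\<^bsub>C\<^esub> (\<eta> \<star>\<^bsub>C\<^esub> Idn C X) = Lun C X \<and>
       \<mu> \<cdot>\<^bsub>C\<^esub> (Idn C X \<star>\<^bsub>C\<^esub> \<eta>) = Run C X \<and>
       \<mu> \<cdot>\<^bsub>C\<^esub> Brd C X X = \<mu>)"

definition Comm :: "('o, 'm, 'x) moncat_scheme \<Rightarrow> (('o, 'm) monoid_object, 'm) cat" where
  "Comm C =
     \<lparr>Ob = {A. comm_monoid_object C A},
      Hom = (\<lambda>A B. {f \<in> Hom C (Carr A) (Carr B).
               f \<cdot>\<^bsub>C\<^esub> Mu A = Mu B \<cdot>\<^bsub>C\<^esub> (f \<star>\<^bsub>C\<^esub> f) \<and> f \<cdot>\<^bsub>C\<^esub> Eta A = Eta B}),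
      Idn = (\<lambda>A. Idn C (Carr A)),
      Cmp = Cmp C\<rparr>"

text \<open>A module over \<open>A\<close> is a pair of its underlying object and its action \<open>A \<otimes> X \<rightarrow> X\<close>.\<close>

definition module_object ::
  "('o, 'm, 'x) moncat_scheme \<Rightarrow> ('o, 'm) monoid_object \<Rightarrow> 'o \<times> 'm \<Rightarrow> bool" where
  "module_object C A M \<longleftrightarrow>
     (let X = fst M; \<rho> = snd M in
       X \<in> Ob C \<and> \<rho> \<in> Hom C (Carr A \<boxtimes>\<^bsub>C\<^esub> X) X \<and>
       \<rho> \<cdot>\<^bsub>C\<^esub> (Mu A \<star>\<^bsub>C\<^esub> Idn C X) =
         \<rho> \<cdot>\<^bsub>C\<^esub> (Idn C (Carr A) \<star>\<^bsub>C\<^esub> \<rho>) \<cdot>\<^bsub>C\<^esub> Asc C (Carr A) (Carr A) X \<and>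
       \<rho> \<cdot>\<^bsub>C\<^esub> (Eta A \<star>\<^bsub>C\<^esub> Idn C X) = Lun C X)"

definition Mod ::
  "('o, 'm, 'x) moncat_scheme \<Rightarrow> ('o, 'm) monoid_object \<Rightarrow> ('o \<times> 'm, 'm) abcat" where
  "Mod C A =
     \<lparr>Ob = {M. module_object C A M},
      Hom = (\<lambda>M N. {f \<in> Hom C (fst M) (fst N).
               f \<cdot>\<^bsub>C\<^esub> snd M = snd N \<cdot>\<^bsub>C\<^esub> (Idn C (Carr A) \<star>\<^bsub>C\<^esub> f)}),
      Idn = (\<lambda>M. Idn C (fst M)),
      Cmp = Cmp C,
      Zero = (\<lambda>M N. Zero C (fst M) (fst N)),
      Plus = Plus C\<rparr>"

definition regular_module :: "('o, 'm) monoid_object \<Rightarrow> 'o \<times> 'm" where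
  "regular_module A = (Carr A, Mu A)"

text \<open>The \<open>A\<close>-module underlying an \<open>A\<close>-algebra \<open>l : A \<rightarrow> B\<close>.\<close>

definition algebra_module ::
  "('o, 'm, 'x) moncat_scheme \<Rightarrow> ('o, 'm) monoid_object \<Rightarrow> 'm \<Rightarrow> 'o \<times> 'm" where
  "algebra_module C B l = (Carr B, Mu B \<cdot>\<^bsub>C\<^esub> (l \<star>\<^bsub>C\<^esub> Idn C (Carr B)))"

definition locally_finitely_generated :: "'u itself \<Rightarrow> ('o, 'm, 'x) moncat_scheme \<Rightarrow> bool" where
  "locally_finitely_generated U C \<longleftrightarrow> (\<forall>A\<in>Ob (Comm C). generated_by_fg_subobjects U (Mod C A))"

definition End_ring ::
  "('o, 'm, 'x) moncat_scheme \<Rightarrow> ('o, 'm) monoid_object \<Rightarrow> 'm ring" where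
  "End_ring C A = endomorphism_ring (Mod C A) (regular_module A)"

definition integral_monoid ::
  "('o, 'm, 'x) moncat_scheme \<Rightarrow> ('o, 'm) monoid_object \<Rightarrow> bool" where
  "integral_monoid C A \<longleftrightarrow> domain (End_ring C A)"

definition noetherian_monoid ::
  "'u itself \<Rightarrow> ('o, 'm, 'x) moncat_scheme \<Rightarrow> ('o, 'm) monoid_object \<Rightarrow> bool" where
  "noetherian_monoid U C A \<longleftrightarrow>
     (\<forall>M\<in>Ob (Mod C A).
        finitely_generated U (Mod C A) M \<longleftrightarrow> finitely_presented (Mod C A) (regular_module A) M)"


section \<open>Localisations\<close>

definition nat_cat :: "(nat, unit) cat" where
  "nat_cat = \<lparr>Ob = UNIV, Hom = (\<lambda>m n. {u. m \<le> n}), Idn = (\<lambda>_. ()), Cmp = (\<lambda>_ _. ())\<rparr>"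

text \<open>
  \<open>l : A \<rightarrow> B\<close> is an \<open>A\<^sub>s\<close>: as an \<open>A\<close>-module, \<open>B\<close> is the colimit of \<open>A \<rightarrow> A \<rightarrow> \<dots>\<close> (all arrows \<open>s\<close>)
  such that the first leg is the structure arrow \<open>l\<close>. The latter condition determines the algebra
  structure on the colimit.
\<close>

definition is_localization ::
  "('o, 'm, 'x) moncat_scheme \<Rightarrow> ('o, 'm) monoid_object \<Rightarrow> 'm \<Rightarrow> ('o, 'm) monoid_object \<Rightarrow> 'm \<Rightarrow> bool" where
  "is_localization C A s B l \<longleftrightarrow> B \<in> Ob (Comm C) \<and> l \<in> Hom (Comm C) A B \<and>
     (\<exists>legs. legs 0 = l \<and>
        is_colimit nat_cat (Mod C A) (\<lambda>_. regular_module A)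
          (\<lambda>m n _. s [^]\<^bsub>End_ring C A\<^esub> (n - m)) (algebra_module C B l) legs)"

text \<open>The nonzero elements of \<open>R\<close>, with an arrow \<open>t : s \<rightarrow> s \<otimes> t\<close> for all nonzero \<open>s\<close> and \<open>t\<close>.\<close>

definition divisibility_cat :: "('a, 'x) ring_scheme \<Rightarrow> ('a, 'a) cat" where
  "divisibility_cat R =
     \<lparr>Ob = carrier R - {\<zero>\<^bsub>R\<^esub>},
      Hom = (\<lambda>s s'. {t \<in> carrier R - {\<zero>\<^bsub>R\<^esub>}. s' = s \<otimes>\<^bsub>R\<^esub> t}),
      Idn = (\<lambda>_. \<one>\<^bsub>R\<^esub>),
      Cmp = (\<lambda>u t. t \<otimes>\<^bsub>R\<^esub> u)\<rparr>"

text \<open>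
  \<open>k : A \<rightarrow> K\<close> is a \<open>K(A)\<close>: the colimit of the \<open>A\<^sub>s\<close> along the canonical arrows \<open>A\<^sub>s \<rightarrow> A\<^sub>s\<^sub>t\<close>, which
  are the arrows of \<open>A\<close>-algebras. Filtered colimits of commutative \<open>A\<close>-algebras are computed in
  \<open>A\<close>-modules; the legs being arrows of monoid objects fixes the algebra structure of the colimit.
\<close>

definition is_fraction_algebra ::
  "('o, 'm, 'x) moncat_scheme \<Rightarrow> ('o, 'm) monoid_object \<Rightarrow> ('o, 'm) monoid_object \<Rightarrow> 'm \<Rightarrow> bool" where
  "is_fraction_algebra C A K k \<longleftrightarrow> K \<in> Ob (Comm C) \<and> k \<in> Hom (Comm C) A K \<and>
     (let J = divisibility_cat (End_ring C A) in
       \<exists>B l c legs.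
         (\<forall>s\<in>Ob J. is_localization C A s (B s) (l s)) \<and>
         (\<forall>s\<in>Ob J. \<forall>s'\<in>Ob J. \<forall>t\<in>Hom J s s'.
            c s s' \<in> Hom (Comm C) (B s) (B s') \<and> c s s' \<cdot>\<^bsub>C\<^esub> l s = l s') \<and>
         (\<forall>s\<in>Ob J. legs s \<in> Hom (Comm C) (B s) K) \<and>
         is_colimit J (Mod C A) (\<lambda>s. algebra_module C (B s) (l s)) (\<lambda>s s' t. c s s')
           (algebra_module C K k) legs)"

end

theory Submission
  imports Defs
begin

text \<open>
  Every finitely generated \<open>A\<close>-module is a quotient of some \<open>A\<^sup>n\<close>, because \<open>A\<close> is Noetherian; as all
  modules are unions of finitely generated ones, \<open>A\<close> is a generator of its module category. Hence a
  nonzero \<open>s \<in> E(A)\<close> is monic, and \<open>K(A)\<close> is a filtered colimit of copies of \<open>A\<close> along the monic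
  arrows \<open>s\<close>. Since \<open>A\<close> itself is finitely generated, every arrow \<open>A \<rightarrow> K(A)\<close> is a fraction \<open>a / s\<close>, so
  \<open>E(K(A))\<close> is a field. Moreover \<open>K(A)\<close> generates its module category, because \<open>K(A)\<close>-linear arrows out
  of \<open>K(A)\<close> are the same as \<open>A\<close>-linear arrows out of \<open>A\<close>.

  The remaining argument is linear algebra. For a \<open>K(A)\<close>-module \<open>M\<close> the monomorphisms \<open>K(A)\<^sup>n \<rightarrow> M\<close>
  form a directed family by the exchange argument, and every arrow \<open>K(A) \<rightarrow> M\<close> factors through one of
  them. Their colimit is a subobject of \<open>M\<close>, because filtered colimits commute with kernels, and it is
  all of \<open>M\<close>, because \<open>K(A)\<close> is a generator. If \<open>M\<close> is finitely generated, its identity factors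
  through a member \<open>K(A)\<^sup>n \<rightarrow> M\<close> of the family, which is therefore an isomorphism.
\<close>

section \<open>Arrows with source and target\<close>

text \<open>Only \<open>C\<close> is assumed abelian, so kernels, biproducts and cokernels of
  modules are formed in \<open>C\<close> and then given an action. For kernels and biproducts the
  axioms of an action are tested along jointly monic arrows. For cokernels they are tested on tensor
  products, and there closedness enters: tensoring has a right adjoint, hence preserves cokernels
  and is additive. The Noetherian condition is used in both directions: one gives the generator, the
  other turns the trivial presentation of \<open>A\<close> into finite generation, without which no
  arrow \<open>A \<rightarrow> K(A)\<close> need factor through a stage of the colimit. The
  definition presents \<open>K(A)\<close> as a colimit of sequential colimits; these are merged into
  one diagram over the divisibility order, because finite generation speaks of a single filtered
  diagram of monomorphisms. Finite generation also quantifies only over diagrams indexed by the type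
  \<open>'u\<close>. The denominators and the monomorphisms \<open>K(A)^n \<rightarrow> M\<close>
  therefore have to be shown small and coded in \<open>'u\<close>; for the latter a monomorphism is
  replaced by the list of its components.\<close>

text \<open>
  An arrow bundled with its source and target. Composability of such arrows is a condition on the
  arrows alone, so that chains of composites can be normalised by rewriting.
\<close>

datatype ('o, 'm) arrow = Arrow (src: 'o) (tgt: 'o) (mor: 'm)

lemma arrow_eqI: "\<lbrakk>src F = src G; tgt F = tgt G; mor F = mor G\<rbrakk> \<Longrightarrow> F = G"
  by (cases F; cases G) auto

context category
begin

definition arr :: "('o, 'm) arrow \<Rightarrow> bool" where
  "arr F \<longleftrightarrow> src F \<in> Ob C \<and> tgt F \<in> Ob C \<and> mor F \<in> Hom C (src F) (tgt F)"

definition comp :: "('o, 'm) arrow \<Rightarrow> ('o, 'm) arrow \<Rightarrow> ('o, 'm) arrow"  (infixr "\<bullet>" 70) where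
  "G \<bullet> F = Arrow (src F) (tgt G) (mor G \<cdot> mor F)"

definition ide :: "'o \<Rightarrow> ('o, 'm) arrow" where
  "ide X = Arrow X X (Idn C X)"

lemma comp_simps [simp]: "src (G \<bullet> F) = src F" "tgt (G \<bullet> F) = tgt G" "mor (G \<bullet> F) = mor G \<cdot> mor F"
  by (simp_all add: comp_def)

lemma ide_simps [simp]: "src (ide X) = X" "tgt (ide X) = X" "mor (ide X) = Idn C X"
  by (simp_all add: ide_def)

lemma arr_Arrow [simp]: "arr (Arrow X Y f) \<longleftrightarrow> X \<in> Ob C \<and> Y \<in> Ob C \<and> f \<in> Hom C X Y"
  by (simp add: arr_def)

lemma arr_ide [simp]: "X \<in> Ob C \<Longrightarrow> arr (ide X)"
  by (simp add: arr_def idn_in)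

lemma arr_comp [simp]: "\<lbrakk>arr F; arr G; tgt F = src G\<rbrakk> \<Longrightarrow> arr (G \<bullet> F)"
  unfolding arr_def by (auto intro: cmp_in)

lemma comp_assoc [simp]:
  "\<lbrakk>arr F; arr G; arr H; tgt F = src G; tgt G = src H\<rbrakk> \<Longrightarrow> (H \<bullet> G) \<bullet> F = H \<bullet> (G \<bullet> F)"
  by (rule arrow_eqI)
    (use cmp_assoc[of "src F" "src G" "src H" "tgt H" "mor F" "mor G" "mor H"] in \<open>auto simp: arr_def\<close>)

lemma comp_ide_left [simp]: "\<lbrakk>arr F; tgt F = X\<rbrakk> \<Longrightarrow> ide X \<bullet> F = F"
  by (rule arrow_eqI) (use idn_left[of "src F" "tgt F" "mor F"] in \<open>auto simp: arr_def\<close>)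

lemma comp_ide_right [simp]: "\<lbrakk>arr F; src F = X\<rbrakk> \<Longrightarrow> F \<bullet> ide X = F"
  by (rule arrow_eqI) (use idn_right[of "src F" "tgt F" "mor F"] in \<open>auto simp: arr_def\<close>)

lemma arr_src [simp]: "arr F \<Longrightarrow> src F \<in> Ob C"
  and arr_tgt [simp]: "arr F \<Longrightarrow> tgt F \<in> Ob C"
  and arr_mor: "arr F \<Longrightarrow> mor F \<in> Hom C (src F) (tgt F)"
  by (simp_all add: arr_def)

text \<open>Composites are kept nested to the right, so an equation for \<open>G \<bullet> F\<close>
  does not match inside a longer chain; this is its form with a tail \<open>E\<close>.\<close>

lemma comp_reassoc:
  "\<lbrakk>G \<bullet> F = H; arr E; arr F; arr G; tgt E = src F; tgt F = src G\<rbrakk> \<Longrightarrow> G \<bullet> F \<bullet> E = H \<bullet> E"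
  using comp_assoc by metis

definition iso :: "('o, 'm) arrow \<Rightarrow> bool" where
  "iso F \<longleftrightarrow> arr F \<and> (\<exists>G. arr G \<and> src G = tgt F \<and> tgt G = src F \<and>
     G \<bullet> F = ide (src F) \<and> F \<bullet> G = ide (tgt F))"

lemma iso_arrow: "\<lbrakk>X \<in> Ob C; Y \<in> Ob C; iso_arr C X Y f\<rbrakk> \<Longrightarrow> iso (Arrow X Y f)"
proof -
  assume a: "X \<in> Ob C" "Y \<in> Ob C" "iso_arr C X Y f"
  then obtain g where "g \<in> Hom C Y X" "g \<cdot> f = Idn C X" "f \<cdot> g = Idn C Y"
    by (auto simp: iso_arr_def)
  with a show ?thesis
    unfolding iso_def by (intro conjI exI[of _ "Arrow Y X g"]) (auto simp: arr_def iso_arr_def comp_def ide_def)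
qed

lemma iso_is_arr [simp]: "iso F \<Longrightarrow> arr F"
  by (simp add: iso_def)

lemma iso_epi:
  assumes "iso F" "arr G" "arr H" "src G = tgt F" "src H = tgt F" "G \<bullet> F = H \<bullet> F"
  shows "G = H"
proof -
  obtain E where E: "arr E" "src E = tgt F" "tgt E = src F" "F \<bullet> E = ide (tgt F)"
    using assms(1) unfolding iso_def by auto
  have "G = (G \<bullet> F) \<bullet> E" using assms(1-5) E by simp
  also have "\<dots> = (H \<bullet> F) \<bullet> E" by (simp only: assms(6))
  also have "\<dots> = H" using assms(1-5) E by simp
  finally show ?thesis .
qed

lemma iso_mono:
  assumes "iso F" "arr G" "arr H" "tgt G = src F" "tgt H = src F" "F \<bullet> G = F \<bullet> H"
  shows "G = H"
proof -
  obtain E where E: "arr E" "src E = tgt F" "tgt E = src F" "E \<bullet> F = ide (src F)"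
    using assms(1) unfolding iso_def by auto
  have "G = (E \<bullet> F) \<bullet> G" using assms(1-5) E(4) by simp
  also have "\<dots> = E \<bullet> F \<bullet> G" using assms(1-5) E(1-3) by simp
  also have "\<dots> = E \<bullet> F \<bullet> H" by (simp only: assms(6))
  also have "\<dots> = (E \<bullet> F) \<bullet> H" using assms(1-5) E(1-3) by simp
  also have "\<dots> = H" using assms(1-5) E(4) by simp
  finally show ?thesis .
qed

lemma iso_factor:
  assumes "iso F" "arr G" "src G = src F"
  obtains H where "arr H" "src H = tgt F" "tgt H = tgt G" "H \<bullet> F = G"
proof -
  obtain E where E: "arr E" "src E = tgt F" "tgt E = src F" "E \<bullet> F = ide (src F)"
    using assms(1) unfolding iso_def by auto
  then show ?thesis
    using assms by (intro that[of "G \<bullet> E"]) auto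
qed

end

section \<open>Tensor products of arrows and coherence of the unitors\<close>

context symmetric_monoidal_category
begin

definition tensor :: "('o, 'm) arrow \<Rightarrow> ('o, 'm) arrow \<Rightarrow> ('o, 'm) arrow"  (infixr "\<diamond>" 75) where
  "F \<diamond> G = Arrow (src F \<boxtimes> src G) (tgt F \<boxtimes> tgt G) (mor F \<star> mor G)"

lemma tensor_simps [simp]: "src (F \<diamond> G) = src F \<boxtimes> src G" "tgt (F \<diamond> G) = tgt F \<boxtimes> tgt G"
    "mor (F \<diamond> G) = mor F \<star> mor G"
  by (simp_all add: tensor_def)

declare unit_ob [simp] tensor_ob [simp]

lemma arr_tensor [simp]: "\<lbrakk>arr F; arr G\<rbrakk> \<Longrightarrow> arr (F \<diamond> G)"
  unfolding arr_def by (auto intro: tensor_in)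

lemma ide_tensor [simp]: "\<lbrakk>X \<in> Ob C; Y \<in> Ob C\<rbrakk> \<Longrightarrow> ide X \<diamond> ide Y = ide (X \<boxtimes> Y)"
  by (rule arrow_eqI) (auto simp: tensor_idn)

lemma tensor_comp:
  "\<lbrakk>arr F; arr G; arr F'; arr G'; tgt F = src G; tgt F' = src G'\<rbrakk>
    \<Longrightarrow> (G \<diamond> G') \<bullet> (F \<diamond> F') = (G \<bullet> F) \<diamond> (G' \<bullet> F')"
  by (rule arrow_eqI) (use tensor_cmp[of "src F" "src G" "tgt G" "src F'" "src G'" "tgt G'" "mor F" "mor G" "mor F'" "mor G'"]
      arr_mor[of F] arr_mor[of G] arr_mor[of F'] arr_mor[of G'] in simp_all)

lemma tensor_comp':
  "\<lbrakk>arr F; arr G; arr F'; arr G'; tgt F = src G; tgt F' = src G'; arr E; tgt E = src F \<boxtimes> src F'\<rbrakk>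
    \<Longrightarrow> (G \<diamond> G') \<bullet> (F \<diamond> F') \<bullet> E = ((G \<bullet> F) \<diamond> (G' \<bullet> F')) \<bullet> E"
  by (simp flip: tensor_comp)

definition asc :: "'o \<Rightarrow> 'o \<Rightarrow> 'o \<Rightarrow> ('o, 'm) arrow" where
  "asc X Y Z = Arrow ((X \<boxtimes> Y) \<boxtimes> Z) (X \<boxtimes> (Y \<boxtimes> Z)) (Asc C X Y Z)"

definition lun :: "'o \<Rightarrow> ('o, 'm) arrow" where
  "lun X = Arrow (Unit_ob C \<boxtimes> X) X (Lun C X)"

definition run :: "'o \<Rightarrow> ('o, 'm) arrow" where
  "run X = Arrow (X \<boxtimes> Unit_ob C) X (Run C X)"

definition brd :: "'o \<Rightarrow> 'o \<Rightarrow> ('o, 'm) arrow" where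
  "brd X Y = Arrow (X \<boxtimes> Y) (Y \<boxtimes> X) (Brd C X Y)"

lemma asc_simps [simp]: "src (asc X Y Z) = (X \<boxtimes> Y) \<boxtimes> Z" "tgt (asc X Y Z) = X \<boxtimes> (Y \<boxtimes> Z)"
    "mor (asc X Y Z) = Asc C X Y Z"
  by (simp_all add: asc_def)

lemma lun_simps [simp]: "src (lun X) = Unit_ob C \<boxtimes> X" "tgt (lun X) = X" "mor (lun X) = Lun C X"
  by (simp_all add: lun_def)

lemma run_simps [simp]: "src (run X) = X \<boxtimes> Unit_ob C" "tgt (run X) = X" "mor (run X) = Run C X"
  by (simp_all add: run_def)

lemma brd_simps [simp]: "src (brd X Y) = X \<boxtimes> Y" "tgt (brd X Y) = Y \<boxtimes> X" "mor (brd X Y) = Brd C X Y"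
  by (simp_all add: brd_def)

lemma iso_asc [simp]: "\<lbrakk>X \<in> Ob C; Y \<in> Ob C; Z \<in> Ob C\<rbrakk> \<Longrightarrow> iso (asc X Y Z)"
  unfolding asc_def by (simp add: iso_arrow asc_iso)

lemma iso_lun [simp]: "X \<in> Ob C \<Longrightarrow> iso (lun X)"
  unfolding lun_def by (simp add: iso_arrow lun_iso)

lemma iso_run [simp]: "X \<in> Ob C \<Longrightarrow> iso (run X)"
  unfolding run_def by (simp add: iso_arrow run_iso)

lemma brd_brd [simp]: "\<lbrakk>X \<in> Ob C; Y \<in> Ob C\<rbrakk> \<Longrightarrow> brd Y X \<bullet> brd X Y = ide (X \<boxtimes> Y)"
  by (rule arrow_eqI) (auto simp: brd_symmetric)

lemma arr_brd [simp]: "\<lbrakk>X \<in> Ob C; Y \<in> Ob C\<rbrakk> \<Longrightarrow> arr (brd X Y)"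
  by (simp add: arr_def brd_in)

lemma iso_brd [simp]: "\<lbrakk>X \<in> Ob C; Y \<in> Ob C\<rbrakk> \<Longrightarrow> iso (brd X Y)"
  unfolding iso_def by (intro conjI exI[of _ "brd Y X"]) auto

lemma asc_nat:
  "\<lbrakk>arr F; arr G; arr H\<rbrakk>
    \<Longrightarrow> asc (tgt F) (tgt G) (tgt H) \<bullet> ((F \<diamond> G) \<diamond> H) = (F \<diamond> (G \<diamond> H)) \<bullet> asc (src F) (src G) (src H)"
  by (rule arrow_eqI) (simp_all add: asc_natural arr_mor)

lemma lun_nat: "arr F \<Longrightarrow> lun (tgt F) \<bullet> (ide (Unit_ob C) \<diamond> F) = F \<bullet> lun (src F)"
  by (rule arrow_eqI) (simp_all add: lun_natural arr_mor)

lemma run_nat: "arr F \<Longrightarrow> run (tgt F) \<bullet> (F \<diamond> ide (Unit_ob C)) = F \<bullet> run (src F)"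
  by (rule arrow_eqI) (simp_all add: run_natural arr_mor)

lemma brd_nat: "\<lbrakk>arr F; arr G\<rbrakk> \<Longrightarrow> brd (tgt F) (tgt G) \<bullet> (F \<diamond> G) = (G \<diamond> F) \<bullet> brd (src F) (src G)"
  by (rule arrow_eqI) (simp_all add: brd_natural arr_mor)

lemma pentagon_arr:
  "\<lbrakk>W \<in> Ob C; X \<in> Ob C; Y \<in> Ob C; Z \<in> Ob C\<rbrakk>
    \<Longrightarrow> asc W X (Y \<boxtimes> Z) \<bullet> asc (W \<boxtimes> X) Y Z =
        (ide W \<diamond> asc X Y Z) \<bullet> asc W (X \<boxtimes> Y) Z \<bullet> (asc W X Y \<diamond> ide Z)"
  by (rule arrow_eqI) (auto simp: pentagon)

lemma triangle_arr:
  "\<lbrakk>X \<in> Ob C; Y \<in> Ob C\<rbrakk> \<Longrightarrow> (ide X \<diamond> lun Y) \<bullet> asc X (Unit_ob C) Y = run X \<diamond> ide Y"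
  by (rule arrow_eqI) (auto simp: triangle)

text \<open>The right unitor is a natural isomorphism from tensoring with the unit to the identity
  functor, so an arrow can be recovered from its tensor product with the unit.\<close>

lemma tensor_unit_faithful:
  assumes "arr F" "arr G" "src F = src G" "tgt F = tgt G" "F \<diamond> ide (Unit_ob C) = G \<diamond> ide (Unit_ob C)"
  shows "F = G"
proof (rule iso_epi)
  show "iso (run (src F))" using assms(1) by simp
  show "F \<bullet> run (src F) = G \<bullet> run (src F)"
    using run_nat[OF assms(1)] run_nat[OF assms(2)] assms(3-5) by metis
qed (use assms(1-4) in simp_all)

lemma unit_tensor_faithful:
  assumes "arr F" "arr G" "src F = src G" "tgt F = tgt G" "ide (Unit_ob C) \<diamond> F = ide (Unit_ob C) \<diamond> G"
  shows "F = G"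
proof (rule iso_epi)
  show "iso (lun (src F))" using assms(1) by simp
  show "F \<bullet> lun (src F) = G \<bullet> lun (src F)"
    using lun_nat[OF assms(1)] lun_nat[OF assms(2)] assms(3-5) by metis
qed (use assms(1-4) in simp_all)

text \<open>The two coherence facts below follow from the axioms by an argument of Kelly.\<close>

lemma run_tensor:
  assumes X: "X \<in> Ob C" and Y: "Y \<in> Ob C"
  shows "run (X \<boxtimes> Y) = (ide X \<diamond> run Y) \<bullet> asc X Y (Unit_ob C)"
proof -
  let ?I = "Unit_ob C"
  \<comment> \<open>Both sides are compared after tensoring with \<open>?I\<close>, which is
    faithful, and composing with the invertible \<open>asc X Y ?I\<close>. In this form the triangle
    for \<open>X \<boxtimes> Y\<close> and \<open>?I\<close> applies, and then the pentagon.\<close>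
  have "asc X Y ?I \<bullet> (run (X \<boxtimes> Y) \<diamond> ide ?I) =
      asc X Y ?I \<bullet> ((ide X \<diamond> ide Y) \<diamond> lun ?I) \<bullet> asc (X \<boxtimes> Y) ?I ?I"
    using X Y by (simp add: triangle_arr)
  also have "\<dots> = (ide X \<diamond> (ide Y \<diamond> lun ?I)) \<bullet> asc X Y (?I \<boxtimes> ?I) \<bullet> asc (X \<boxtimes> Y) ?I ?I"
    using X Y asc_nat[of "ide X" "ide Y" "lun ?I"]
    by (subst (1 2) comp_assoc[symmetric]) simp_all
  also have "\<dots> = (ide X \<diamond> ((ide Y \<diamond> lun ?I) \<bullet> asc Y ?I ?I)) \<bullet> asc X (Y \<boxtimes> ?I) ?I \<bullet> (asc X Y ?I \<diamond> ide ?I)"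
    using X Y by (simp add: pentagon_arr tensor_comp')
  also have "\<dots> = ((ide X \<diamond> (run Y \<diamond> ide ?I)) \<bullet> asc X (Y \<boxtimes> ?I) ?I) \<bullet> (asc X Y ?I \<diamond> ide ?I)"
    using X Y by (simp add: triangle_arr)
  also have "\<dots> = (asc X Y ?I \<bullet> ((ide X \<diamond> run Y) \<diamond> ide ?I)) \<bullet> (asc X Y ?I \<diamond> ide ?I)"
    using X Y asc_nat[of "ide X" "run Y" "ide ?I"] by simp
  also have "\<dots> = asc X Y ?I \<bullet> (((ide X \<diamond> run Y) \<bullet> asc X Y ?I) \<diamond> ide ?I)"
    using X Y by (simp add: tensor_comp)
  finally have "run (X \<boxtimes> Y) \<diamond> ide ?I = ((ide X \<diamond> run Y) \<bullet> asc X Y ?I) \<diamond> ide ?I"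
    using X Y by - (rule iso_mono[of "asc X Y ?I"], simp_all)
  then show ?thesis
    using X Y by - (rule tensor_unit_faithful, simp_all)
qed

lemma lun_unit: "lun (Unit_ob C) = run (Unit_ob C)"
proof -
  let ?I = "Unit_ob C"
  \<comment> \<open>Naturality of the right unitor at the arrow \<open>run ?I\<close> itself;
    cancelling \<open>run ?I\<close> identifies the unitor of \<open>?I \<boxtimes> ?I\<close>,
    which \<open>run_tensor\<close> and the triangle express in two ways.\<close>
  have "run ?I \<bullet> run (?I \<boxtimes> ?I) = run ?I \<bullet> (run ?I \<diamond> ide ?I)"
    using run_nat[of "run ?I"] by simp
  then have "run (?I \<boxtimes> ?I) = run ?I \<diamond> ide ?I"
    by - (rule iso_mono[of "run ?I"], simp_all)
  then have "(ide ?I \<diamond> run ?I) \<bullet> asc ?I ?I ?I = (ide ?I \<diamond> lun ?I) \<bullet> asc ?I ?I ?I"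
    by (simp add: run_tensor triangle_arr)
  then have "ide ?I \<diamond> run ?I = ide ?I \<diamond> lun ?I"
    by - (rule iso_epi[of "asc ?I ?I ?I"], simp_all)
  then show ?thesis
    by - (rule unit_tensor_faithful, simp_all)
qed

end

section \<open>Additive structure\<close>

context preadditive_category
begin

lemma zero_in [simp]: "\<lbrakk>X \<in> Ob C; Y \<in> Ob C\<rbrakk> \<Longrightarrow> Zero C X Y \<in> Hom C X Y"
  using comm_group.axioms(2)[OF hom_comm_group, THEN group.is_monoid, THEN monoid.one_closed]
  by (fastforce simp: hom_group_def)

lemma plus_in: "\<lbrakk>X \<in> Ob C; Y \<in> Ob C; f \<in> Hom C X Y; g \<in> Hom C X Y\<rbrakk> \<Longrightarrow> Plus C f g \<in> Hom C X Y"
  using comm_group.axioms(2)[OF hom_comm_group, THEN group.is_monoid, THEN monoid.m_closed, of X Y f g]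
  by (simp add: hom_group_def)

lemma plus_assoc_hom:
  "\<lbrakk>X \<in> Ob C; Y \<in> Ob C; f \<in> Hom C X Y; g \<in> Hom C X Y; h \<in> Hom C X Y\<rbrakk>
    \<Longrightarrow> Plus C (Plus C f g) h = Plus C f (Plus C g h)"
  using comm_group.axioms(2)[OF hom_comm_group, THEN group.is_monoid, THEN monoid.m_assoc, of X Y f g h]
  by (simp add: hom_group_def)

lemma plus_comm_hom:
  "\<lbrakk>X \<in> Ob C; Y \<in> Ob C; f \<in> Hom C X Y; g \<in> Hom C X Y\<rbrakk> \<Longrightarrow> Plus C f g = Plus C g f"
  using comm_group.axioms(1)[OF hom_comm_group, THEN comm_monoid.m_comm, of X Y f g]
  by (simp add: hom_group_def)

lemma plus_zero_left: "\<lbrakk>X \<in> Ob C; Y \<in> Ob C; f \<in> Hom C X Y\<rbrakk> \<Longrightarrow> Plus C (Zero C X Y) f = f"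
  using comm_group.axioms(2)[OF hom_comm_group, THEN group.is_monoid, THEN monoid.l_one, of X Y f]
  by (simp add: hom_group_def)

lemma negative_hom:
  assumes "X \<in> Ob C" "Y \<in> Ob C" "f \<in> Hom C X Y"
  obtains g where "g \<in> Hom C X Y" "Plus C g f = Zero C X Y" "Plus C f g = Zero C X Y"
  using group.l_inv[OF comm_group.axioms(2)[OF hom_comm_group[OF assms(1,2)]], of f]
    group.r_inv[OF comm_group.axioms(2)[OF hom_comm_group[OF assms(1,2)]], of f]
    group.inv_closed[OF comm_group.axioms(2)[OF hom_comm_group[OF assms(1,2)]], of f] assms(3)
  by (auto simp: hom_group_def)

lemma plus_zero_right: "\<lbrakk>X \<in> Ob C; Y \<in> Ob C; f \<in> Hom C X Y\<rbrakk> \<Longrightarrow> Plus C f (Zero C X Y) = f"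
  using plus_zero_left plus_comm_hom zero_in by metis

lemma plus_cancel_right:
  assumes "X \<in> Ob C" "Y \<in> Ob C" "f \<in> Hom C X Y" "g \<in> Hom C X Y" "h \<in> Hom C X Y"
    "Plus C f h = Plus C g h"
  shows "f = g"
proof -
  obtain n where n: "n \<in> Hom C X Y" "Plus C h n = Zero C X Y"
    using negative_hom assms by metis
  have "f = Plus C (Plus C f h) n"
    using plus_assoc_hom[of X Y f h n] plus_zero_right[of X Y f] assms(1-5) n by simp
  also have "\<dots> = Plus C (Plus C g h) n"
    by (simp only: assms(6))
  also have "\<dots> = g"
    using plus_assoc_hom[of X Y g h n] plus_zero_right[of X Y g] assms(1-5) n by simp
  finally show ?thesis .
qed

text \<open>Since \<open>0 + 0 = 0\<close>, the composite equals its own double, and cancellation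
  makes it zero.\<close>

lemma cmp_zero_right:
  assumes "X \<in> Ob C" "Y \<in> Ob C" "Z \<in> Ob C" "h \<in> Hom C Y Z"
  shows "h \<cdot> Zero C X Y = Zero C X Z"
proof (rule plus_cancel_right)
  show "Plus C (h \<cdot> Zero C X Y) (h \<cdot> Zero C X Y) = Plus C (Zero C X Z) (h \<cdot> Zero C X Y)"
    using assms cmp_in[of X Y Z "Zero C X Y" h] cmp_plus_right[of X Y Z "Zero C X Y" "Zero C X Y" h]
    by (simp add: plus_zero_left)
qed (use assms cmp_in[of X Y Z "Zero C X Y" h] in simp_all)

lemma cmp_zero_left:
  assumes "X \<in> Ob C" "Y \<in> Ob C" "Z \<in> Ob C" "f \<in> Hom C X Y"
  shows "Zero C Y Z \<cdot> f = Zero C X Z"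
proof (rule plus_cancel_right)
  show "Plus C (Zero C Y Z \<cdot> f) (Zero C Y Z \<cdot> f) = Plus C (Zero C X Z) (Zero C Y Z \<cdot> f)"
    using assms cmp_in[of X Y Z f "Zero C Y Z"] cmp_plus_left[of X Y Z f "Zero C Y Z" "Zero C Y Z"]
    by (simp add: plus_zero_left)
qed (use assms cmp_in[of X Y Z f "Zero C Y Z"] in simp_all)

lemma difference_hom:
  assumes "X \<in> Ob C" "Y \<in> Ob C" "f \<in> Hom C X Y" "g \<in> Hom C X Y"
  obtains d where "d \<in> Hom C X Y" "Plus C d g = f"
proof -
  obtain n where n: "n \<in> Hom C X Y" "Plus C n g = Zero C X Y"
    using negative_hom assms by metis
  show ?thesis
    using that[of "Plus C f n"] n assms plus_in plus_assoc_hom plus_zero_right by metis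
qed

text \<open>Two arrows with the same composite differ by an arrow \<open>d\<close> that
  \<open>f\<close> kills.\<close>

lemma monic_iff_kernel_zero:
  assumes X: "X \<in> Ob C" and Y: "Y \<in> Ob C" and f: "f \<in> Hom C X Y"
  shows "monic C X Y f \<longleftrightarrow>
    (\<forall>W\<in>Ob C. \<forall>g\<in>Hom C W X. f \<cdot> g = Zero C W Y \<longrightarrow> g = Zero C W X)" (is "_ \<longleftrightarrow> ?R")
proof
  assume "monic C X Y f"
  then show ?R
    unfolding monic_def using cmp_zero_right X Y f zero_in by metis
next
  assume R: ?R
  show "monic C X Y f"
    unfolding monic_def
  proof (intro conjI f ballI impI)
    fix W g h
    assume W: "W \<in> Ob C" and g: "g \<in> Hom C W X" and h: "h \<in> Hom C W X" and eq: "f \<cdot> g = f \<cdot> h"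
    obtain d where d: "d \<in> Hom C W X" "Plus C d h = g"
      using difference_hom W X g h by metis
    have fd: "f \<cdot> d \<in> Hom C W Y" and fh: "f \<cdot> h \<in> Hom C W Y"
      using cmp_in W X Y f d h by metis+
    have "Plus C (f \<cdot> d) (f \<cdot> h) = f \<cdot> g"
      using cmp_plus_right[OF W X Y d(1) h f] d by simp
    also have "\<dots> = Plus C (Zero C W Y) (f \<cdot> h)"
      using plus_zero_left[OF W Y fh] eq by simp
    finally have "f \<cdot> d = Zero C W Y"
      using plus_cancel_right[OF W Y fd _ fh] W Y by simp
    then have "d = Zero C W X"
      using R W d by blast
    then show "g = h"
      using d plus_zero_left W X h by metis
  qed
qed

definition plus :: "('o, 'm) arrow \<Rightarrow> ('o, 'm) arrow \<Rightarrow> ('o, 'm) arrow"  (infixl "\<boxplus>" 65) where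
  "F \<boxplus> G = Arrow (src F) (tgt F) (Plus C (mor F) (mor G))"

definition zer :: "'o \<Rightarrow> 'o \<Rightarrow> ('o, 'm) arrow" where
  "zer X Y = Arrow X Y (Zero C X Y)"

lemma plus_simps [simp]: "src (F \<boxplus> G) = src F" "tgt (F \<boxplus> G) = tgt F" "mor (F \<boxplus> G) = Plus C (mor F) (mor G)"
  by (simp_all add: plus_def)

lemma zer_simps [simp]: "src (zer X Y) = X" "tgt (zer X Y) = Y" "mor (zer X Y) = Zero C X Y"
  by (simp_all add: zer_def)

lemma arr_zer [simp]: "\<lbrakk>X \<in> Ob C; Y \<in> Ob C\<rbrakk> \<Longrightarrow> arr (zer X Y)"
  by (simp add: arr_def)

lemma arr_plus [simp]: "\<lbrakk>arr F; arr G; src F = src G; tgt F = tgt G\<rbrakk> \<Longrightarrow> arr (F \<boxplus> G)"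
  unfolding arr_def by (simp add: plus_in)

lemma plus_zer [simp]: "\<lbrakk>arr F; src F = X; tgt F = Y\<rbrakk> \<Longrightarrow> F \<boxplus> zer X Y = F"
  by (rule arrow_eqI) (auto simp: plus_zero_right arr_mor)

lemma zer_plus [simp]: "\<lbrakk>arr F; src F = X; tgt F = Y\<rbrakk> \<Longrightarrow> zer X Y \<boxplus> F = F"
  by (rule arrow_eqI) (auto simp: plus_zero_left arr_mor)

lemma comp_zer [simp]: "\<lbrakk>arr F; src F = Y; X \<in> Ob C\<rbrakk> \<Longrightarrow> F \<bullet> zer X Y = zer X (tgt F)"
  by (rule arrow_eqI) (auto intro!: cmp_zero_right simp: arr_mor)

lemma zer_comp [simp]: "\<lbrakk>arr F; tgt F = Y; Z \<in> Ob C\<rbrakk> \<Longrightarrow> zer Y Z \<bullet> F = zer (src F) Z"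
  by (rule arrow_eqI) (auto intro!: cmp_zero_left simp: arr_mor)

lemma comp_plus:
  "\<lbrakk>arr F; arr G; arr H; src F = src G; tgt F = tgt G; tgt G = src H\<rbrakk>
    \<Longrightarrow> H \<bullet> (F \<boxplus> G) = (H \<bullet> F) \<boxplus> (H \<bullet> G)"
  by (rule arrow_eqI)
    (use cmp_plus_right[of "src F" "tgt F" "tgt H" "mor F" "mor G" "mor H"]
      arr_mor[of F] arr_mor[of G] arr_mor[of H] in simp_all)

lemma plus_comp:
  "\<lbrakk>arr F; arr G; arr H; src G = src H; tgt G = tgt H; tgt F = src G\<rbrakk>
    \<Longrightarrow> (G \<boxplus> H) \<bullet> F = (G \<bullet> F) \<boxplus> (H \<bullet> F)"
  by (rule arrow_eqI)
    (use cmp_plus_left[of "src F" "tgt F" "tgt G" "mor F" "mor G" "mor H"]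
      arr_mor[of F] arr_mor[of G] arr_mor[of H] in simp_all)

lemma plus_cancel:
  assumes "arr F" "arr G" "arr H" "src F = src H" "src G = src H" "tgt F = tgt H" "tgt G = tgt H"
    "F \<boxplus> H = G \<boxplus> H"
  shows "F = G"
  by (rule arrow_eqI)
    (use assms plus_cancel_right[of "src H" "tgt H" "mor F" "mor G" "mor H"]
      arr_mor[of F] arr_mor[of G] arr_mor[of H] arrow.inject[of _ _ "Plus C (mor F) (mor H)"]
      in \<open>simp_all add: plus_def\<close>)

lemma plus_comm: "\<lbrakk>arr F; arr G; src F = src G; tgt F = tgt G\<rbrakk> \<Longrightarrow> F \<boxplus> G = G \<boxplus> F"
  by (rule arrow_eqI) (use plus_comm_hom[of "src F" "tgt F" "mor F" "mor G"] arr_mor[of F] arr_mor[of G] in simp_all)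

text \<open>Families rather than single arrows, so that one notion covers the empty family at a zero
  object, the two injections of a biproduct and a single cokernel.\<close>

definition jointly_epic :: "'i set \<Rightarrow> ('i \<Rightarrow> ('o, 'm) arrow) \<Rightarrow> 'o \<Rightarrow> bool" where
  "jointly_epic I F P \<longleftrightarrow> (\<forall>G H. arr G \<longrightarrow> arr H \<longrightarrow> src G = P \<longrightarrow> src H = P \<longrightarrow> tgt G = tgt H \<longrightarrow>
     (\<forall>a\<in>I. G \<bullet> F a = H \<bullet> F a) \<longrightarrow> G = H)"

definition jointly_monic :: "'i set \<Rightarrow> ('i \<Rightarrow> ('o, 'm) arrow) \<Rightarrow> 'o \<Rightarrow> bool" where
  "jointly_monic I F P \<longleftrightarrow> (\<forall>G H. arr G \<longrightarrow> arr H \<longrightarrow> tgt G = P \<longrightarrow> tgt H = P \<longrightarrow> src G = src H \<longrightarrow>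
     (\<forall>a\<in>I. F a \<bullet> G = F a \<bullet> H) \<longrightarrow> G = H)"

lemma jointly_epicD:
  "\<lbrakk>jointly_epic I F P; arr G; arr H; src G = P; src H = P; tgt G = tgt H; \<And>a. a \<in> I \<Longrightarrow> G \<bullet> F a = H \<bullet> F a\<rbrakk>
    \<Longrightarrow> G = H"
  by (auto simp: jointly_epic_def)

lemma jointly_monicD:
  "\<lbrakk>jointly_monic I F P; arr G; arr H; tgt G = P; tgt H = P; src G = src H; \<And>a. a \<in> I \<Longrightarrow> F a \<bullet> G = F a \<bullet> H\<rbrakk>
    \<Longrightarrow> G = H"
  by (auto simp: jointly_monic_def)

end

text \<open>The equations are those of the axiom \<open>biproducts\<close>; the vanishing of the
  mixed composites is derived from them below.\<close>

locale biproduct = preadditive_category C for C :: "('o, 'm, 'x) abcat_scheme" (structure) +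
  fixes X Y P :: 'o and i j p q :: "('o, 'm) arrow"
  assumes ob: "X \<in> Ob C" "Y \<in> Ob C" "P \<in> Ob C"
    and arr [simp]: "arr i" "arr j" "arr p" "arr q"
    and src_tgt [simp]: "src i = X" "tgt i = P" "src j = Y" "tgt j = P"
      "src p = P" "tgt p = X" "src q = P" "tgt q = Y"
    and pi [simp]: "p \<bullet> i = ide X" and qj [simp]: "q \<bullet> j = ide Y"
    and sum: "(i \<bullet> p) \<boxplus> (j \<bullet> q) = ide P"
begin

declare ob [simp]

lemma decompose: "\<lbrakk>arr F; tgt F = P\<rbrakk> \<Longrightarrow> (i \<bullet> p \<bullet> F) \<boxplus> (j \<bullet> q \<bullet> F) = F"
  using plus_comp[of F "i \<bullet> p" "j \<bullet> q"] by (simp add: sum)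

lemma codecompose: "\<lbrakk>arr F; src F = P\<rbrakk> \<Longrightarrow> (F \<bullet> i \<bullet> p) \<boxplus> (F \<bullet> j \<bullet> q) = F"
  using comp_plus[of "i \<bullet> p" "j \<bullet> q" F] by (simp add: sum)

text \<open>Applying \<open>q\<close> to the decomposition of \<open>i\<close> gives
  \<open>q \<bullet> i = (q \<bullet> i) \<boxplus> (q \<bullet> i)\<close>, because
  \<open>p \<bullet> i\<close> and \<open>q \<bullet> j\<close> are identities.\<close>

lemma qi [simp]: "q \<bullet> i = zer X Y"
proof -
  have "(q \<bullet> i) \<boxplus> (q \<bullet> i) = q \<bullet> i"
    using decompose[of i] comp_plus[of "i \<bullet> p \<bullet> i" "j \<bullet> q \<bullet> i" q] comp_reassoc[OF qj, of "q \<bullet> i"]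
    by simp
  then show ?thesis
    using plus_cancel[of "q \<bullet> i" "zer X Y" "q \<bullet> i"] by simp
qed

lemma pj [simp]: "p \<bullet> j = zer Y X"
proof -
  have "(p \<bullet> j) \<boxplus> (p \<bullet> j) = p \<bullet> j"
    using decompose[of j] comp_plus[of "i \<bullet> p \<bullet> j" "j \<bullet> q \<bullet> j" p] comp_reassoc[OF pi, of "p \<bullet> j"]
    by simp
  then show ?thesis
    using plus_cancel[of "p \<bullet> j" "zer Y X" "p \<bullet> j"] by simp
qed

lemma monic_pq: "jointly_monic (UNIV :: bool set) (\<lambda>b. if b then p else q) P"
  unfolding jointly_monic_def
proof (intro allI impI)
  fix G H
  assume a: "arr G" "arr H" "tgt G = P" "tgt H = P" "src G = src H"
    "\<forall>b\<in>UNIV. (if b then p else q) \<bullet> G = (if b then p else q) \<bullet> H"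
  have eq: "p \<bullet> G = p \<bullet> H" "q \<bullet> G = q \<bullet> H"
    using a(6)[rule_format, of True] a(6)[rule_format, of False] by simp_all
  show "G = H"
    using decompose[OF a(1,3)] decompose[OF a(2,4)] unfolding eq by (rule trans[OF sym])
qed

lemma epic_ij: "jointly_epic (UNIV :: bool set) (\<lambda>b. if b then i else j) P"
  unfolding jointly_epic_def
proof (intro allI impI)
  fix G H
  assume a: "arr G" "arr H" "src G = P" "src H = P" "tgt G = tgt H"
    "\<forall>b\<in>UNIV. G \<bullet> (if b then i else j) = H \<bullet> (if b then i else j)"
  have eq: "G \<bullet> i = H \<bullet> i" "G \<bullet> j = H \<bullet> j"
    using a(6)[rule_format, of True] a(6)[rule_format, of False] by simp_all
  have "G \<bullet> i \<bullet> p = H \<bullet> i \<bullet> p" "G \<bullet> j \<bullet> q = H \<bullet> j \<bullet> q"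
    using comp_reassoc[OF eq(1), of p] comp_reassoc[OF eq(2), of q] a(1-4) by simp_all
  then show "G = H"
    using codecompose[OF a(1,3)] codecompose[OF a(2,4)] by metis
qed

end

context abelian_category
begin

text \<open>Phrased through the empty family, so that the results on tensoring and on transporting
  actions along joint families apply to zero objects too.\<close>

lemma zero_object_exists:
  obtains Z where "Z \<in> Ob C" "jointly_epic ({} :: unit set) F Z" "jointly_monic ({} :: unit set) F Z"
    "\<And>X f g. \<lbrakk>X \<in> Ob C; f \<in> Hom C X Z; g \<in> Hom C X Z\<rbrakk> \<Longrightarrow> f = g"
    "\<And>X f g. \<lbrakk>X \<in> Ob C; f \<in> Hom C Z X; g \<in> Hom C Z X\<rbrakk> \<Longrightarrow> f = g"
proof -
  obtain Z where Z1: "Z \<in> Ob C" and "\<forall>X\<in>Ob C. (\<exists>!f. f \<in> Hom C X Z) \<and> (\<exists>!f. f \<in> Hom C Z X)"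
    using zero_object by (elim bexE)
  then have Z: "Z \<in> Ob C" "\<And>X. X \<in> Ob C \<Longrightarrow> (\<exists>!f. f \<in> Hom C X Z) \<and> (\<exists>!f. f \<in> Hom C Z X)"
    by (rule_tac Z1, drule_tac bspec)
  show ?thesis
  proof (rule that[OF Z(1)])
    show "jointly_epic {} F Z"
      unfolding jointly_epic_def
    proof (intro allI impI)
      fix G H assume G: "arr G" "arr H" "src G = Z" "src H = Z" "tgt G = tgt H"
      show "G = H"
        using Z(2)[of "tgt G"] arr_mor[OF G(1)] arr_mor[OF G(2)] arr_tgt[OF G(1)] G(3-5)
        by (metis arrow_eqI)
    qed
    show "jointly_monic {} F Z"
      unfolding jointly_monic_def
    proof (intro allI impI)
      fix G H assume G: "arr G" "arr H" "tgt G = Z" "tgt H = Z" "src G = src H"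
      show "G = H"
        using Z(2)[of "src G"] arr_mor[OF G(1)] arr_mor[OF G(2)] arr_src[OF G(1)] G(3-5)
        by (metis arrow_eqI)
    qed
  qed (use Z(2) in blast)+
qed

lemma biproduct_exists:
  assumes "X \<in> Ob C" "Y \<in> Ob C"
  obtains P i j p q where "biproduct C X Y P i j p q"
proof -
  obtain P i j p q where P: "P\<in>Ob C" "i\<in>Hom C X P" "j\<in>Hom C Y P" "p\<in>Hom C P X" "q\<in>Hom C P Y"
        "p \<cdot> i = Idn C X" "q \<cdot> j = Idn C Y" "Plus C (i \<cdot> p) (j \<cdot> q) = Idn C P"
    using biproducts[OF assms] by blast
  have "biproduct C X Y P (Arrow X P i) (Arrow Y P j) (Arrow P X p) (Arrow P Y q)"
    using P assms by unfold_locales (simp_all add: arr_def comp_def ide_def plus_def)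
  then show ?thesis using that by blast
qed

end

section \<open>Consequences of closedness: tensoring is additive and right exact\<close>

context abelian_closed_symmetric_monoidal_category
begin

text \<open>The internal hom \<open>H\<close> in the form of a universal arrow: \<open>ev\<close> is
  evaluation, the first clause is currying and the second is its uniqueness.\<close>

lemma curry:
  assumes "X \<in> Ob C" "Y \<in> Ob C"
  obtains ev where "arr ev" "\<exists>H. src ev = H \<boxtimes> X \<and> H \<in> Ob C \<and>
    (\<forall>F. arr F \<longrightarrow> tgt F = Y \<longrightarrow> (\<forall>Z\<in>Ob C. src F = Z \<boxtimes> X \<longrightarrow>
        (\<exists>G. arr G \<and> src G = Z \<and> tgt G = H \<and> ev \<bullet> (G \<diamond> ide X) = F))) \<and>
    (\<forall>G G'. arr G \<longrightarrow> arr G' \<longrightarrow> src G = src G' \<longrightarrow> tgt G = H \<longrightarrow> tgt G' = H \<longrightarrow>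
        ev \<bullet> (G \<diamond> ide X) = ev \<bullet> (G' \<diamond> ide X) \<longrightarrow> G = G')" "tgt ev = Y"
proof -
  obtain H ev where H: "H \<in> Ob C" "ev \<in> Hom C (H \<boxtimes> X) Y"
    and un: "\<And>Z f. Z \<in> Ob C \<Longrightarrow> f \<in> Hom C (Z \<boxtimes> X) Y \<Longrightarrow> \<exists>!g. g \<in> Hom C Z H \<and> ev \<cdot> (g \<star> Idn C X) = f"
    using internal_hom[OF assms] by blast
  let ?ev = "Arrow (H \<boxtimes> X) Y ev"
  have ev: "arr ?ev"
    using H assms by (simp add: arr_def)
  show ?thesis
  proof (rule that[of ?ev], rule ev, intro exI[of _ H] conjI allI impI ballI)
    fix F Z assume F: "arr F" "tgt F = Y" "Z \<in> Ob C" "src F = Z \<boxtimes> X"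
    obtain g where g: "g \<in> Hom C Z H" "ev \<cdot> (g \<star> Idn C X) = mor F"
      using un[of Z "mor F"] F arr_mor[of F] by auto
    show "\<exists>G. arr G \<and> src G = Z \<and> tgt G = H \<and> ?ev \<bullet> (G \<diamond> ide X) = F"
      using g F H by (intro exI[of _ "Arrow Z H g"]) (auto simp: arr_def intro: arrow_eqI)
  next
    fix G G' assume G: "arr G" "arr G'" "src G = src G'" "tgt G = H" "tgt G' = H"
      and eq: "?ev \<bullet> (G \<diamond> ide X) = ?ev \<bullet> (G' \<diamond> ide X)"
    have "arr (?ev \<bullet> (G \<diamond> ide X))"
      using ev G assms by simp
    then have "ev \<cdot> (mor G \<star> Idn C X) \<in> Hom C (src G \<boxtimes> X) Y"
      using arr_mor by fastforce
    moreover have "ev \<cdot> (mor G \<star> Idn C X) = ev \<cdot> (mor G' \<star> Idn C X)"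
      using arg_cong[OF eq, of mor] by simp
    ultimately have "mor G = mor G'"
      using un[of "src G" "ev \<cdot> (mor G \<star> Idn C X)"] G arr_mor[of G] arr_mor[of G'] arr_src[of G] by metis
    then show "G = G'"
      using G by (intro arrow_eqI) simp_all
  qed (use H in simp_all)
qed

text \<open>Tensoring with \<open>X\<close> is a left adjoint: arrows out of
  \<open>P \<boxtimes> X\<close> are curried to arrows out of \<open>P\<close>, where the family
  \<open>F\<close> separates them.\<close>

lemma jointly_epic_tensor_left:
  assumes epic: "jointly_epic I F P" and F: "\<And>a. a \<in> I \<Longrightarrow> arr (F a) \<and> tgt (F a) = P" and X: "X \<in> Ob C" and P: "P \<in> Ob C"
  shows "jointly_epic I (\<lambda>a. F a \<diamond> ide X) (P \<boxtimes> X)"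
  unfolding jointly_epic_def
proof (intro allI impI)
  fix G G' assume G: "arr G" "arr G'" "src G = P \<boxtimes> X" "src G' = P \<boxtimes> X" "tgt G = tgt G'"
    and eq: "\<forall>a\<in>I. G \<bullet> (F a \<diamond> ide X) = G' \<bullet> (F a \<diamond> ide X)"
  obtain ev H where ev: "arr ev" "src ev = H \<boxtimes> X" "H \<in> Ob C" "tgt ev = tgt G"
    and ex: "\<And>F Z. \<lbrakk>arr F; tgt F = tgt G; Z \<in> Ob C; src F = Z \<boxtimes> X\<rbrakk> \<Longrightarrow> \<exists>G. arr G \<and> src G = Z \<and> tgt G = H \<and> ev \<bullet> (G \<diamond> ide X) = F"
    and un: "\<And>G G'. \<lbrakk>arr G; arr G'; src G = src G'; tgt G = H; tgt G' = H; ev \<bullet> (G \<diamond> ide X) = ev \<bullet> (G' \<diamond> ide X)\<rbrakk> \<Longrightarrow> G = G'"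
    by (rule curry[OF X, of "tgt G"]) (use G in auto)
  obtain E where E: "arr E" "src E = P" "tgt E = H" "ev \<bullet> (E \<diamond> ide X) = G"
    using ex[of G P] G P by auto
  obtain E' where E': "arr E'" "src E' = P" "tgt E' = H" "ev \<bullet> (E' \<diamond> ide X) = G'"
    using ex[of G' P] G P by auto
  have "E \<bullet> F a = E' \<bullet> F a" if a: "a \<in> I" for a
  proof (rule un)
    have "ev \<bullet> ((E \<bullet> F a) \<diamond> ide X) = ev \<bullet> (E \<diamond> ide X) \<bullet> (F a \<diamond> ide X)"
      using E F[OF a] X by (simp add: tensor_comp)
    also have "\<dots> = G \<bullet> (F a \<diamond> ide X)"
      using E F[OF a] X ev by (intro comp_reassoc) auto
    also have "\<dots> = G' \<bullet> (F a \<diamond> ide X)"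
      using eq a by blast
    also have "\<dots> = ev \<bullet> (E' \<diamond> ide X) \<bullet> (F a \<diamond> ide X)"
      using E' F[OF a] X ev by (intro comp_reassoc[symmetric]) auto
    also have "\<dots> = ev \<bullet> ((E' \<bullet> F a) \<diamond> ide X)"
      using E' F[OF a] X by (simp add: tensor_comp)
    finally show "ev \<bullet> ((E \<bullet> F a) \<diamond> ide X) = ev \<bullet> ((E' \<bullet> F a) \<diamond> ide X)" .
  qed (use E E' F[OF a] in simp_all)
  then have "E = E'"
    by - (rule jointly_epicD[OF epic], use E E' in simp_all)
  then show "G = G'" using E E' by simp
qed

text \<open>A zero arrow factors through a zero object \<open>O'\<close>, and arrows out of
  \<open>O' \<boxtimes> X\<close> are unique because the empty family remains jointly epic
  there.\<close>

lemma tensor_zer_left: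
  assumes "X \<in> Ob C" "Y \<in> Ob C" "Z \<in> Ob C"
  shows "zer Y Z \<diamond> ide X = zer (Y \<boxtimes> X) (Z \<boxtimes> X)"
proof -
  obtain O' where O: "O' \<in> Ob C" "jointly_epic ({}::unit set) undefined O'"
    using zero_object_exists by metis
  have "jointly_epic ({}::unit set) (\<lambda>a. undefined a \<diamond> ide X) (O' \<boxtimes> X)"
    using O assms by (intro jointly_epic_tensor_left) auto
  then have "zer O' Z \<diamond> ide X = zer (O' \<boxtimes> X) (Z \<boxtimes> X)"
    by (rule jointly_epicD) (use O assms in auto)
  then have "(zer O' Z \<diamond> ide X) \<bullet> (zer Y O' \<diamond> ide X) = zer (Y \<boxtimes> X) (Z \<boxtimes> X)"
    using O assms by simp
  then show ?thesis
    using O assms by (simp add: tensor_comp)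
qed

text \<open>Additivity follows from adjointness. The sum is the diagonal
  \<open>i \<boxplus> j\<close> followed by
  \<open>(F \<bullet> p) \<boxplus> (G \<bullet> q)\<close>, and the tensored injections are still
  jointly epic, so the tensor product of the second factor is computed on each summand.\<close>

lemma tensor_plus_left:
  assumes FG: "arr F" "arr G" "src F = src G" "tgt F = tgt G" and X: "X \<in> Ob C"
  shows "(F \<boxplus> G) \<diamond> ide X = (F \<diamond> ide X) \<boxplus> (G \<diamond> ide X)"
proof -
  let ?T = "\<lambda>F. F \<diamond> ide X"
  obtain P i j p q where "biproduct C (src F) (src F) P i j p q"
    by (rule biproduct_exists[OF arr_src[OF FG(1)] arr_src[OF FG(1)]])
  then interpret biproduct C "src F" "src F" P i j p q .
  have TT: "?T (U \<bullet> V) = ?T U \<bullet> ?T V" if "arr U" "arr V" "src U = tgt V" for U V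
    using that X by (simp add: tensor_comp)
  let ?S = "(F \<bullet> p) \<boxplus> (G \<bullet> q)"
  have Si: "?S \<bullet> i = F" and Sj: "?S \<bullet> j = G"
    using FG by (simp_all add: plus_comp)
  have "?T ?S = (?T F \<bullet> ?T p) \<boxplus> (?T G \<bullet> ?T q)"
  proof (rule jointly_epicD[OF jointly_epic_tensor_left[OF epic_ij]])
    fix b :: bool
    have "?T ?S \<bullet> ?T i = ((?T F \<bullet> ?T p) \<boxplus> (?T G \<bullet> ?T q)) \<bullet> ?T i"
      using FG X by (simp add: TT[symmetric] Si plus_comp tensor_zer_left)
    moreover have "?T ?S \<bullet> ?T j = ((?T F \<bullet> ?T p) \<boxplus> (?T G \<bullet> ?T q)) \<bullet> ?T j"
      using FG X by (simp add: TT[symmetric] Sj plus_comp tensor_zer_left)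
    ultimately show "?T ?S \<bullet> ?T (if b then i else j) = ((?T F \<bullet> ?T p) \<boxplus> (?T G \<bullet> ?T q)) \<bullet> ?T (if b then i else j)"
      by simp
  qed (use FG X in simp_all)
  moreover have "?S \<bullet> (i \<boxplus> j) = F \<boxplus> G"
    using FG by (simp add: plus_comp comp_plus)
  moreover have "p \<bullet> (i \<boxplus> j) = ide (src F)" "q \<bullet> (i \<boxplus> j) = ide (src F)"
    by (simp_all add: comp_plus)
  ultimately have "?T (F \<boxplus> G) = ((?T F \<bullet> ?T p) \<boxplus> (?T G \<bullet> ?T q)) \<bullet> ?T (i \<boxplus> j)"
    using TT[of ?S "i \<boxplus> j"] FG by simp
  also have "\<dots> = ?T (F \<bullet> p \<bullet> (i \<boxplus> j)) \<boxplus> ?T (G \<bullet> q \<bullet> (i \<boxplus> j))"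
    using FG X by (simp add: plus_comp TT)
  also have "\<dots> = ?T F \<boxplus> ?T G"
    using FG \<open>p \<bullet> (i \<boxplus> j) = ide (src F)\<close> \<open>q \<bullet> (i \<boxplus> j) = ide (src F)\<close> by simp
  finally show ?thesis .
qed

text \<open>Conjugation by the braiding carries the results for the left factor over to the right
  one, where the module sits in an action.\<close>

lemma tensor_swap:
  assumes "arr F" "X \<in> Ob C"
  shows "ide X \<diamond> F = brd (tgt F) X \<bullet> (F \<diamond> ide X) \<bullet> brd X (src F)"
proof -
  have "brd (tgt F) X \<bullet> (F \<diamond> ide X) \<bullet> brd X (src F) = brd (tgt F) X \<bullet> brd X (tgt F) \<bullet> (ide X \<diamond> F)"
    using assms brd_nat[of "ide X" F] by simp
  also have "\<dots> = ide X \<diamond> F"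
    using assms comp_reassoc[OF brd_brd, of X "tgt F" "ide X \<diamond> F"] by simp
  finally show ?thesis by simp
qed

lemma tensor_zer [simp]:
  "\<lbrakk>X \<in> Ob C; Y \<in> Ob C; Z \<in> Ob C\<rbrakk> \<Longrightarrow> ide X \<diamond> zer Y Z = zer (X \<boxtimes> Y) (X \<boxtimes> Z)"
  by (simp add: tensor_swap tensor_zer_left)

lemma tensor_plus:
  "\<lbrakk>arr F; arr G; src F = src G; tgt F = tgt G; X \<in> Ob C\<rbrakk>
    \<Longrightarrow> ide X \<diamond> (F \<boxplus> G) = (ide X \<diamond> F) \<boxplus> (ide X \<diamond> G)"
  by (simp add: tensor_swap tensor_plus_left plus_comp comp_plus)

lemma jointly_epic_tensor:
  assumes epic: "jointly_epic I F P" and F: "\<And>a. a \<in> I \<Longrightarrow> arr (F a) \<and> tgt (F a) = P" and X: "X \<in> Ob C" and P: "P \<in> Ob C"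
  shows "jointly_epic I (\<lambda>a. ide X \<diamond> F a) (X \<boxtimes> P)"
  unfolding jointly_epic_def
proof (intro allI impI)
  fix G G' assume G: "arr G" "arr G'" "src G = X \<boxtimes> P" "src G' = X \<boxtimes> P" "tgt G = tgt G'"
    and eq: "\<forall>a\<in>I. G \<bullet> (ide X \<diamond> F a) = G' \<bullet> (ide X \<diamond> F a)"
  have "G \<bullet> brd P X = G' \<bullet> brd P X"
  proof (rule jointly_epicD[OF jointly_epic_tensor_left[OF epic F X P]])
    fix a assume a: "a \<in> I"
    have *: "(H \<bullet> brd P X) \<bullet> (F a \<diamond> ide X) = (H \<bullet> (ide X \<diamond> F a)) \<bullet> brd (src (F a)) X"
      if "arr H" "src H = X \<boxtimes> P" for H
      using that F[OF a] X P brd_nat[of "F a" "ide X"] by simp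
    show "(G \<bullet> brd P X) \<bullet> (F a \<diamond> ide X) = (G' \<bullet> brd P X) \<bullet> (F a \<diamond> ide X)"
      using *[of G] *[of G'] G eq a by metis
  qed (use G X P in simp_all)
  then show "G = G'"
    by - (rule iso_epi[of "brd P X"], use G X P in simp_all)
qed

text \<open>The existence half of the fact that a left adjoint preserves cokernels: the braided
  \<open>G\<close> is curried, the curried arrow kills \<open>f\<close> and factors through
  \<open>c\<close>, and the factor is uncurried. The uniqueness half comes from
  \<open>jointly_epic_tensor\<close>.\<close>

lemma cokernel_tensor:
  assumes f: "arr f" and c: "arr c" "src c = tgt f"
    and factor: "\<And>G. \<lbrakk>arr G; src G = tgt f; G \<bullet> f = zer (src f) (tgt G)\<rbrakk> \<Longrightarrow> \<exists>H. arr H \<and> src H = tgt c \<and> tgt H = tgt G \<and> H \<bullet> c = G"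
    and X: "X \<in> Ob C" and G: "arr G" "src G = X \<boxtimes> tgt f" "G \<bullet> (ide X \<diamond> f) = zer (X \<boxtimes> src f) (tgt G)"
  shows "\<exists>H. arr H \<and> src H = X \<boxtimes> tgt c \<and> tgt H = tgt G \<and> H \<bullet> (ide X \<diamond> c) = G"
proof -
  obtain ev H where ev: "arr ev" "src ev = H \<boxtimes> X" "H \<in> Ob C" "tgt ev = tgt G"
    and ex: "\<And>F Z. \<lbrakk>arr F; tgt F = tgt G; Z \<in> Ob C; src F = Z \<boxtimes> X\<rbrakk> \<Longrightarrow> \<exists>G. arr G \<and> src G = Z \<and> tgt G = H \<and> ev \<bullet> (G \<diamond> ide X) = F"
    and un: "\<And>G G'. \<lbrakk>arr G; arr G'; src G = src G'; tgt G = H; tgt G' = H; ev \<bullet> (G \<diamond> ide X) = ev \<bullet> (G' \<diamond> ide X)\<rbrakk> \<Longrightarrow> G = G'"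
    by (rule curry[OF X, of "tgt G"]) (use G in auto)
  let ?M = "tgt f"
  have M: "?M \<in> Ob C" using f by simp
  obtain E where E: "arr E" "src E = ?M" "tgt E = H" "ev \<bullet> (E \<diamond> ide X) = G \<bullet> brd ?M X"
    using ex[of "G \<bullet> brd ?M X" ?M] G M X by auto
  have "E \<bullet> f = zer (src f) H"
  proof (rule un)
    have "ev \<bullet> ((E \<bullet> f) \<diamond> ide X) = ev \<bullet> (E \<diamond> ide X) \<bullet> (f \<diamond> ide X)"
      using E f X by (simp add: tensor_comp)
    also have "\<dots> = (G \<bullet> brd ?M X) \<bullet> (f \<diamond> ide X)"
      using E f X ev by (intro comp_reassoc) auto
    also have "\<dots> = G \<bullet> (ide X \<diamond> f) \<bullet> brd (src f) X"
      using G(1,2) f X brd_nat[of f "ide X"] by simp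
    also have "\<dots> = zer (src f \<boxtimes> X) (tgt G)"
      using G(1,2) f X comp_reassoc[OF G(3), of "brd (src f) X"] by simp
    also have "\<dots> = ev \<bullet> (zer (src f) H \<diamond> ide X)"
      using ev f X by (simp add: tensor_zer_left)
    finally show "ev \<bullet> ((E \<bullet> f) \<diamond> ide X) = ev \<bullet> (zer (src f) H \<diamond> ide X)" .
  qed (use E f ev in simp_all)
  then obtain K where K: "arr K" "src K = tgt c" "tgt K = H" "K \<bullet> c = E"
    using factor[of E] E by auto
  have "(ev \<bullet> (K \<diamond> ide X) \<bullet> brd X (tgt c)) \<bullet> (ide X \<diamond> c) = ev \<bullet> (K \<diamond> ide X) \<bullet> (c \<diamond> ide X) \<bullet> brd X ?M"
    using K ev c X brd_nat[of "ide X" c] by simp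
  also have "\<dots> = ev \<bullet> (E \<diamond> ide X) \<bullet> brd X ?M"
    using K ev c X M by (simp add: tensor_comp')
  also have "\<dots> = (G \<bullet> brd ?M X) \<bullet> brd X ?M"
    using E ev X M by (intro comp_reassoc) auto
  also have "\<dots> = G"
    using G X M by simp
  finally show ?thesis
    using K ev c X by (intro exI[of _ "ev \<bullet> (K \<diamond> ide X) \<bullet> brd X (tgt c)"]) simp
qed

end

section \<open>Modules over a commutative monoid object\<close>

context abelian_category
begin

text \<open>Existence and uniqueness of factorisations are separated; uniqueness is stated as joint
  monicity over a one-element index set, the form needed to transport actions.\<close>

lemma kernel_arrow:
  assumes F: "arr F"
  obtains z where "arr z" "tgt z = src F" "F \<bullet> z = zer (src z) (tgt F)"
    "jointly_monic (UNIV :: unit set) (\<lambda>_. z) (src z)"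
    "\<And>G. \<lbrakk>arr G; tgt G = src F; F \<bullet> G = zer (src G) (tgt F)\<rbrakk>
      \<Longrightarrow> \<exists>H. arr H \<and> src H = src G \<and> tgt H = src z \<and> z \<bullet> H = G"
proof -
  let ?X = "src F" and ?Y = "tgt F"
  obtain K k where K: "is_kernel C ?X ?Y (mor F) K k"
    using kernels[OF _ _ arr_mor[OF F]] F by auto
  let ?z = "Arrow K ?X k"
  have K_ob: "K \<in> Ob C" and k: "k \<in> Hom C K ?X" "mor F \<cdot> k = Zero C K ?Y"
    and fac: "\<And>W g. \<lbrakk>W \<in> Ob C; g \<in> Hom C W ?X; mor F \<cdot> g = Zero C W ?Y\<rbrakk>
      \<Longrightarrow> \<exists>!h. h \<in> Hom C W K \<and> k \<cdot> h = g"
    using K by (simp_all add: is_kernel_def)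
  have z: "arr ?z"
    using K_ob k F by simp
  have Fz: "F \<bullet> ?z = zer K ?Y"
    by (rule arrow_eqI) (simp_all add: k)
  show ?thesis
  proof (rule that[of ?z])
    show "jointly_monic UNIV (\<lambda>_. ?z) (src ?z)"
      unfolding jointly_monic_def
    proof (intro allI impI)
      fix G H assume G: "arr G" "arr H" "tgt G = src ?z" "tgt H = src ?z" "src G = src H"
        and "\<forall>a\<in>UNIV. ?z \<bullet> G = ?z \<bullet> H"
      then have eq: "?z \<bullet> G = ?z \<bullet> H" by simp
      have "F \<bullet> ?z \<bullet> G = zer (src G) ?Y"
        using comp_reassoc[OF Fz, of G] G z F by simp
      then have "mor F \<cdot> (k \<cdot> mor G) = Zero C (src G) ?Y"
        by (metis comp_simps(3) arrow.sel(3) zer_simps(3))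
      moreover have "k \<cdot> mor G \<in> Hom C (src G) ?X"
        using arr_mor[of "?z \<bullet> G"] G z by simp
      moreover have "k \<cdot> mor G = k \<cdot> mor H"
        using arg_cong[OF eq, of mor] by simp
      ultimately have "mor G = mor H"
        using fac[OF arr_src[OF G(1)], of "k \<cdot> mor G"] arr_mor[OF G(1)] arr_mor[OF G(2)] G(3-5)
        by auto
      then show "G = H"
        by (rule arrow_eqI[rotated 2]) (use G in simp_all)
    qed
  next
    fix G assume G: "arr G" "tgt G = ?X" "F \<bullet> G = zer (src G) ?Y"
    have "mor F \<cdot> mor G = Zero C (src G) ?Y"
      using arg_cong[OF G(3), of mor] by simp
    then obtain h where h: "h \<in> Hom C (src G) K" "k \<cdot> h = mor G"
      using fac[OF arr_src[OF G(1)], of "mor G"] arr_mor[OF G(1)] G(2) by auto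
    have "?z \<bullet> Arrow (src G) K h = G"
      by (rule arrow_eqI) (use h G in simp_all)
    moreover have "arr (Arrow (src G) K h)"
      using h G K_ob by simp
    ultimately show "\<exists>H. arr H \<and> src H = src G \<and> tgt H = src ?z \<and> ?z \<bullet> H = G"
      by (intro exI[of _ "Arrow (src G) K h"]) simp
  qed (use z Fz in simp_all)
qed

lemma cokernel_arrow:
  assumes F: "arr F"
  obtains c where "arr c" "src c = tgt F" "c \<bullet> F = zer (src F) (tgt c)"
    "jointly_epic (UNIV :: unit set) (\<lambda>_. c) (tgt c)"
    "\<And>G. \<lbrakk>arr G; src G = tgt F; G \<bullet> F = zer (src F) (tgt G)\<rbrakk>
      \<Longrightarrow> \<exists>H. arr H \<and> src H = tgt c \<and> tgt H = tgt G \<and> H \<bullet> c = G"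
proof -
  let ?X = "src F" and ?Y = "tgt F"
  obtain K k where K: "is_cokernel C ?X ?Y (mor F) K k"
    using cokernels[OF _ _ arr_mor[OF F]] F by auto
  let ?c = "Arrow ?Y K k"
  have K_ob: "K \<in> Ob C" and k: "k \<in> Hom C ?Y K" "k \<cdot> mor F = Zero C ?X K"
    and fac: "\<And>W g. \<lbrakk>W \<in> Ob C; g \<in> Hom C ?Y W; g \<cdot> mor F = Zero C ?X W\<rbrakk>
      \<Longrightarrow> \<exists>!h. h \<in> Hom C K W \<and> h \<cdot> k = g"
    using K by (simp_all add: is_cokernel_def)
  have c: "arr ?c"
    using K_ob k F by simp
  have cF: "?c \<bullet> F = zer ?X K"
    by (rule arrow_eqI) (simp_all add: k)
  show ?thesis
  proof (rule that[of ?c])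
    show "jointly_epic UNIV (\<lambda>_. ?c) (tgt ?c)"
      unfolding jointly_epic_def
    proof (intro allI impI)
      fix G H assume G: "arr G" "arr H" "src G = tgt ?c" "src H = tgt ?c" "tgt G = tgt H"
        and "\<forall>a\<in>UNIV. G \<bullet> ?c = H \<bullet> ?c"
      then have eq: "G \<bullet> ?c = H \<bullet> ?c" by simp
      have "(G \<bullet> ?c) \<bullet> F = zer ?X (tgt G)"
        using G c F by (simp add: cF)
      then have "(mor G \<cdot> k) \<cdot> mor F = Zero C ?X (tgt G)"
        by (metis comp_simps(3) arrow.sel(3) zer_simps(3))
      moreover have "mor G \<cdot> k \<in> Hom C ?Y (tgt G)"
        using arr_mor[of "G \<bullet> ?c"] G c by simp
      moreover have "mor G \<cdot> k = mor H \<cdot> k"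
        using arg_cong[OF eq, of mor] by simp
      ultimately have "mor G = mor H"
        using fac[OF arr_tgt[OF G(1)], of "mor G \<cdot> k"] arr_mor[OF G(1)] arr_mor[OF G(2)] G(3-5)
        by auto
      then show "G = H"
        by (rule arrow_eqI[rotated 2]) (use G in simp_all)
    qed
  next
    fix G assume G: "arr G" "src G = ?Y" "G \<bullet> F = zer ?X (tgt G)"
    have "mor G \<cdot> mor F = Zero C ?X (tgt G)"
      using arg_cong[OF G(3), of mor] by simp
    then obtain h where h: "h \<in> Hom C K (tgt G)" "h \<cdot> k = mor G"
      using fac[OF arr_tgt[OF G(1)], of "mor G"] arr_mor[OF G(1)] G(2) by auto
    have "Arrow K (tgt G) h \<bullet> ?c = G"
      by (rule arrow_eqI) (use h G in simp_all)
    moreover have "arr (Arrow K (tgt G) h)"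
      using h G K_ob by simp
    ultimately show "\<exists>H. arr H \<and> src H = tgt ?c \<and> tgt H = tgt G \<and> H \<bullet> ?c = G"
      by (intro exI[of _ "Arrow K (tgt G) h"]) simp
  qed (use c cF in simp_all)
qed

text \<open>A monomorphism is the kernel of some arrow, which vanishes if the monomorphism is epic as well.\<close>

lemma monic_epic_retraction:
  assumes f: "monic C X Y f" and X: "X \<in> Ob C" and Y: "Y \<in> Ob C"
    and epi: "\<And>Z g. \<lbrakk>Z \<in> Ob C; g \<in> Hom C Y Z; g \<cdot> f = Zero C X Z\<rbrakk> \<Longrightarrow> g = Zero C Y Z"
  obtains h where "h \<in> Hom C Y X" "f \<cdot> h = Idn C Y" "h \<cdot> f = Idn C X"
proof -
  obtain Z g where Z: "Z \<in> Ob C" "g \<in> Hom C Y Z" "is_kernel C Y Z g X f"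
    using monic_kernel[OF X Y f] by blast
  have "g = Zero C Y Z"
    using epi Z by (simp add: is_kernel_def)
  then have "g \<cdot> Idn C Y = Zero C Y Z"
    using cmp_zero_left Y Z idn_in by metis
  then obtain h where h: "h \<in> Hom C Y X" "f \<cdot> h = Idn C Y"
    using Z(3) Y idn_in unfolding is_kernel_def by blast
  have f_in: "f \<in> Hom C X Y"
    using f by (simp add: monic_def)
  have "f \<cdot> (h \<cdot> f) = f \<cdot> Idn C X"
    using cmp_assoc[OF X Y X Y f_in h(1) f_in] h idn_left[OF X Y f_in] idn_right[OF X Y f_in] by simp
  then have "h \<cdot> f = Idn C X"
    using f cmp_in[OF X Y X f_in h(1)] idn_in X unfolding monic_def by blast
  then show ?thesis
    using that h by blast
qed

end

section \<open>Actions, linear arrows and the additive structure of module categories\<close>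

locale monoid_in_category = abelian_closed_symmetric_monoidal_category C
  for C :: "('o, 'm, 'x) moncat_scheme" (structure) +
  fixes R :: "('o, 'm) monoid_object"
  assumes monoid: "R \<in> Ob (Comm C)"
begin

definition mul :: "('o, 'm) arrow" where
  "mul = Arrow (Carr R \<boxtimes> Carr R) (Carr R) (Mu R)"

definition unt :: "('o, 'm) arrow" where
  "unt = Arrow (Unit_ob C) (Carr R) (Eta R)"

definition act :: "'o \<times> 'm \<Rightarrow> ('o, 'm) arrow" where
  "act M = Arrow (Carr R \<boxtimes> fst M) (fst M) (snd M)"

text \<open>The ends of \<open>F\<close> are only the underlying objects, hence the modules are
  separate arguments. The equation is \<open>F(a x) = a F(x)\<close>.\<close>

definition lin :: "'o \<times> 'm \<Rightarrow> 'o \<times> 'm \<Rightarrow> ('o, 'm) arrow \<Rightarrow> bool" where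
  "lin M N F \<longleftrightarrow> arr F \<and> src F = fst M \<and> tgt F = fst N \<and> F \<bullet> act M = act N \<bullet> (ide (Carr R) \<diamond> F)"

lemma mul_simps [simp]: "src mul = Carr R \<boxtimes> Carr R" "tgt mul = Carr R" "mor mul = Mu R"
  by (simp_all add: mul_def)

lemma unt_simps [simp]: "src unt = Unit_ob C" "tgt unt = Carr R" "mor unt = Eta R"
  by (simp_all add: unt_def)

lemma act_simps [simp]: "src (act M) = Carr R \<boxtimes> fst M" "tgt (act M) = fst M" "mor (act M) = snd M"
  by (simp_all add: act_def)

lemma monoid_raw:
  "Carr R \<in> Ob C" "Mu R \<in> Hom C (Carr R \<boxtimes> Carr R) (Carr R)" "Eta R \<in> Hom C (Unit_ob C) (Carr R)"
  "Mu R \<cdot> (Mu R \<star> Idn C (Carr R)) = Mu R \<cdot> (Idn C (Carr R) \<star> Mu R) \<cdot> Asc C (Carr R) (Carr R) (Carr R)"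
  "Mu R \<cdot> (Eta R \<star> Idn C (Carr R)) = Lun C (Carr R)"
  "Mu R \<cdot> (Idn C (Carr R) \<star> Eta R) = Run C (Carr R)"
  "Mu R \<cdot> Brd C (Carr R) (Carr R) = Mu R"
  using monoid by (simp_all add: Comm_def comm_monoid_object_def Let_def)

lemma carr [simp]: "Carr R \<in> Ob C"
  by (rule monoid_raw)

lemma arr_mul [simp]: "arr mul" and arr_unt [simp]: "arr unt"
  using monoid_raw(2,3) by (simp_all add: mul_def unt_def)

lemma mul_assoc: "mul \<bullet> (mul \<diamond> ide (Carr R)) = mul \<bullet> (ide (Carr R) \<diamond> mul) \<bullet> asc (Carr R) (Carr R) (Carr R)"
  by (rule arrow_eqI) (simp_all add: monoid_raw)

lemma mul_unt_left: "mul \<bullet> (unt \<diamond> ide (Carr R)) = lun (Carr R)"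
  by (rule arrow_eqI) (simp_all add: monoid_raw)

lemma mul_unt_right: "mul \<bullet> (ide (Carr R) \<diamond> unt) = run (Carr R)"
  by (rule arrow_eqI) (simp_all add: monoid_raw)

lemma mul_brd: "mul \<bullet> brd (Carr R) (Carr R) = mul"
  by (rule arrow_eqI) (simp_all add: monoid_raw)

lemma module_iff:
  "M \<in> Ob (Mod C R) \<longleftrightarrow> fst M \<in> Ob C \<and> arr (act M) \<and>
     act M \<bullet> (mul \<diamond> ide (fst M)) = act M \<bullet> (ide (Carr R) \<diamond> act M) \<bullet> asc (Carr R) (Carr R) (fst M) \<and>
     act M \<bullet> (unt \<diamond> ide (fst M)) = lun (fst M)" (is "?L \<longleftrightarrow> ?A \<and> ?B \<and> ?E1 \<and> ?E2")
proof -
  have "?E1 \<longleftrightarrow> snd M \<cdot> (Mu R \<star> Idn C (fst M)) =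
      snd M \<cdot> (Idn C (Carr R) \<star> snd M) \<cdot> Asc C (Carr R) (Carr R) (fst M)"
    by (simp add: comp_def tensor_def asc_def ide_def mul_def act_def)
  moreover have "?E2 \<longleftrightarrow> snd M \<cdot> (Eta R \<star> Idn C (fst M)) = Lun C (fst M)"
    by (simp add: comp_def tensor_def lun_def ide_def unt_def act_def)
  moreover have "?A \<Longrightarrow> ?B \<longleftrightarrow> snd M \<in> Hom C (Carr R \<boxtimes> fst M) (fst M)"
    by (simp add: act_def)
  ultimately show ?thesis
    by (auto simp: Mod_def module_object_def Let_def)
qed

lemma module_ob [simp]: "M \<in> Ob (Mod C R) \<Longrightarrow> fst M \<in> Ob C"
  and arr_act [simp]: "M \<in> Ob (Mod C R) \<Longrightarrow> arr (act M)"
  and act_mul: "M \<in> Ob (Mod C R) \<Longrightarrow>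
    act M \<bullet> (mul \<diamond> ide (fst M)) = act M \<bullet> (ide (Carr R) \<diamond> act M) \<bullet> asc (Carr R) (Carr R) (fst M)"
  and act_unt: "M \<in> Ob (Mod C R) \<Longrightarrow> act M \<bullet> (unt \<diamond> ide (fst M)) = lun (fst M)"
  by (simp_all only: module_iff)

lemma lin_arr [simp]: "lin M N F \<Longrightarrow> arr F" "lin M N F \<Longrightarrow> src F = fst M" "lin M N F \<Longrightarrow> tgt F = fst N"
  by (simp_all add: lin_def)

lemma lin_act: "lin M N F \<Longrightarrow> F \<bullet> act M = act N \<bullet> (ide (Carr R) \<diamond> F)"
  unfolding lin_def by simp

lemma linI:
  "\<lbrakk>arr F; src F = fst M; tgt F = fst N; F \<bullet> act M = act N \<bullet> (ide (Carr R) \<diamond> F)\<rbrakk> \<Longrightarrow> lin M N F"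
  unfolding lin_def by simp

lemma Hom_Mod_iff:
  assumes "M \<in> Ob (Mod C R)" "N \<in> Ob (Mod C R)"
  shows "f \<in> Hom (Mod C R) M N \<longleftrightarrow> lin M N (Arrow (fst M) (fst N) f)"
proof -
  let ?F = "Arrow (fst M) (fst N) f"
  have "?F \<bullet> act M = act N \<bullet> (ide (Carr R) \<diamond> ?F) \<longleftrightarrow>
      f \<cdot> snd M = snd N \<cdot> (Idn C (Carr R) \<star> f)"
    by (simp add: comp_def tensor_def act_def ide_def)
  then show ?thesis
    using assms unfolding lin_def by simp (simp add: Mod_def)
qed

lemma Hom_Mod_mor:
  "\<lbrakk>M \<in> Ob (Mod C R); N \<in> Ob (Mod C R); lin M N F\<rbrakk> \<Longrightarrow> mor F \<in> Hom (Mod C R) M N"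
  by (simp add: Hom_Mod_iff) (metis arrow.collapse lin_arr(2,3))

lemma Mod_simps [simp]: "Idn (Mod C R) M = Idn C (fst M)" "Cmp (Mod C R) = Cmp C"
    "Zero (Mod C R) M N = Zero C (fst M) (fst N)" "Plus (Mod C R) = Plus C"
  by (simp_all add: Mod_def)

lemma lin_ide: "M \<in> Ob (Mod C R) \<Longrightarrow> lin M M (ide (fst M))"
  by (rule linI) simp_all

lemma lin_comp:
  assumes "M \<in> Ob (Mod C R)" "N \<in> Ob (Mod C R)" "P \<in> Ob (Mod C R)" "lin M N F" "lin N P G"
  shows "lin M P (G \<bullet> F)"
proof -
  have "(G \<bullet> F) \<bullet> act M = G \<bullet> act N \<bullet> (ide (Carr R) \<diamond> F)"
    using assms lin_act[OF assms(4)] by simp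
  also have "\<dots> = (act P \<bullet> (ide (Carr R) \<diamond> G)) \<bullet> (ide (Carr R) \<diamond> F)"
    using assms by (intro comp_reassoc lin_act[OF assms(5)]) simp_all
  also have "\<dots> = act P \<bullet> (ide (Carr R) \<diamond> (G \<bullet> F))"
    using assms by (simp add: tensor_comp)
  finally show ?thesis
    by - (rule linI, use assms in simp_all)
qed

lemma lin_zer: "\<lbrakk>M \<in> Ob (Mod C R); N \<in> Ob (Mod C R)\<rbrakk> \<Longrightarrow> lin M N (zer (fst M) (fst N))"
  by (rule linI) simp_all

lemma lin_plus:
  assumes "M \<in> Ob (Mod C R)" "N \<in> Ob (Mod C R)" "lin M N F" "lin M N G"
  shows "lin M N (F \<boxplus> G)"
  by (rule linI) (use assms lin_act[OF assms(3)] lin_act[OF assms(4)] in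
    \<open>simp_all add: plus_comp tensor_plus comp_plus\<close>)

text \<open>The negative is available in \<open>C\<close> only. Composition and tensoring are
  additive, so its linearity follows from that of \<open>F\<close> and of zero by
  cancellation.\<close>

lemma lin_negative:
  assumes M: "M \<in> Ob (Mod C R)" and N: "N \<in> Ob (Mod C R)" and F: "lin M N F"
    and G: "arr G" "src G = fst M" "tgt G = fst N" "G \<boxplus> F = zer (fst M) (fst N)"
  shows "lin M N G"
proof -
  have "(G \<bullet> act M) \<boxplus> (F \<bullet> act M) = (G \<boxplus> F) \<bullet> act M"
    using M N F G(1-3) by (simp add: plus_comp)
  also have "\<dots> = act N \<bullet> (ide (Carr R) \<diamond> (G \<boxplus> F))"
    using M N F G by simp
  also have "\<dots> = (act N \<bullet> (ide (Carr R) \<diamond> G)) \<boxplus> (act N \<bullet> (ide (Carr R) \<diamond> F))"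
    using M N F G(1-3) by (simp add: tensor_plus comp_plus)
  also have "\<dots> = (act N \<bullet> (ide (Carr R) \<diamond> G)) \<boxplus> (F \<bullet> act M)"
    by (simp add: lin_act[OF F])
  finally have "G \<bullet> act M = act N \<bullet> (ide (Carr R) \<diamond> G)"
    by - (rule plus_cancel[of _ _ "F \<bullet> act M"], use M N F G(1-3) in simp_all)
  then show ?thesis
    by - (rule linI, use G in simp_all)
qed

lemma Hom_Mod_in: "\<lbrakk>M \<in> Ob (Mod C R); N \<in> Ob (Mod C R); f \<in> Hom (Mod C R) M N\<rbrakk> \<Longrightarrow> f \<in> Hom C (fst M) (fst N)"
  by (simp add: Mod_def)

lemma lin_arrow:
  "\<lbrakk>M \<in> Ob (Mod C R); N \<in> Ob (Mod C R); f \<in> Hom (Mod C R) M N\<rbrakk> \<Longrightarrow> lin M N (Arrow (fst M) (fst N) f)"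
  by (simp add: Hom_Mod_iff)

lemma comm_group_Mod:
  assumes X: "X \<in> Ob (Mod C R)" and Y: "Y \<in> Ob (Mod C R)"
  shows "comm_group (hom_group (Mod C R) X Y)"
proof (rule comm_groupI)
  fix a b c
  assume "a \<in> carrier (hom_group (Mod C R) X Y)"
  then have a: "a \<in> Hom (Mod C R) X Y" by (simp add: hom_group_def)
  note a' = Hom_Mod_in[OF X Y a]
  show "\<one>\<^bsub>hom_group (Mod C R) X Y\<^esub> \<otimes>\<^bsub>hom_group (Mod C R) X Y\<^esub> a = a"
    using a' X Y by (simp add: hom_group_def plus_zero_left)
  obtain n where n: "n \<in> Hom C (fst X) (fst Y)" "Plus C n a = Zero C (fst X) (fst Y)"
    using negative_hom[OF _ _ a'] X Y by auto
  have "lin X Y (Arrow (fst X) (fst Y) n)"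
    by (rule lin_negative[OF X Y lin_arrow[OF X Y a]]) (use n X Y in \<open>simp_all add: plus_def zer_def\<close>)
  then have "n \<in> Hom (Mod C R) X Y"
    using X Y by (simp add: Hom_Mod_iff)
  then show "\<exists>y\<in>carrier (hom_group (Mod C R) X Y). y \<otimes>\<^bsub>hom_group (Mod C R) X Y\<^esub> a = \<one>\<^bsub>hom_group (Mod C R) X Y\<^esub>"
    using n by (auto simp: hom_group_def)
  assume "b \<in> carrier (hom_group (Mod C R) X Y)"
  then have b: "b \<in> Hom (Mod C R) X Y" by (simp add: hom_group_def)
  note b' = Hom_Mod_in[OF X Y b]
  show "a \<otimes>\<^bsub>hom_group (Mod C R) X Y\<^esub> b \<in> carrier (hom_group (Mod C R) X Y)"
    using Hom_Mod_mor[OF X Y lin_plus[OF X Y lin_arrow[OF X Y a] lin_arrow[OF X Y b]]]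
    by (simp add: hom_group_def)
  show "a \<otimes>\<^bsub>hom_group (Mod C R) X Y\<^esub> b = b \<otimes>\<^bsub>hom_group (Mod C R) X Y\<^esub> a"
    using a' b' X Y plus_comm_hom[of "fst X" "fst Y" a b] by (simp add: hom_group_def)
  assume "c \<in> carrier (hom_group (Mod C R) X Y)"
  then have "c \<in> Hom (Mod C R) X Y" by (simp add: hom_group_def)
  note c' = Hom_Mod_in[OF X Y this]
  show "a \<otimes>\<^bsub>hom_group (Mod C R) X Y\<^esub> b \<otimes>\<^bsub>hom_group (Mod C R) X Y\<^esub> c =
      a \<otimes>\<^bsub>hom_group (Mod C R) X Y\<^esub> (b \<otimes>\<^bsub>hom_group (Mod C R) X Y\<^esub> c)"
    using a' b' c' X Y plus_assoc_hom[of "fst X" "fst Y" a b c] by (simp add: hom_group_def)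
next
  show "\<one>\<^bsub>hom_group (Mod C R) X Y\<^esub> \<in> carrier (hom_group (Mod C R) X Y)"
    using Hom_Mod_mor[OF X Y lin_zer[OF X Y]] by (simp add: hom_group_def)
qed

text \<open>Makes the general additive facts available for modules with the prefix
  \<open>Mod\<close>, while the unprefixed ones keep speaking of \<open>C\<close>.\<close>

sublocale Mod: preadditive_category "Mod C R"
proof (intro preadditive_category.intro category.intro preadditive_category_axioms.intro)
  fix X Y Z W f g h
  assume X: "X \<in> Ob (Mod C R)"
  show "Idn (Mod C R) X \<in> Hom (Mod C R) X X"
    using Hom_Mod_mor[OF X X lin_ide[OF X]] by simp
  assume Y: "Y \<in> Ob (Mod C R)"
  show "f \<in> Hom (Mod C R) X Y \<Longrightarrow> f \<cdot>\<^bsub>Mod C R\<^esub> Idn (Mod C R) X = f"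
    "f \<in> Hom (Mod C R) X Y \<Longrightarrow> Idn (Mod C R) Y \<cdot>\<^bsub>Mod C R\<^esub> f = f"
    using X Y idn_right[of "fst X" "fst Y" f] idn_left[of "fst X" "fst Y" f] by (simp_all add: Hom_Mod_in)
  show "comm_group (hom_group (Mod C R) X Y)"
    by (rule comm_group_Mod[OF X Y])
  assume Z: "Z \<in> Ob (Mod C R)"
  show "\<lbrakk>f \<in> Hom (Mod C R) X Y; g \<in> Hom (Mod C R) Y Z\<rbrakk> \<Longrightarrow> g \<cdot>\<^bsub>Mod C R\<^esub> f \<in> Hom (Mod C R) X Z"
    using Hom_Mod_mor[OF X Z lin_comp[OF X Y Z lin_arrow[OF X Y, of f] lin_arrow[OF Y Z, of g]]] by simp
  show "\<lbrakk>f \<in> Hom (Mod C R) X Y; g \<in> Hom (Mod C R) X Y; h \<in> Hom (Mod C R) Y Z\<rbrakk>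
    \<Longrightarrow> h \<cdot>\<^bsub>Mod C R\<^esub> Plus (Mod C R) f g = Plus (Mod C R) (h \<cdot>\<^bsub>Mod C R\<^esub> f) (h \<cdot>\<^bsub>Mod C R\<^esub> g)"
    using X Y Z cmp_plus_right[of "fst X" "fst Y" "fst Z" f g h] by (simp add: Hom_Mod_in)
  show "\<lbrakk>f \<in> Hom (Mod C R) X Y; g \<in> Hom (Mod C R) Y Z; h \<in> Hom (Mod C R) Y Z\<rbrakk>
    \<Longrightarrow> Plus (Mod C R) g h \<cdot>\<^bsub>Mod C R\<^esub> f = Plus (Mod C R) (g \<cdot>\<^bsub>Mod C R\<^esub> f) (h \<cdot>\<^bsub>Mod C R\<^esub> f)"
    using X Y Z cmp_plus_left[of "fst X" "fst Y" "fst Z" f g h] by (simp add: Hom_Mod_in)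
  assume W: "W \<in> Ob (Mod C R)"
  show "\<lbrakk>f \<in> Hom (Mod C R) W X; g \<in> Hom (Mod C R) X Y; h \<in> Hom (Mod C R) Y Z\<rbrakk>
    \<Longrightarrow> (h \<cdot>\<^bsub>Mod C R\<^esub> g) \<cdot>\<^bsub>Mod C R\<^esub> f = h \<cdot>\<^bsub>Mod C R\<^esub> (g \<cdot>\<^bsub>Mod C R\<^esub> f)"
    using W X Y Z cmp_assoc[of "fst W" "fst X" "fst Y" "fst Z" f g h] by (simp add: Hom_Mod_in)
qed

end

section \<open>Zero object, biproducts, kernels and cokernels of modules; the regular module\<close>

context monoid_in_category
begin

lemma act_mk: "\<lbrakk>src r = Carr R \<boxtimes> Z; tgt r = Z\<rbrakk> \<Longrightarrow> act (Z, mor r) = r"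
  by (rule arrow_eqI) simp_all

text \<open>The axioms of an action are equations between arrows into \<open>Z\<close>; composed
  with \<open>z a\<close> they become the axioms of the module \<open>N a\<close>. The empty family,
  the two projections of a biproduct and a single kernel are the cases of interest.\<close>

lemma module_of_jointly_monic:
  assumes r: "arr r" "src r = Carr R \<boxtimes> Z" "tgt r = Z" and monic: "jointly_monic I z Z"
    and z: "\<And>a. a \<in> I \<Longrightarrow> N a \<in> Ob (Mod C R) \<and> arr (z a) \<and> src (z a) = Z \<and> tgt (z a) = fst (N a) \<and>
      z a \<bullet> r = act (N a) \<bullet> (ide (Carr R) \<diamond> z a)"
  shows "(Z, mor r) \<in> Ob (Mod C R)"
proof -
  have Z: "Z \<in> Ob C"
    using r arr_tgt by blast
  let ?R = "Carr R"
  have "r \<bullet> (mul \<diamond> ide Z) = r \<bullet> (ide ?R \<diamond> r) \<bullet> asc ?R ?R Z"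
  proof (rule jointly_monicD[OF monic])
    fix a assume "a \<in> I"
    note za = z[OF this]
    have zr: "z a \<bullet> r = act (N a) \<bullet> (ide ?R \<diamond> z a)" using za by blast
    have "z a \<bullet> r \<bullet> (mul \<diamond> ide Z) = (act (N a) \<bullet> (ide ?R \<diamond> z a)) \<bullet> (mul \<diamond> ide Z)"
      using za r Z by (intro comp_reassoc) auto
    also have "\<dots> = act (N a) \<bullet> (mul \<diamond> ide (fst (N a))) \<bullet> (ide (?R \<boxtimes> ?R) \<diamond> z a)"
      using za Z by (simp add: tensor_comp)
    also have "\<dots> = (act (N a) \<bullet> (ide ?R \<diamond> act (N a)) \<bullet> asc ?R ?R (fst (N a))) \<bullet> (ide (?R \<boxtimes> ?R) \<diamond> z a)"
      using za Z by (intro comp_reassoc act_mul) auto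
    also have "\<dots> = act (N a) \<bullet> (ide ?R \<diamond> act (N a)) \<bullet> (ide ?R \<diamond> ide ?R \<diamond> z a) \<bullet> asc ?R ?R Z"
      using za Z asc_nat[of "ide ?R" "ide ?R" "z a"] by simp
    also have "\<dots> = act (N a) \<bullet> (ide ?R \<diamond> (z a \<bullet> r)) \<bullet> asc ?R ?R Z"
      using za Z by (simp add: tensor_comp')
    also have "\<dots> = act (N a) \<bullet> (ide ?R \<diamond> z a) \<bullet> (ide ?R \<diamond> r) \<bullet> asc ?R ?R Z"
      using za Z r by (simp add: tensor_comp')
    also have "\<dots> = (z a \<bullet> r) \<bullet> (ide ?R \<diamond> r) \<bullet> asc ?R ?R Z"
      unfolding zr using za Z r by simp
    also have "\<dots> = z a \<bullet> r \<bullet> (ide ?R \<diamond> r) \<bullet> asc ?R ?R Z"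
      using za Z r(1-3) by (intro comp_assoc) auto
    finally show "z a \<bullet> (r \<bullet> (mul \<diamond> ide Z)) = z a \<bullet> (r \<bullet> (ide ?R \<diamond> r) \<bullet> asc ?R ?R Z)" .
  qed (use r Z in simp_all)
  moreover have "r \<bullet> (unt \<diamond> ide Z) = lun Z"
  proof (rule jointly_monicD[OF monic])
    fix a assume "a \<in> I"
    note za = z[OF this]
    have "z a \<bullet> r \<bullet> (unt \<diamond> ide Z) = (act (N a) \<bullet> (ide ?R \<diamond> z a)) \<bullet> (unt \<diamond> ide Z)"
      using za r Z by (intro comp_reassoc) auto
    also have "\<dots> = act (N a) \<bullet> (unt \<diamond> ide (fst (N a))) \<bullet> (ide (Unit_ob C) \<diamond> z a)"
      using za Z by (simp add: tensor_comp)
    also have "\<dots> = lun (fst (N a)) \<bullet> (ide (Unit_ob C) \<diamond> z a)"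
      using za Z by (intro comp_reassoc act_unt) auto
    also have "\<dots> = z a \<bullet> lun Z"
      using za lun_nat[of "z a"] by simp
    finally show "z a \<bullet> r \<bullet> (unt \<diamond> ide Z) = z a \<bullet> lun Z" .
  qed (use r Z in simp_all)
  ultimately show ?thesis
    unfolding module_iff using r Z by (simp add: act_mk)
qed

text \<open>Here the axioms are tested on their sources
  \<open>(Carr R \<boxtimes> Carr R) \<boxtimes> Z\<close> and
  \<open>Unit_ob C \<boxtimes> Z\<close>, which is possible because \<open>c\<close> remains epic
  after tensoring.\<close>

lemma module_of_epic:
  assumes r: "arr r" "src r = Carr R \<boxtimes> Z" "tgt r = Z" and epic: "jointly_epic (UNIV :: unit set) (\<lambda>_. c) Z"
    and M: "M \<in> Ob (Mod C R)" and c: "arr c" "src c = fst M" "tgt c = Z"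
    and eq: "c \<bullet> act M = r \<bullet> (ide (Carr R) \<diamond> c)"
  shows "(Z, mor r) \<in> Ob (Mod C R)"
proof -
  have Z: "Z \<in> Ob C"
    using r arr_tgt by blast
  let ?R = "Carr R" and ?M = "fst M"
  have "r \<bullet> (mul \<diamond> ide Z) = r \<bullet> (ide ?R \<diamond> r) \<bullet> asc ?R ?R Z"
  proof (rule jointly_epicD[OF jointly_epic_tensor[OF epic, of "?R \<boxtimes> ?R"]])
    have "(r \<bullet> (mul \<diamond> ide Z)) \<bullet> (ide (?R \<boxtimes> ?R) \<diamond> c) = r \<bullet> (ide ?R \<diamond> c) \<bullet> (mul \<diamond> ide ?M)"
      using r Z M c by (simp add: tensor_comp)
    also have "\<dots> = (c \<bullet> act M) \<bullet> (mul \<diamond> ide ?M)"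
      using r Z M c by (intro comp_reassoc eq[symmetric]) auto
    also have "\<dots> = c \<bullet> act M \<bullet> (ide ?R \<diamond> act M) \<bullet> asc ?R ?R ?M"
      using r Z M c by (simp add: act_mul)
    also have "\<dots> = (r \<bullet> (ide ?R \<diamond> c)) \<bullet> (ide ?R \<diamond> act M) \<bullet> asc ?R ?R ?M"
      using r Z M c by (intro comp_reassoc eq) auto
    also have "\<dots> = r \<bullet> (ide ?R \<diamond> (c \<bullet> act M)) \<bullet> asc ?R ?R ?M"
      using r Z M c by (simp add: tensor_comp')
    also have "\<dots> = r \<bullet> (ide ?R \<diamond> r) \<bullet> (ide ?R \<diamond> ide ?R \<diamond> c) \<bullet> asc ?R ?R ?M"
      unfolding eq using r Z M c by (simp add: tensor_comp')
    also have "\<dots> = (r \<bullet> (ide ?R \<diamond> r) \<bullet> asc ?R ?R Z) \<bullet> (ide (?R \<boxtimes> ?R) \<diamond> c)"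
      using r Z M c asc_nat[of "ide ?R" "ide ?R" c] by simp
    finally show "(r \<bullet> (mul \<diamond> ide Z)) \<bullet> (ide (?R \<boxtimes> ?R) \<diamond> c) =
      (r \<bullet> (ide ?R \<diamond> r) \<bullet> asc ?R ?R Z) \<bullet> (ide (?R \<boxtimes> ?R) \<diamond> c)" .
  qed (use r Z c in simp_all)
  moreover have "r \<bullet> (unt \<diamond> ide Z) = lun Z"
  proof (rule jointly_epicD[OF jointly_epic_tensor[OF epic, of "Unit_ob C"]])
    have "(r \<bullet> (unt \<diamond> ide Z)) \<bullet> (ide (Unit_ob C) \<diamond> c) = r \<bullet> (ide ?R \<diamond> c) \<bullet> (unt \<diamond> ide ?M)"
      using r Z M c by (simp add: tensor_comp)
    also have "\<dots> = (c \<bullet> act M) \<bullet> (unt \<diamond> ide ?M)"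
      using r Z M c by (intro comp_reassoc eq[symmetric]) auto
    also have "\<dots> = lun Z \<bullet> (ide (Unit_ob C) \<diamond> c)"
      using r Z M c lun_nat[of c] by (simp add: act_unt)
    finally show "(r \<bullet> (unt \<diamond> ide Z)) \<bullet> (ide (Unit_ob C) \<diamond> c) = lun Z \<bullet> (ide (Unit_ob C) \<diamond> c)" .
  qed (use r Z c in simp_all)
  ultimately show ?thesis
    unfolding module_iff using r Z by (simp add: act_mk)
qed

text \<open>Linearity of \<open>h\<close> is an equation between arrows into \<open>Z\<close>, so it
  can be tested after each \<open>z a\<close>.\<close>

lemma lin_of_jointly_monic:
  assumes Z: "Z \<in> Ob (Mod C R)" and W: "W \<in> Ob (Mod C R)" and monic: "jointly_monic I z (fst Z)"
    and z: "\<And>a. a \<in> I \<Longrightarrow> N a \<in> Ob (Mod C R) \<and> lin Z (N a) (z a) \<and> lin W (N a) (z a \<bullet> h)"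
    and h: "arr h" "src h = fst W" "tgt h = fst Z"
  shows "lin W Z h"
proof (rule linI[OF h])
  show "h \<bullet> act W = act Z \<bullet> (ide (Carr R) \<diamond> h)"
  proof (rule jointly_monicD[OF monic])
    fix a assume a: "a \<in> I"
    have za: "N a \<in> Ob (Mod C R)" "lin Z (N a) (z a)" "lin W (N a) (z a \<bullet> h)"
      using z[OF a] by auto
    have "z a \<bullet> h \<bullet> act W = (z a \<bullet> h) \<bullet> act W"
      using za h W by simp
    also have "\<dots> = act (N a) \<bullet> (ide (Carr R) \<diamond> z a) \<bullet> (ide (Carr R) \<diamond> h)"
      unfolding lin_act[OF za(3)] using za(1,2) h by (simp add: tensor_comp)
    also have "\<dots> = (z a \<bullet> act Z) \<bullet> (ide (Carr R) \<diamond> h)"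
      using za(1,2) h lin_act[OF za(2)] by (intro comp_reassoc) auto
    finally show "z a \<bullet> h \<bullet> act W = z a \<bullet> act Z \<bullet> (ide (Carr R) \<diamond> h)"
      using za(1,2) h Z by simp
  qed (use Z W h in simp_all)
qed

lemma Mod_zero_object:
  obtains Z where "Z \<in> Ob (Mod C R)"
    "\<And>X f g. \<lbrakk>X \<in> Ob (Mod C R); f \<in> Hom (Mod C R) X Z; g \<in> Hom (Mod C R) X Z\<rbrakk> \<Longrightarrow> f = g"
    "\<And>X f g. \<lbrakk>X \<in> Ob (Mod C R); f \<in> Hom (Mod C R) Z X; g \<in> Hom (Mod C R) Z X\<rbrakk> \<Longrightarrow> f = g"
proof -
  obtain Z where Z: "Z \<in> Ob C" "jointly_monic ({} :: unit set) undefined Z"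
    and zero: "\<And>X f g. \<lbrakk>X \<in> Ob C; f \<in> Hom C X Z; g \<in> Hom C X Z\<rbrakk> \<Longrightarrow> f = g"
      "\<And>X f g. \<lbrakk>X \<in> Ob C; f \<in> Hom C Z X; g \<in> Hom C Z X\<rbrakk> \<Longrightarrow> f = g"
    using zero_object_exists by metis
  have ob: "(Z, mor (zer (Carr R \<boxtimes> Z) Z)) \<in> Ob (Mod C R)"
    by (rule module_of_jointly_monic[OF _ _ _ Z(2)]) (use Z in simp_all)
  show ?thesis
  proof (rule that[OF ob])
    fix X f g assume X: "X \<in> Ob (Mod C R)"
    show "f = g" if "f \<in> Hom (Mod C R) X (Z, mor (zer (Carr R \<boxtimes> Z) Z))"
      "g \<in> Hom (Mod C R) X (Z, mor (zer (Carr R \<boxtimes> Z) Z))"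
      using zero(1)[of "fst X" f g] Hom_Mod_in[OF X ob that(1)] Hom_Mod_in[OF X ob that(2)] X by simp
    show "f = g" if "f \<in> Hom (Mod C R) (Z, mor (zer (Carr R \<boxtimes> Z) Z)) X"
      "g \<in> Hom (Mod C R) (Z, mor (zer (Carr R \<boxtimes> Z) Z)) X"
      using zero(2)[of "fst X" f g] Hom_Mod_in[OF ob X that(1)] Hom_Mod_in[OF ob X that(2)] X by simp
  qed
qed

lemma Mod_biproduct:
  assumes M: "M \<in> Ob (Mod C R)" and N: "N \<in> Ob (Mod C R)"
  shows "\<exists>P i j p q. biproduct (Mod C R) M N P i j p q"
proof -
  obtain P i j p q where "biproduct C (fst M) (fst N) P i j p q"
    by (rule biproduct_exists[OF module_ob[OF M] module_ob[OF N]])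
  then interpret biproduct C "fst M" "fst N" P i j p q .
  let ?T = "\<lambda>F. ide (Carr R) \<diamond> F"
  \<comment> \<open>The sum of the two actions along the injections. It is the only action making
    both projections linear, since these are jointly monic.\<close>
  define r where "r = (i \<bullet> act M \<bullet> ?T p) \<boxplus> (j \<bullet> act N \<bullet> ?T q)"
  have r: "arr r" "src r = Carr R \<boxtimes> P" "tgt r = P"
    using M N by (simp_all add: r_def)
  have pr: "p \<bullet> r = act M \<bullet> ?T p"
    unfolding r_def using M N comp_reassoc[OF pi, of "act M \<bullet> ?T p"] comp_reassoc[OF pj, of "act N \<bullet> ?T q"]
    by (simp add: comp_plus)
  have qr: "q \<bullet> r = act N \<bullet> ?T q"
    unfolding r_def using M N comp_reassoc[OF qj, of "act N \<bullet> ?T q"] comp_reassoc[OF qi, of "act M \<bullet> ?T p"]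
    by (simp add: comp_plus)
  let ?P = "(P, mor r)"
  have P: "?P \<in> Ob (Mod C R)"
    by (rule module_of_jointly_monic[OF r monic_pq, of "\<lambda>b. if b then M else N"]) (use M N pr qr in simp_all)
  have act: "act ?P = r"
    using r by (simp add: act_mk)
  have p: "lin ?P M p" and q: "lin ?P N q"
    by (rule linI; use pr qr act in simp)+
  have i: "lin M ?P i"
    by (rule lin_of_jointly_monic[where z = "\<lambda>b. if b then p else q" and N = "\<lambda>b. if b then M else N" and I = UNIV])
      (use M N P monic_pq p q lin_ide[OF M] lin_zer[OF M N] in simp_all)
  have j: "lin N ?P j"
    by (rule lin_of_jointly_monic[where z = "\<lambda>b. if b then p else q" and N = "\<lambda>b. if b then M else N" and I = UNIV])
      (use M N P monic_pq p q lin_ide[OF N] lin_zer[OF N M] in simp_all)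
  have eqs: "mor p \<cdot> mor i = Idn C (fst M)" "mor q \<cdot> mor j = Idn C (fst N)"
    "Plus C (mor i \<cdot> mor p) (mor j \<cdot> mor q) = Idn C (fst ?P)"
    using arg_cong[OF pi, of mor] arg_cong[OF qj, of mor] arg_cong[OF sum, of mor]
    by (simp_all only: comp_simps ide_simps plus_simps fst_conv)
  have "biproduct (Mod C R) M N ?P (Arrow M ?P (mor i)) (Arrow N ?P (mor j)) (Arrow ?P M (mor p)) (Arrow ?P N (mor q))"
    using eqs P M N Hom_Mod_mor[OF M P i] Hom_Mod_mor[OF N P j] Hom_Mod_mor[OF P M p] Hom_Mod_mor[OF P N q]
    by (intro biproduct.intro biproduct_axioms.intro Mod.preadditive_category_axioms)
      (simp_all add: Mod.comp_def Mod.ide_def Mod.plus_def)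
  then show ?thesis by blast
qed

text \<open>The last clause factors arbitrary arrows of \<open>C\<close>, linear or not: the kernel
  of modules is the kernel in \<open>C\<close>. This is what transfers monicity from
  \<open>Mod C R\<close> to \<open>C\<close>.\<close>

lemma Mod_kernel_arrow:
  assumes L: "L \<in> Ob (Mod C R)" and M: "M \<in> Ob (Mod C R)" and F: "lin L M F"
  obtains Z z where "Z \<in> Ob (Mod C R)" "lin Z L z" "F \<bullet> z = zer (fst Z) (fst M)"
    "jointly_monic (UNIV :: unit set) (\<lambda>_. z) (fst Z)"
    "\<And>G. \<lbrakk>arr G; tgt G = fst L; F \<bullet> G = zer (src G) (fst M)\<rbrakk>
      \<Longrightarrow> \<exists>H. arr H \<and> src H = src G \<and> tgt H = fst Z \<and> z \<bullet> H = G"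
proof -
  obtain z where z: "arr z" "tgt z = src F" "F \<bullet> z = zer (src z) (tgt F)"
    and monic: "jointly_monic (UNIV :: unit set) (\<lambda>_. z) (src z)"
    and fac: "\<And>G. \<lbrakk>arr G; tgt G = src F; F \<bullet> G = zer (src G) (tgt F)\<rbrakk>
      \<Longrightarrow> \<exists>H. arr H \<and> src H = src G \<and> tgt H = src z \<and> z \<bullet> H = G"
    using kernel_arrow[OF lin_arr(1)[OF F]] by metis
  let ?T = "\<lambda>F. ide (Carr R) \<diamond> F"
  \<comment> \<open>The action of \<open>L\<close> restricted along \<open>z\<close> is killed by
    \<open>F\<close>; its factor through the kernel is the action on \<open>Z\<close>.\<close>
  have "F \<bullet> act L \<bullet> ?T z = (act M \<bullet> ?T F) \<bullet> ?T z"
    using L z F by (intro comp_reassoc lin_act) auto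
  also have "\<dots> = act M \<bullet> ?T (F \<bullet> z)"
    using M z(1,2) F by (simp add: tensor_comp)
  also have "\<dots> = zer (Carr R \<boxtimes> src z) (fst M)"
    unfolding z(3) using M z(1) F by simp
  finally obtain r where r: "arr r" "src r = Carr R \<boxtimes> src z" "tgt r = src z" "z \<bullet> r = act L \<bullet> ?T z"
    using fac[of "act L \<bullet> ?T z"] z(1,2) L F by auto
  let ?Z = "(src z, mor r)"
  have Z: "?Z \<in> Ob (Mod C R)"
    by (rule module_of_jointly_monic[OF r(1-3) monic, of "\<lambda>_. L"]) (use L z r F in simp_all)
  have lin: "lin ?Z L z"
    by (rule linI) (use z(1,2) r lin_arr(2)[OF F] in \<open>simp_all add: act_mk\<close>)
  note F_ends = lin_arr(2,3)[OF F]
  show ?thesis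
  proof (rule that[OF Z lin])
    show "F \<bullet> z = zer (fst ?Z) (fst M)" "jointly_monic (UNIV :: unit set) (\<lambda>_. z) (fst ?Z)"
      using z(3) monic F_ends by simp_all
    show "\<exists>H. arr H \<and> src H = src G \<and> tgt H = fst ?Z \<and> z \<bullet> H = G"
      if "arr G" "tgt G = fst L" "F \<bullet> G = zer (src G) (fst M)" for G
      using fac[of G] that F_ends by simp
  qed
qed

lemma Mod_kernel:
  assumes L: "L \<in> Ob (Mod C R)" and M: "M \<in> Ob (Mod C R)" and f: "f \<in> Hom (Mod C R) L M"
  shows "\<exists>Z z. is_kernel (Mod C R) L M f Z z"
proof -
  let ?F = "Arrow (fst L) (fst M) f"
  obtain Z z where Z: "Z \<in> Ob (Mod C R)" "lin Z L z" "?F \<bullet> z = zer (fst Z) (fst M)"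
    and monic: "jointly_monic (UNIV :: unit set) (\<lambda>_. z) (fst Z)"
    and fac: "\<And>G. \<lbrakk>arr G; tgt G = fst L; ?F \<bullet> G = zer (src G) (fst M)\<rbrakk>
      \<Longrightarrow> \<exists>H. arr H \<and> src H = src G \<and> tgt H = fst Z \<and> z \<bullet> H = G"
    using Mod_kernel_arrow[OF L M lin_arrow[OF L M f]] by metis
  have "is_kernel (Mod C R) L M f Z (mor z)"
    unfolding is_kernel_def
  proof (intro conjI ballI impI)
    show "f \<cdot>\<^bsub>Mod C R\<^esub> mor z = Zero (Mod C R) Z M"
      using arg_cong[OF Z(3), of mor] by simp
    fix W g assume W: "W \<in> Ob (Mod C R)" and g: "g \<in> Hom (Mod C R) W L"
      and fg: "f \<cdot>\<^bsub>Mod C R\<^esub> g = Zero (Mod C R) W M"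
    let ?G = "Arrow (fst W) (fst L) g"
    have G: "lin W L ?G" by (rule lin_arrow[OF W L g])
    have "?F \<bullet> ?G = zer (fst W) (fst M)"
      by (rule arrow_eqI) (use fg in simp_all)
    then obtain H where H: "arr H" "src H = fst W" "tgt H = fst Z" "z \<bullet> H = ?G"
      using fac[of ?G] lin_arr(1)[OF G] by auto
    have linH: "lin W Z H"
      by (rule lin_of_jointly_monic[OF Z(1) W monic, of "\<lambda>_. L"]) (use Z L H G in simp_all)
    show "\<exists>!h. h \<in> Hom (Mod C R) W Z \<and> mor z \<cdot>\<^bsub>Mod C R\<^esub> h = g"
    proof (rule ex1I[of _ "mor H"])
      show "mor H \<in> Hom (Mod C R) W Z \<and> mor z \<cdot>\<^bsub>Mod C R\<^esub> mor H = g"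
        using Hom_Mod_mor[OF W Z(1) linH] arg_cong[OF H(4), of mor] by simp
      fix h assume h: "h \<in> Hom (Mod C R) W Z \<and> mor z \<cdot>\<^bsub>Mod C R\<^esub> h = g"
      have h': "lin W Z (Arrow (fst W) (fst Z) h)"
        using h lin_arrow[OF W Z(1)] by blast
      have "Arrow (fst W) (fst Z) h = H"
      proof (rule jointly_monicD[OF monic])
        have "z \<bullet> Arrow (fst W) (fst Z) h = ?G"
          by (rule arrow_eqI) (use h Z in simp_all)
        then show "z \<bullet> Arrow (fst W) (fst Z) h = z \<bullet> H" using H by simp
      qed (use lin_arr[OF h'] H in simp_all)
      then show "h = mor H" by auto
    qed
  qed (use Z Hom_Mod_mor[OF _ L Z(2)] in simp_all)
  then show ?thesis by blast
qed

text \<open>The kernel of a monomorphism of modules vanishes, and it is at the same time the kernel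
  in \<open>C\<close>.\<close>

lemma Mod_monic_imp_monic:
  assumes L: "L \<in> Ob (Mod C R)" and M: "M \<in> Ob (Mod C R)" and f: "monic (Mod C R) L M f"
  shows "monic C (fst L) (fst M) f"
proof -
  have f_in: "f \<in> Hom (Mod C R) L M"
    using f by (simp add: monic_def)
  let ?F = "Arrow (fst L) (fst M) f"
  obtain Z z where Z: "Z \<in> Ob (Mod C R)" "lin Z L z" "?F \<bullet> z = zer (fst Z) (fst M)"
    and fac: "\<And>G. \<lbrakk>arr G; tgt G = fst L; ?F \<bullet> G = zer (src G) (fst M)\<rbrakk>
      \<Longrightarrow> \<exists>H. arr H \<and> src H = src G \<and> tgt H = fst Z \<and> z \<bullet> H = G"
    using Mod_kernel_arrow[OF L M lin_arrow[OF L M f_in]] by metis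
  have "mor z = Zero (Mod C R) Z L"
    using f Mod.monic_iff_kernel_zero[OF L M f_in] Z(1) Hom_Mod_mor[OF Z(1) L Z(2)] arg_cong[OF Z(3), of mor]
    by simp
  then have z: "z = zer (fst Z) (fst L)"
    using Z(2) by (intro arrow_eqI) simp_all
  show ?thesis
    unfolding monic_iff_kernel_zero[OF module_ob[OF L] module_ob[OF M] Hom_Mod_in[OF L M f_in]]
  proof (intro ballI impI)
    fix W g assume W: "W \<in> Ob C" and g: "g \<in> Hom C W (fst L)" and fg: "f \<cdot> g = Zero C W (fst M)"
    let ?G = "Arrow W (fst L) g"
    have "?F \<bullet> ?G = zer W (fst M)"
      by (rule arrow_eqI) (use fg in simp_all)
    then obtain H where H: "arr H" "src H = W" "tgt H = fst Z" "z \<bullet> H = ?G"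
      using fac[of ?G] W g L by auto
    have "mor z \<cdot> mor H = g"
      using arg_cong[OF H(4), of mor] by (simp only: comp_simps arrow.sel)
    then show "g = Zero C W (fst L)"
      using Z(1) L arr_mor[OF H(1)] H(2,3) z W cmp_zero_left[of W "fst Z" "fst L" "mor H"] by simp
  qed
qed

lemma regular_ob [simp]: "regular_module R \<in> Ob (Mod C R)"
  and fst_regular [simp]: "fst (regular_module R) = Carr R"
  and act_regular [simp]: "act (regular_module R) = mul"
proof -
  show act: "act (regular_module R) = mul" and fst: "fst (regular_module R) = Carr R"
    by (simp_all add: act_def mul_def regular_module_def)
  show "regular_module R \<in> Ob (Mod C R)"
    unfolding module_iff act fst by (simp add: mul_assoc mul_unt_left)
qed

text \<open>The action descends to the cokernel taken in \<open>C\<close> because tensoring with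
  \<open>Carr R\<close> preserves it. As for kernels, the factorisation property holds for all
  arrows of \<open>C\<close>.\<close>

lemma Mod_cokernel:
  assumes L: "L \<in> Ob (Mod C R)" and M: "M \<in> Ob (Mod C R)" and F: "lin L M F"
  obtains Z c where "Z \<in> Ob (Mod C R)" "lin M Z c" "c \<bullet> F = zer (fst L) (fst Z)"
    "\<And>G. \<lbrakk>arr G; src G = fst M; G \<bullet> F = zer (fst L) (tgt G)\<rbrakk>
      \<Longrightarrow> \<exists>H. arr H \<and> src H = fst Z \<and> tgt H = tgt G \<and> H \<bullet> c = G"
proof -
  obtain c where c: "arr c" "src c = tgt F" "c \<bullet> F = zer (src F) (tgt c)"
    and epic: "jointly_epic (UNIV :: unit set) (\<lambda>_. c) (tgt c)"
    and fac: "\<And>G. \<lbrakk>arr G; src G = tgt F; G \<bullet> F = zer (src F) (tgt G)\<rbrakk>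
      \<Longrightarrow> \<exists>H. arr H \<and> src H = tgt c \<and> tgt H = tgt G \<and> H \<bullet> c = G"
    using cokernel_arrow[OF lin_arr(1)[OF F]] by metis
  let ?T = "\<lambda>F. ide (Carr R) \<diamond> F"
  have "(c \<bullet> act M) \<bullet> ?T F = c \<bullet> F \<bullet> act L"
    using L M c(1,2) F lin_act[OF F] by simp
  also have "\<dots> = zer (fst L) (tgt c) \<bullet> act L"
    using L M c F by (intro comp_reassoc) simp_all
  finally have "(c \<bullet> act M) \<bullet> ?T F = zer (Carr R \<boxtimes> src F) (tgt (c \<bullet> act M))"
    using c(1) L F by simp
  then obtain r where r: "arr r" "src r = Carr R \<boxtimes> tgt c" "tgt r = tgt c" "r \<bullet> ?T c = c \<bullet> act M"
    using cokernel_tensor[OF lin_arr(1)[OF F] c(1,2) fac, of "Carr R" "c \<bullet> act M"] c(1,2) M F by auto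
  let ?Z = "(tgt c, mor r)"
  have Z: "?Z \<in> Ob (Mod C R)"
    by (rule module_of_epic[OF r(1-3) epic M c(1)]) (use c r F in simp_all)
  have lin: "lin M ?Z c"
    by (rule linI) (use c(1,2) r lin_arr(3)[OF F] in \<open>simp_all add: act_mk\<close>)
  note F_ends = lin_arr(2,3)[OF F]
  show ?thesis
  proof (rule that[OF Z lin])
    show "c \<bullet> F = zer (fst L) (fst ?Z)"
      using c(3) F_ends by simp
    show "\<exists>H. arr H \<and> src H = fst ?Z \<and> tgt H = tgt G \<and> H \<bullet> c = G"
      if "arr G" "src G = fst M" "G \<bullet> F = zer (fst L) (tgt G)" for G
      using fac[of G] that F_ends by simp
  qed
qed

text \<open>Every arrow from \<open>G\<close> to \<open>M\<close> lifts along \<open>f\<close>, so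
  the cokernel of \<open>f\<close> kills it and is therefore zero. Hence \<open>f\<close> is epic as
  well as monic in the abelian category \<open>C\<close> and has an inverse there, which is again
  linear.\<close>

lemma iso_of_generator:
  assumes gen: "\<And>M N c. \<lbrakk>M \<in> Ob (Mod C R); N \<in> Ob (Mod C R); c \<in> Hom (Mod C R) M N;
      \<And>x. x \<in> Hom (Mod C R) G M \<Longrightarrow> c \<cdot> x = Zero C (fst G) (fst N)\<rbrakk> \<Longrightarrow> c = Zero C (fst M) (fst N)"
    and G: "G \<in> Ob (Mod C R)" and L: "L \<in> Ob (Mod C R)" and M: "M \<in> Ob (Mod C R)"
    and f: "monic (Mod C R) L M f"
    and lift: "\<And>x. x \<in> Hom (Mod C R) G M \<Longrightarrow> \<exists>y\<in>Hom (Mod C R) G L. f \<cdot> y = x"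
  shows "iso_arr (Mod C R) L M f"
proof -
  have f_in: "f \<in> Hom (Mod C R) L M"
    using f by (simp add: monic_def)
  let ?F = "Arrow (fst L) (fst M) f"
  obtain Z c where Z: "Z \<in> Ob (Mod C R)" "lin M Z c" "c \<bullet> ?F = zer (fst L) (fst Z)"
    and fac: "\<And>G. \<lbrakk>arr G; src G = fst M; G \<bullet> ?F = zer (fst L) (tgt G)\<rbrakk>
      \<Longrightarrow> \<exists>H. arr H \<and> src H = fst Z \<and> tgt H = tgt G \<and> H \<bullet> c = G"
    using Mod_cokernel[OF L M lin_arrow[OF L M f_in]] by metis
  note c_in = Hom_Mod_mor[OF M Z(1,2)]
  have cf: "mor c \<cdot> f = Zero C (fst L) (fst Z)"
    using arg_cong[OF Z(3), of mor] by simp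
  have "mor c = Zero C (fst M) (fst Z)"
  proof (rule gen[OF M Z(1) c_in])
    fix x assume "x \<in> Hom (Mod C R) G M"
    then obtain y where y: "y \<in> Hom (Mod C R) G L" "f \<cdot> y = x"
      using lift by blast
    have "mor c \<cdot> x = (mor c \<cdot> f) \<cdot> y"
      using Mod.cmp_assoc[OF G L M Z(1) y(1) f_in c_in] y(2) by simp
    then show "mor c \<cdot> x = Zero C (fst G) (fst Z)"
      using cf Mod.cmp_zero_left[OF G L Z(1) y(1)] by simp
  qed
  then have c: "c = zer (fst M) (fst Z)"
    using Z(2) by (intro arrow_eqI) simp_all
  obtain h where h: "h \<in> Hom C (fst M) (fst L)" "f \<cdot> h = Idn C (fst M)" "h \<cdot> f = Idn C (fst L)"
  proof (rule monic_epic_retraction[OF Mod_monic_imp_monic[OF L M f] module_ob[OF L] module_ob[OF M]])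
    fix W g assume W: "W \<in> Ob C" and g: "g \<in> Hom C (fst M) W" and gf: "g \<cdot> f = Zero C (fst L) W"
    let ?G = "Arrow (fst M) W g"
    have "?G \<bullet> ?F = zer (fst L) W"
      by (rule arrow_eqI) (use gf in simp_all)
    then obtain H where H: "arr H" "src H = fst Z" "tgt H = W" "H \<bullet> c = ?G"
      using fac[of ?G] W g M by auto
    have "mor H \<cdot> mor c = g"
      using arg_cong[OF H(4), of mor] by (simp only: comp_simps arrow.sel)
    then show "g = Zero C (fst M) W"
      using c Z(1) M arr_mor[OF H(1)] H(2,3) W cmp_zero_right[of "fst M" "fst Z" W "mor H"] by simp
  qed blast
  have "lin M L (Arrow (fst M) (fst L) h)"
  proof (rule lin_of_jointly_monic[OF L M, of "UNIV :: unit set" "\<lambda>_. ?F" "\<lambda>_. M"])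
    show "jointly_monic (UNIV :: unit set) (\<lambda>_. ?F) (fst L)"
      unfolding jointly_monic_def
    proof (intro allI impI)
      fix G H assume GH: "arr G" "arr H" "tgt G = fst L" "tgt H = fst L" "src G = src H"
        and "\<forall>a\<in>UNIV. ?F \<bullet> G = ?F \<bullet> H"
      then have eq: "?F \<bullet> G = ?F \<bullet> H" by simp
      have "f \<cdot> mor G = f \<cdot> mor H"
        using arg_cong[OF eq, of mor] by simp
      then have "mor G = mor H"
        using Mod_monic_imp_monic[OF L M f] arr_mor[OF GH(1)] arr_mor[OF GH(2)] arr_src[OF GH(1)] GH(3-5)
        unfolding monic_def by auto
      then show "G = H"
        by (rule arrow_eqI[rotated 2]) (use GH in simp_all)
    qed
    have "?F \<bullet> Arrow (fst M) (fst L) h = ide (fst M)"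
      by (rule arrow_eqI) (simp_all add: h)
    then show "M \<in> Ob (Mod C R) \<and> lin L M ?F \<and> lin M M (?F \<bullet> Arrow (fst M) (fst L) h)"
      using M lin_arrow[OF L M f_in] lin_ide[OF M] by simp
  qed (use h L M in simp_all)
  then have "h \<in> Hom (Mod C R) M L"
    using Hom_Mod_iff[OF M L] by simp
  then show ?thesis
    using h f_in unfolding iso_arr_def by auto
qed

text \<open>Linearity lets \<open>F\<close> pass to the right factor of a product; commutativity of
  the multiplication moves it to the left one.\<close>

lemma endomorphism_mul:
  assumes F: "lin (regular_module R) (regular_module R) F"
  shows "F \<bullet> mul = mul \<bullet> (F \<diamond> ide (Carr R))"
proof -
  have F': "arr F" "src F = Carr R" "tgt F = Carr R"
    using lin_arr[OF F] by simp_all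
  have "F \<bullet> mul = F \<bullet> mul \<bullet> brd (Carr R) (Carr R)"
    by (simp add: mul_brd)
  also have "\<dots> = (mul \<bullet> (ide (Carr R) \<diamond> F)) \<bullet> brd (Carr R) (Carr R)"
    using lin_act[OF F] F' by (intro comp_reassoc) simp_all
  also have "\<dots> = mul \<bullet> brd (Carr R) (Carr R) \<bullet> (F \<diamond> ide (Carr R))"
    using F' brd_nat[of F "ide (Carr R)"] by simp
  also have "\<dots> = mul \<bullet> (F \<diamond> ide (Carr R))"
    using F' by (intro comp_reassoc mul_brd) simp_all
  finally show ?thesis .
qed

text \<open>An argument in the style of Eckmann and Hilton: applied to a product, one endomorphism
  acts on the left factor and the other on the right, in either order. Then \<open>mul\<close> is
  cancelled by inserting the unit, which turns it into the invertible left unitor.\<close>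

lemma endomorphism_commute:
  assumes f: "f \<in> Hom (Mod C R) (regular_module R) (regular_module R)"
    and g: "g \<in> Hom (Mod C R) (regular_module R) (regular_module R)"
  shows "f \<cdot> g = g \<cdot> f"
proof -
  let ?R = "Carr R"
  let ?F = "Arrow ?R ?R f" and ?G = "Arrow ?R ?R g"
  have F: "lin (regular_module R) (regular_module R) ?F" and G: "lin (regular_module R) (regular_module R) ?G"
    using lin_arrow[OF regular_ob regular_ob f] lin_arrow[OF regular_ob regular_ob g] by simp_all
  have FG: "arr ?F" "arr ?G"
    using lin_arr(1)[OF F] lin_arr(1)[OF G] by auto
  have "?F \<bullet> ?G \<bullet> mul = ?F \<bullet> mul \<bullet> (ide ?R \<diamond> ?G)"
    using lin_act[OF G] by simp
  also have "\<dots> = (mul \<bullet> (?F \<diamond> ide ?R)) \<bullet> (ide ?R \<diamond> ?G)"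
    using FG by (intro comp_reassoc endomorphism_mul[OF F]) simp_all
  also have "\<dots> = mul \<bullet> (ide ?R \<diamond> ?G) \<bullet> (?F \<diamond> ide ?R)"
    using FG by (simp add: tensor_comp del: arr_Arrow)
  also have "\<dots> = (?G \<bullet> mul) \<bullet> (?F \<diamond> ide ?R)"
    using FG lin_act[OF G] by (intro comp_reassoc) simp_all
  also have "\<dots> = ?G \<bullet> ?F \<bullet> mul"
    using FG endomorphism_mul[OF F] by simp
  finally have "(?F \<bullet> ?G) \<bullet> mul = (?G \<bullet> ?F) \<bullet> mul"
    using FG by (simp del: arr_Arrow)
  from comp_reassoc[OF this, of "unt \<diamond> ide ?R"]
  have "(?F \<bullet> ?G) \<bullet> mul \<bullet> (unt \<diamond> ide ?R) = ((?G \<bullet> ?F) \<bullet> mul) \<bullet> (unt \<diamond> ide ?R)"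
    using FG by (simp only: arr_comp arr_mul arr_tensor arr_unt arr_ide carr comp_simps mul_simps unt_simps
      tensor_simps ide_simps arrow.sel)
  also have "\<dots> = (?G \<bullet> ?F) \<bullet> mul \<bullet> (unt \<diamond> ide ?R)"
    using FG by (intro comp_assoc) (simp_all del: arr_Arrow)
  finally have "?F \<bullet> ?G = ?G \<bullet> ?F"
    unfolding mul_unt_left by - (rule iso_epi[of "lun ?R"], use FG in simp_all)
  from arg_cong[OF this, of mor] show ?thesis by simp
qed

text \<open>The regular module is free on its unit: a linear arrow \<open>H\<close> is recovered
  from its value there as \<open>a \<mapsto> a H(1)\<close>.\<close>

lemma lin_regular_unique:
  assumes N: "N \<in> Ob (Mod C R)" and F: "lin (regular_module R) N F" and G: "lin (regular_module R) N G"
    and eq: "F \<bullet> unt = G \<bullet> unt"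
  shows "F = G"
proof -
  have *: "H \<bullet> run (Carr R) = act N \<bullet> (ide (Carr R) \<diamond> (H \<bullet> unt))" if "lin (regular_module R) N H" for H
  proof -
    have H: "arr H" "src H = Carr R" "tgt H = fst N"
      using lin_arr[OF that] by simp_all
    have "H \<bullet> run (Carr R) = H \<bullet> mul \<bullet> (ide (Carr R) \<diamond> unt)"
      by (simp add: mul_unt_right)
    also have "\<dots> = (act N \<bullet> (ide (Carr R) \<diamond> H)) \<bullet> (ide (Carr R) \<diamond> unt)"
      using lin_act[OF that] H by (intro comp_reassoc) simp_all
    finally show ?thesis
      using H N by (simp add: tensor_comp)
  qed
  have "F \<bullet> run (Carr R) = G \<bullet> run (Carr R)"
    unfolding *[OF F] *[OF G] eq ..
  then show ?thesis
    by - (rule iso_epi[of "run (Carr R)"], use lin_arr[OF F] lin_arr[OF G] in simp_all)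
qed

text \<open>The arrow sought is \<open>a \<mapsto> a x\<close>, the action after the inverse right
  unitor. Its linearity is associativity of the action combined with \<open>run_tensor\<close>, and
  its value at the unit is computed with \<open>lun_unit\<close>.\<close>

lemma lin_regular_exists:
  assumes N: "N \<in> Ob (Mod C R)" and x: "arr x" "src x = Unit_ob C" "tgt x = fst N"
  obtains U where "lin (regular_module R) N U" "U \<bullet> unt = x"
proof -
  let ?R = "Carr R" and ?I = "Unit_ob C"
  obtain U where U: "arr U" "src U = ?R" "tgt U = fst N" "U \<bullet> run ?R = act N \<bullet> (ide ?R \<diamond> x)"
    by (rule iso_factor[of "run ?R" "act N \<bullet> (ide ?R \<diamond> x)"]) (use N x in auto)
  have "(U \<bullet> mul) \<bullet> run (?R \<boxtimes> ?R) = U \<bullet> run ?R \<bullet> (mul \<diamond> ide ?I)"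
    using U(1-3) run_nat[of mul] by simp
  also have "\<dots> = (act N \<bullet> (ide ?R \<diamond> x)) \<bullet> (mul \<diamond> ide ?I)"
    using U by (intro comp_reassoc) auto
  also have "\<dots> = act N \<bullet> (mul \<diamond> ide (fst N)) \<bullet> (ide (?R \<boxtimes> ?R) \<diamond> x)"
    using N x by (simp add: tensor_comp)
  also have "\<dots> = (act N \<bullet> (ide ?R \<diamond> act N) \<bullet> asc ?R ?R (fst N)) \<bullet> (ide (?R \<boxtimes> ?R) \<diamond> x)"
    using N x by (intro comp_reassoc act_mul) auto
  also have "\<dots> = act N \<bullet> (ide ?R \<diamond> act N) \<bullet> (ide ?R \<diamond> ide ?R \<diamond> x) \<bullet> asc ?R ?R ?I"
    using N x asc_nat[of "ide ?R" "ide ?R" x] by simp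
  also have "\<dots> = act N \<bullet> (ide ?R \<diamond> (U \<bullet> run ?R)) \<bullet> asc ?R ?R ?I"
    unfolding U(4) using N x by (simp add: tensor_comp')
  also have "\<dots> = act N \<bullet> (ide ?R \<diamond> U) \<bullet> (ide ?R \<diamond> run ?R) \<bullet> asc ?R ?R ?I"
    using U(1-3) N by (simp add: tensor_comp')
  also have "\<dots> = (act N \<bullet> (ide ?R \<diamond> U)) \<bullet> run (?R \<boxtimes> ?R)"
    using U(1-3) N by (simp add: run_tensor)
  finally have "U \<bullet> mul = act N \<bullet> (ide ?R \<diamond> U)"
    by - (rule iso_epi[of "run (?R \<boxtimes> ?R)"], use U(1-3) N in simp_all)
  then have lin: "lin (regular_module R) N U"
    using U by (intro linI) simp_all
  have "(U \<bullet> unt) \<bullet> run ?I = U \<bullet> run ?R \<bullet> (unt \<diamond> ide ?I)"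
    using U(1-3) run_nat[of unt] by simp
  also have "\<dots> = (act N \<bullet> (ide ?R \<diamond> x)) \<bullet> (unt \<diamond> ide ?I)"
    using U by (intro comp_reassoc) auto
  also have "\<dots> = act N \<bullet> (unt \<diamond> ide (fst N)) \<bullet> (ide ?I \<diamond> x)"
    using N x by (simp add: tensor_comp)
  also have "\<dots> = lun (fst N) \<bullet> (ide ?I \<diamond> x)"
    using N x by (intro comp_reassoc act_unt) auto
  also have "\<dots> = x \<bullet> run ?I"
    using x lun_nat[of x] by (simp add: lun_unit)
  finally have "U \<bullet> unt = x"
    by - (rule iso_epi[of "run ?I"], use U(1-3) x in simp_all)
  then show ?thesis using that lin by blast
qed

end

section \<open>Restriction of scalars along an arrow of monoid objects\<close>

locale monoid_arrow = abelian_closed_symmetric_monoidal_category C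
  + A: monoid_in_category C A + B: monoid_in_category C B
  for C :: "('o, 'm, 'x) moncat_scheme" (structure) and A B :: "('o, 'm) monoid_object" +
  fixes l :: 'm
  assumes l: "l \<in> Hom (Comm C) A B"
begin

text \<open>\<open>A\<close> acts through \<open>l\<close>. The underlying object stays the same, so
  a \<open>B\<close>-linear arrow is its own restriction.\<close>

definition restrict :: "'o \<times> 'm \<Rightarrow> 'o \<times> 'm" where
  "restrict N = (fst N, snd N \<cdot> (l \<star> Idn C (fst N)))"

definition str :: "('o, 'm) arrow" where
  "str = Arrow (Carr A) (Carr B) l"

lemma str_simps [simp]: "src str = Carr A" "tgt str = Carr B" "mor str = l"
  by (simp_all add: str_def)

lemma arr_str [simp]: "arr str"
  using l by (simp add: str_def Comm_def)

lemma str_mul: "str \<bullet> A.mul = B.mul \<bullet> (str \<diamond> str)"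
  by (rule arrow_eqI) (use l in \<open>simp_all add: Comm_def\<close>)

lemma str_unt: "str \<bullet> A.unt = B.unt"
  by (rule arrow_eqI) (use l in \<open>simp_all add: Comm_def\<close>)

lemma fst_restrict [simp]: "fst (restrict N) = fst N"
  by (simp add: restrict_def)

lemma act_restrict [simp]: "A.act (restrict N) = B.act N \<bullet> (str \<diamond> ide (fst N))"
  by (rule arrow_eqI) (simp_all add: restrict_def)

lemma algebra_module_eq: "algebra_module C B l = restrict (regular_module B)"
  by (simp add: algebra_module_def restrict_def regular_module_def)

lemma restrict_ob [simp]:
  assumes N: "N \<in> Ob (Mod C B)"
  shows "restrict N \<in> Ob (Mod C A)"
proof -
  let ?A = "Carr A" and ?B = "Carr B" and ?N = "fst N"
  let ?r = "B.act N \<bullet> (str \<diamond> ide ?N)"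
  have "?r \<bullet> (A.mul \<diamond> ide ?N) = B.act N \<bullet> ((str \<bullet> A.mul) \<diamond> ide ?N)"
    using N by (simp add: tensor_comp)
  also have "\<dots> = B.act N \<bullet> (B.mul \<diamond> ide ?N) \<bullet> ((str \<diamond> str) \<diamond> ide ?N)"
    unfolding str_mul using N by (simp add: tensor_comp)
  also have "\<dots> = (B.act N \<bullet> (ide ?B \<diamond> B.act N) \<bullet> asc ?B ?B ?N) \<bullet> ((str \<diamond> str) \<diamond> ide ?N)"
    using N by (intro comp_reassoc B.act_mul) auto
  also have "\<dots> = B.act N \<bullet> (ide ?B \<diamond> B.act N) \<bullet> (str \<diamond> (str \<diamond> ide ?N)) \<bullet> asc ?A ?A ?N"
    using N asc_nat[of str str "ide ?N"] by simp
  also have "\<dots> = ?r \<bullet> (ide ?A \<diamond> ?r) \<bullet> asc ?A ?A ?N"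
    using N by (simp add: tensor_comp')
  finally have 1: "?r \<bullet> (A.mul \<diamond> ide ?N) = ?r \<bullet> (ide ?A \<diamond> ?r) \<bullet> asc ?A ?A ?N" .
  have "?r \<bullet> (A.unt \<diamond> ide ?N) = B.act N \<bullet> ((str \<bullet> A.unt) \<diamond> ide ?N)"
    using N by (simp add: tensor_comp)
  also have "\<dots> = lun ?N"
    unfolding str_unt by (rule B.act_unt[OF N])
  finally show ?thesis
    unfolding A.module_iff using N 1 by simp
qed

lemma restrict_Hom:
  assumes M: "M \<in> Ob (Mod C B)" and N: "N \<in> Ob (Mod C B)" and f: "f \<in> Hom (Mod C B) M N"
  shows "f \<in> Hom (Mod C A) (restrict M) (restrict N)"
proof -
  let ?F = "Arrow (fst M) (fst N) f"
  have F: "B.lin M N ?F" by (rule B.lin_arrow[OF M N f])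
  have F': "arr ?F"
    using B.lin_arr(1)[OF F] .
  have "A.lin (restrict M) (restrict N) ?F"
  proof (rule A.linI)
    have "?F \<bullet> B.act M \<bullet> (str \<diamond> ide (fst M)) = (B.act N \<bullet> (ide (Carr B) \<diamond> ?F)) \<bullet> (str \<diamond> ide (fst M))"
      using M F' by (intro comp_reassoc B.lin_act[OF F]) (simp_all del: arr_Arrow)
    also have "\<dots> = (B.act N \<bullet> (str \<diamond> ide (fst N))) \<bullet> (ide (Carr A) \<diamond> ?F)"
      using M N F' by (simp add: tensor_comp del: arr_Arrow)
    finally show "?F \<bullet> A.act (restrict M) = A.act (restrict N) \<bullet> (ide (Carr A) \<diamond> ?F)"
      by simp
  qed (use F' in simp_all)
  then show ?thesis
    using M N by (simp add: A.Hom_Mod_iff)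
qed

lemma str_lin: "A.lin (regular_module A) (restrict (regular_module B)) str"
  by (rule A.linI) (simp_all add: str_mul tensor_comp)

lemma str_Hom: "l \<in> Hom (Mod C A) (regular_module A) (restrict (regular_module B))"
  using A.Hom_Mod_mor[OF _ _ str_lin] by simp

text \<open>Both \<open>B\<close>-linear arrows out of \<open>B\<close> and \<open>A\<close>-linear
  arrows out of \<open>A\<close> amount to arrows from the unit object into \<open>N\<close>, and
  \<open>l\<close> preserves units. So composing with \<open>l\<close> is bijective; the next lemma
  is the injective half.\<close>

lemma extend:
  assumes N: "N \<in> Ob (Mod C B)" and u: "u \<in> Hom (Mod C A) (regular_module A) (restrict N)"
  shows "\<exists>v\<in>Hom (Mod C B) (regular_module B) N. v \<cdot> l = u"
proof -
  let ?U = "Arrow (Carr A) (fst N) u"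
  have U: "A.lin (regular_module A) (restrict N) ?U"
    using A.lin_arrow[OF _ _ u] N by simp
  then have "arr ?U" by (rule A.lin_arr)
  then obtain V where V: "B.lin (regular_module B) N V" "V \<bullet> B.unt = ?U \<bullet> A.unt"
    using B.lin_regular_exists[OF N, of "?U \<bullet> A.unt"] by (auto simp del: arr_Arrow)
  have v: "mor V \<in> Hom (Mod C B) (regular_module B) N"
    using B.Hom_Mod_mor[OF _ N V(1)] by simp
  have V': "arr V" "src V = Carr B" "tgt V = fst N"
    using B.lin_arr[OF V(1)] by simp_all
  have "A.lin (restrict (regular_module B)) (restrict N) (Arrow (Carr B) (fst N) (mor V))"
    using A.lin_arrow[OF _ _ restrict_Hom[OF _ N v]] N by simp
  then have "A.lin (restrict (regular_module B)) (restrict N) V"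
    using V' by (metis arrow.collapse)
  then have "A.lin (regular_module A) (restrict N) (V \<bullet> str)"
    using A.lin_comp[OF _ _ _ str_lin] N by simp
  then have "V \<bullet> str = ?U"
    by (rule A.lin_regular_unique[OF restrict_ob[OF N] _ U]) (use V V' in \<open>simp add: str_unt\<close>)
  from arg_cong[OF this, of mor] have "mor V \<cdot> l = u" by simp
  then show ?thesis using v by blast
qed

lemma extend_unique:
  assumes N: "N \<in> Ob (Mod C B)" and v: "v \<in> Hom (Mod C B) (regular_module B) N"
    and w: "w \<in> Hom (Mod C B) (regular_module B) N" and eq: "v \<cdot> l = w \<cdot> l"
  shows "v = w"
proof -
  let ?V = "Arrow (Carr B) (fst N) v" and ?W = "Arrow (Carr B) (fst N) w"
  have V: "B.lin (regular_module B) N ?V" and W: "B.lin (regular_module B) N ?W"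
    using B.lin_arrow[OF _ N v] B.lin_arrow[OF _ N w] by simp_all
  have "?V \<bullet> str = ?W \<bullet> str"
    by (rule arrow_eqI) (use eq in simp_all)
  then have "(?V \<bullet> str) \<bullet> A.unt = (?W \<bullet> str) \<bullet> A.unt" by simp
  then have "?V \<bullet> B.unt = ?W \<bullet> B.unt"
    using B.lin_arr(1)[OF V] B.lin_arr(1)[OF W] by (simp add: str_unt del: arr_Arrow)
  then have "?V = ?W"
    by (rule B.lin_regular_unique[OF N V W])
  then show ?thesis by simp
qed

end

section \<open>Filtered colimits\<close>

lemma ex1_eqD: "\<lbrakk>\<exists>!x. P x; P a; P b\<rbrakk> \<Longrightarrow> a = b"
  by blast

lemma is_coproduct_factor:
  assumes P: "is_coproduct D I X P inc" and N: "N \<in> Ob D" and x: "\<And>i. i \<in> I \<Longrightarrow> x i \<in> Hom D (X i) N"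
  shows "\<exists>!h. h \<in> Hom D P N \<and> (\<forall>i\<in>I. h \<cdot>\<^bsub>D\<^esub> inc i = x i)"
  by (rule P[unfolded is_coproduct_def, THEN conjunct2, THEN conjunct2, THEN bspec, OF N, THEN spec, THEN mp])
    (use x in blast)

lemma colimit_factor:
  "\<lbrakk>is_colimit J D Fo Fm L l; cocone J D Fo Fm N n\<rbrakk>
    \<Longrightarrow> \<exists>!h. h \<in> Hom D L N \<and> (\<forall>i\<in>Ob J. h \<cdot>\<^bsub>D\<^esub> l i = n i)"
  unfolding is_colimit_def by (elim conjE allE impE)

lemma colimit_leg: "\<lbrakk>is_colimit J D Fo Fm L l; i \<in> Ob J\<rbrakk> \<Longrightarrow> l i \<in> Hom D (Fo i) L"
  unfolding is_colimit_def cocone_def by simp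

lemma colimit_leg_cmp:
  "\<lbrakk>is_colimit J D Fo Fm L l; i \<in> Ob J; j \<in> Ob J; u \<in> Hom J i j\<rbrakk> \<Longrightarrow> l j \<cdot>\<^bsub>D\<^esub> Fm i j u = l i"
  unfolding is_colimit_def cocone_def by blast

text \<open>An infinite set absorbs its square through a pairing \<open>g\<close>. A list is coded
  by its iterated pairing, ended by a fixed \<open>x0\<close>, together with its length, embedded by
  \<open>c\<close>; the length tells how often to unpair.\<close>

lemma lists_lepoll_infinite:
  assumes "infinite X"
  shows "lists X \<lesssim> X"
proof -
  obtain g where g: "bij_betw g (X \<times> X) X"
    using card_of_Times_same_infinite[OF assms] unfolding card_of_ordIso[symmetric] by blast
  then have inj: "inj_on g (X \<times> X)" and into: "\<And>x y. x \<in> X \<Longrightarrow> y \<in> X \<Longrightarrow> g (x, y) \<in> X"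
    by (auto simp: bij_betw_def)
  obtain x0 where x0: "x0 \<in> X"
    using assms by fastforce
  obtain c :: "nat \<Rightarrow> 'a" where c: "inj c" "range c \<subseteq> X"
    using assms infinite_countable_subset by blast
  define code where "code = foldr (\<lambda>x y. g (x, y))"
  have in_X: "set xs \<subseteq> X \<Longrightarrow> code xs x0 \<in> X" for xs
    by (induction xs) (auto simp: code_def x0 into)
  have code_inj: "\<lbrakk>set xs \<subseteq> X; set ys \<subseteq> X; length xs = length ys; code xs x0 = code ys x0\<rbrakk> \<Longrightarrow> xs = ys" for xs ys
  proof (induction xs ys rule: list_induct2')
    case (4 x xs y ys)
    have "(x, code xs x0) = (y, code ys x0)"
      using 4 in_X[of xs] in_X[of ys] by (intro inj_onD[OF inj]) (auto simp: code_def)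
    then show ?case using 4 by auto
  qed auto
  have "inj_on (\<lambda>xs. g (c (length xs), code xs x0)) (lists X)"
  proof (rule inj_onI)
    fix xs ys assume xs: "xs \<in> lists X" and ys: "ys \<in> lists X"
      and eq: "g (c (length xs), code xs x0) = g (c (length ys), code ys x0)"
    have "(c (length xs), code xs x0) = (c (length ys), code ys x0)"
      using eq xs ys in_X[of xs] in_X[of ys] c(2) by (intro inj_onD[OF inj]) auto
    then have "length xs = length ys" "code xs x0 = code ys x0"
      using injD[OF c(1)] by auto
    then show "xs = ys"
      using code_inj[of xs ys] xs ys by (auto simp: lists_eq_set)
  qed
  moreover have "(\<lambda>xs. g (c (length xs), code xs x0)) ` lists X \<subseteq> X"
    using c(2) in_X by (auto intro!: into)
  ultimately show ?thesis
    unfolding lepoll_def by blast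
qed

text \<open>A finite \<open>X\<close> has countably many lists, which is where \<open>U\<close> has
  to be strictly larger than the natural numbers; an infinite \<open>X\<close> has no more lists
  than elements.\<close>

lemma lists_lesspoll:
  fixes U :: "'u set"
  assumes "(UNIV :: nat set) \<prec> U" "X \<prec> U"
  shows "lists X \<prec> U"
proof (cases "finite X")
  case True
  then have "countable (lists X)"
    by (intro countable_lists countable_finite)
  then have "lists X \<lesssim> (UNIV :: nat set)"
    unfolding lepoll_def countable_def by auto
  then show ?thesis
    using assms(1) lesspoll_trans1 by blast
next
  case False
  then show ?thesis
    using assms(2) lists_lepoll_infinite lesspoll_trans1 by blast
qed

text \<open>A preorder as a category, with \<open>undefined\<close> as the only arrow between
  related elements. Objects and arrows share a type because filtered diagrams are indexed by values
  of \<open>('u, 'u) cat\<close>.\<close>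

definition thin_cat :: "'i set \<Rightarrow> ('i \<Rightarrow> 'i \<Rightarrow> bool) \<Rightarrow> ('i, 'i) cat" where
  "thin_cat I rel = \<lparr>Ob = I, Hom = (\<lambda>i j. {u. u = undefined \<and> rel i j}), Idn = (\<lambda>_. undefined), Cmp = (\<lambda>_ _. undefined)\<rparr>"

lemma thin_cat_simps [simp]:
  "Ob (thin_cat I rel) = I" "u \<in> Hom (thin_cat I rel) i j \<longleftrightarrow> u = undefined \<and> rel i j"
  "Idn (thin_cat I rel) i = undefined" "Cmp (thin_cat I rel) v u = undefined"
  by (simp_all add: thin_cat_def)

lemma thin_cat_Hom_empty [simp]: "Hom (thin_cat I rel) i j = {} \<longleftrightarrow> \<not> rel i j"
  by (auto simp: thin_cat_def)

lemma small_thin_cat: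
  fixes I :: "'u set"
  assumes u: "(UNIV :: nat set) \<prec> (UNIV :: 'u set)" and I: "I \<prec> (UNIV :: 'u set)"
    and refl: "\<And>i. i \<in> I \<Longrightarrow> rel i i"
    and trans: "\<And>i j k. \<lbrakk>i \<in> I; j \<in> I; k \<in> I; rel i j; rel j k\<rbrakk> \<Longrightarrow> rel i k"
  shows "small_cat TYPE('u) (thin_cat I rel)"
proof -
  have "infinite (UNIV :: 'u set)"
    using u by (simp add: infinite_le_lepoll lesspoll_imp_lepoll)
  then have "Hom (thin_cat I rel) i j \<prec> (UNIV :: 'u set)" for i j
    by (intro finite_lesspoll_infinite) (auto simp: thin_cat_def)
  moreover have "category (thin_cat I rel)"
    by unfold_locales (auto intro: refl trans)
  ultimately show ?thesis
    using I by (simp add: small_cat_def small_set_def)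
qed

lemma filtered_thin_cat:
  assumes "I \<noteq> {}" "\<And>i j. \<lbrakk>i \<in> I; j \<in> I\<rbrakk> \<Longrightarrow> \<exists>k\<in>I. rel i k \<and> rel j k" "\<And>i. i \<in> I \<Longrightarrow> rel i i"
  shows "filtered (thin_cat I rel)"
  unfolding filtered_def using assms by (simp; blast)

lemma diagram_thin_cat:
  assumes "\<And>i. i \<in> I \<Longrightarrow> Fo i \<in> Ob D"
    "\<And>i j. \<lbrakk>i \<in> I; j \<in> I; rel i j\<rbrakk> \<Longrightarrow> Fm i j \<in> Hom D (Fo i) (Fo j)"
    "\<And>i. i \<in> I \<Longrightarrow> Fm i i = Idn D (Fo i)"
    "\<And>i j k. \<lbrakk>i \<in> I; j \<in> I; k \<in> I; rel i j; rel j k\<rbrakk> \<Longrightarrow> Fm i k = Fm j k \<cdot>\<^bsub>D\<^esub> Fm i j"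
  shows "diagram (thin_cat I rel) D Fo (\<lambda>i j _. Fm i j)"
  unfolding diagram_def using assms by simp

lemma cocone_thin_cat:
  "cocone (thin_cat I rel) D Fo (\<lambda>i j _. Fm i j) N n \<longleftrightarrow> N \<in> Ob D \<and> (\<forall>i\<in>I. n i \<in> Hom D (Fo i) N) \<and>
     (\<forall>i\<in>I. \<forall>j\<in>I. rel i j \<longrightarrow> n j \<cdot>\<^bsub>D\<^esub> Fm i j = n i)"
  by (simp add: cocone_def)

section \<open>Finite generation and constant diagrams\<close>

context category
begin

text \<open>Only surjectivity of the bijection in \<open>set_colimit\<close> is extracted: an arrow
  into the colimit is the value of the class of some pair \<open>(i, g)\<close>.\<close>

lemma finitely_generated_factor:
  fixes J :: "('u, 'u) cat"
  assumes fg: "finitely_generated TYPE('u) C M" and M: "M \<in> Ob C"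
    and J: "small_cat TYPE('u) J" "filtered J" "diagram J C Fo Fm"
    and monic: "\<And>i j u. \<lbrakk>i \<in> Ob J; j \<in> Ob J; u \<in> Hom J i j\<rbrakk> \<Longrightarrow> monic C (Fo i) (Fo j) (Fm i j u)"
    and colim: "is_colimit J C Fo Fm L l" and x: "x \<in> Hom C M L"
  shows "\<exists>i\<in>Ob J. \<exists>g\<in>Hom C M (Fo i). l i \<cdot> g = x"
proof -
  let ?S = "\<lambda>i. Hom C M (Fo i)" and ?Sm = "\<lambda>i j u g. Fm i j u \<cdot> g" and ?l = "\<lambda>i g. l i \<cdot> g"
  let ?step = "set_colimit_step J ?S ?Sm"
  let ?v = "\<lambda>(i, x). ?l i x"
  have L: "L \<in> Ob C" "\<And>i. i \<in> Ob J \<Longrightarrow> l i \<in> Hom C (Fo i) L"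
    "\<And>i j u. \<lbrakk>i \<in> Ob J; j \<in> Ob J; u \<in> Hom J i j\<rbrakk> \<Longrightarrow> l j \<cdot> Fm i j u = l i"
    using colim by (auto simp: is_colimit_def cocone_def)
  have F: "\<And>i. i \<in> Ob J \<Longrightarrow> Fo i \<in> Ob C"
    "\<And>i j u. \<lbrakk>i \<in> Ob J; j \<in> Ob J; u \<in> Hom J i j\<rbrakk> \<Longrightarrow> Fm i j u \<in> Hom C (Fo i) (Fo j)"
    using J(3) unfolding diagram_def by auto
  \<comment> \<open>The value \<open>l i \<cdot> g\<close> is constant along the generating
    relation, hence on classes, so that \<open>the_elem\<close> is later applied to a
    singleton.\<close>
  have step: "?v a = ?v b" if ab: "(a, b) \<in> ?step" for a b
  proof -
    obtain i j u g where "i \<in> Ob J" "j \<in> Ob J" "u \<in> Hom J i j" "g \<in> ?S i" "a = (i, g)" "b = (j, Fm i j u \<cdot> g)"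
      using ab by (auto simp: set_colimit_step_def)
    then show ?thesis
      using cmp_assoc[of M "Fo i" "Fo j" L g "Fm i j u" "l j"] M F L by simp
  qed
  have steps: "?v a = ?v b" if "(a, b) \<in> (?step \<union> ?step\<inverse>)\<^sup>*" for a b
    using that
  proof (induction rule: rtrancl_induct)
    case (step y z)
    then show ?case using assms \<open>\<And>a b. (a, b) \<in> ?step \<Longrightarrow> ?v a = ?v b\<close>[of y z]
        \<open>\<And>a b. (a, b) \<in> ?step \<Longrightarrow> ?v a = ?v b\<close>[of z y] by auto
  qed simp
  have "set_colimit J ?S ?Sm (Hom C M L) ?l"
    using fg J monic colim unfolding finitely_generated_def by blast
  then have "x \<in> (\<lambda>c. the_elem (?v ` c)) ` set_colimit_classes J ?S ?Sm"
    using x by (simp add: set_colimit_def bij_betw_def)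
  then obtain c where c: "c \<in> set_colimit_classes J ?S ?Sm" "x = the_elem (?v ` c)"
    by blast
  then obtain i g where ig: "i \<in> Ob J" "g \<in> ?S i" "c = (?step \<union> ?step\<inverse>)\<^sup>* `` {(i, g)}"
    unfolding set_colimit_classes_def quotient_def by auto
  have "?v ` c = {?v (i, g)}"
  proof
    show "?v ` c \<subseteq> {?v (i, g)}"
      unfolding ig(3) using steps by fastforce
    show "{?v (i, g)} \<subseteq> ?v ` c"
      unfolding ig(3) by (intro subsetI image_eqI[of _ _ "(i, g)"]) auto
  qed
  then show ?thesis
    using c ig by auto
qed

text \<open>Any two indices map to a common one, so all legs of a cocone on a constant diagram
  agree. This supplies the constant rows in the commutation of filtered colimits with
  kernels.\<close>

lemma constant_colimit:
  assumes J: "filtered J" and X: "X \<in> Ob C"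
  shows "is_colimit J C (\<lambda>_. X) (\<lambda>_ _ _. Idn C X) X (\<lambda>_. Idn C X)"
  unfolding is_colimit_def
proof (intro conjI allI impI)
  show "cocone J C (\<lambda>_. X) (\<lambda>_ _ _. Idn C X) X (\<lambda>_. Idn C X)"
    using X idn_in[OF X] idn_left[OF X X idn_in[OF X]] by (simp add: cocone_def)
  fix N n assume n: "cocone J C (\<lambda>_. X) (\<lambda>_ _ _. Idn C X) N n"
  then have N: "N \<in> Ob C" and n_in: "\<And>i. i \<in> Ob J \<Longrightarrow> n i \<in> Hom C X N"
    by (auto simp: cocone_def)
  have step: "n i = n j" if ij: "i \<in> Ob J" "j \<in> Ob J" "Hom J i j \<noteq> {}" for i j
  proof -
    obtain u where "u \<in> Hom J i j"
      using ij(3) by blast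
    then have "n j \<cdot> Idn C X = n i"
      using n ij(1,2) unfolding cocone_def by blast
    then show ?thesis
      using idn_right[OF X N n_in[OF ij(2)]] by simp
  qed
  have eq: "n i = n j" if ij: "i \<in> Ob J" "j \<in> Ob J" for i j
  proof -
    obtain k where "k \<in> Ob J" "Hom J i k \<noteq> {}" "Hom J j k \<noteq> {}"
      using J ij unfolding filtered_def by blast
    then show ?thesis using step[of i k] step[of j k] ij by simp
  qed
  obtain i where i: "i \<in> Ob J"
    using J by (auto simp: filtered_def)
  show "\<exists>!h. h \<in> Hom C X N \<and> (\<forall>i\<in>Ob J. h \<cdot> Idn C X = n i)"
  proof (rule ex1I[of _ "n i"])
    show "n i \<in> Hom C X N \<and> (\<forall>j\<in>Ob J. n i \<cdot> Idn C X = n j)"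
      using n_in[OF i] idn_right[OF X N n_in[OF i]] eq[OF i] by metis
    fix h assume "h \<in> Hom C X N \<and> (\<forall>i\<in>Ob J. h \<cdot> Idn C X = n i)"
    then show "h = n i"
      using i idn_right[OF X N, of h] by simp
  qed
qed

end

text \<open>A parallel pair: the two arrows from \<open>0\<close> to \<open>1\<close> are the numbers \<open>0\<close> and \<open>1\<close>.\<close>

definition pair_cat :: "(nat, nat) cat" where
  "pair_cat = \<lparr>Ob = {0, 1}, Hom = (\<lambda>a b. {v. a \<le> b \<and> v \<le> b - a}), Idn = (\<lambda>_. 0), Cmp = (+)\<rparr>"

lemma finite_pair_cat: "finite_cat pair_cat"
proof -
  have "category pair_cat"
    by unfold_locales (auto simp: pair_cat_def)
  then show ?thesis
    by (auto simp: finite_cat_def pair_cat_def)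
qed

context preadditive_category
begin

text \<open>Kernels are limits of parallel pairs \<open>(f, 0)\<close>, so the kernel of \<open>f\<close> is the colimit of the
  kernels of the \<open>e i\<close>, which vanish.\<close>

lemma directed_union_monic:
  fixes J :: "('u, 'u) cat"
  assumes comm: "filtered_colimits_commute_finite_limits TYPE('u) C"
    and J: "small_cat TYPE('u) J" "filtered J" "diagram J C No Nm" and colim: "is_colimit J C No Nm L l"
    and M: "M \<in> Ob C" and e: "\<And>i. i \<in> Ob J \<Longrightarrow> monic C (No i) M (e i)"
    and e_Nm: "\<And>i j u. \<lbrakk>i \<in> Ob J; j \<in> Ob J; u \<in> Hom J i j\<rbrakk> \<Longrightarrow> e j \<cdot> Nm i j u = e i"
    and f: "f \<in> Hom C L M" and fl: "\<And>i. i \<in> Ob J \<Longrightarrow> f \<cdot> l i = e i"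
    and kernel: "is_kernel C L M f K k"
    and Z: "Z \<in> Ob C" and Z_to: "\<And>X f g. \<lbrakk>X \<in> Ob C; f \<in> Hom C X Z; g \<in> Hom C X Z\<rbrakk> \<Longrightarrow> f = g"
  shows "monic C L M f"
proof -
  have L: "L \<in> Ob C" and l: "\<And>i. i \<in> Ob J \<Longrightarrow> l i \<in> Hom C (No i) L"
    using colim by (auto simp: is_colimit_def cocone_def)
  have No: "\<And>i. i \<in> Ob J \<Longrightarrow> No i \<in> Ob C"
    and Nm: "\<And>i j u. \<lbrakk>i \<in> Ob J; j \<in> Ob J; u \<in> Hom J i j\<rbrakk> \<Longrightarrow> Nm i j u \<in> Hom C (No i) (No j)"
    and Nm_idn: "\<And>i. i \<in> Ob J \<Longrightarrow> Nm i i (Idn J i) = Idn C (No i)"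
    and Nm_cmp: "\<And>i j k u v. \<lbrakk>i \<in> Ob J; j \<in> Ob J; k \<in> Ob J; u \<in> Hom J i j; v \<in> Hom J j k\<rbrakk>
      \<Longrightarrow> Nm i k (v \<cdot>\<^bsub>J\<^esub> u) = Nm j k v \<cdot> Nm i j u"
    using J(3) unfolding diagram_def by auto
  have e_in: "\<And>i. i \<in> Ob J \<Longrightarrow> e i \<in> Hom C (No i) M"
    using e by (simp add: monic_def)
  interpret J: category J
    using J(1) by (simp add: small_cat_def)
  have K: "K \<in> Ob C" "k \<in> Hom C K L" "f \<cdot> k = Zero C K M"
    and K_fac: "\<And>W g. \<lbrakk>W \<in> Ob C; g \<in> Hom C W L; f \<cdot> g = Zero C W M\<rbrakk> \<Longrightarrow> \<exists>!h. h \<in> Hom C W K \<and> k \<cdot> h = g"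
    using kernel by (auto simp: is_kernel_def)
  \<comment> \<open>Row \<open>0\<close> is the given family and row \<open>1\<close> is constantly
    \<open>M\<close>; over each \<open>i\<close> the two arrows of the pair are \<open>e i\<close>
    and zero.\<close>
  define Xo where "Xo = (\<lambda>(i, a::nat). if a = 0 then No i else M)"
  define Xm where "Xm = (\<lambda>(i, a::nat) (j, b::nat) (u, v::nat). if a \<noteq> 0 then Idn C M else if b = 0 then Nm i j u
     else if v = 0 then e i else Zero C (No i) M)"
  define Co where "Co = (\<lambda>a::nat. if a = 0 then L else M)"
  define Cm where "Cm = (\<lambda>(a::nat) (b::nat) (v::nat). if a \<noteq> 0 then Idn C M else if b = 0 then Idn C L
     else if v = 0 then f else Zero C L M)"
  define c where "c = (\<lambda>i (a::nat). if a = 0 then l i else Idn C M)"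
  \<comment> \<open>The limit of the pair over \<open>i\<close> is the kernel of the monic
    \<open>e i\<close>, so it is the zero object \<open>Z\<close> with zero projections.\<close>
  define p where "p = (\<lambda>i (a::nat). Zero C Z (Xo (i, a)))"
  define \<pi> where "\<pi> = (\<lambda>a::nat. if a = 0 then k else Zero C K M)"
  have d1: "diagram (prod_cat J pair_cat) C Xo Xm"
    unfolding diagram_def
  proof (intro conjI ballI)
    fix x assume x: "x \<in> Ob (prod_cat J pair_cat)"
    obtain i a where xi: "x = (i, a)" by force
    then have i: "i \<in> Ob J" and a: "a = 0 \<or> a = 1"
      using x by (auto simp: prod_cat_def pair_cat_def)
    show "Xo x \<in> Ob C"
      using i No M by (auto simp: xi Xo_def)
    show "Xm x x (Idn (prod_cat J pair_cat) x) = Idn C (Xo x)"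
      using i a by (auto simp: xi Xo_def Xm_def prod_cat_def pair_cat_def Nm_idn)
    fix y assume y: "y \<in> Ob (prod_cat J pair_cat)"
    obtain j b where yj: "y = (j, b)" by force
    then have j: "j \<in> Ob J" and b: "b = 0 \<or> b = 1"
      using y by (auto simp: prod_cat_def pair_cat_def)
    show "Xm x y w \<in> Hom C (Xo x) (Xo y)" if w: "w \<in> Hom (prod_cat J pair_cat) x y" for w
    proof -
      obtain u v where "w = (u, v)" "u \<in> Hom J i j" "v \<in> Hom pair_cat a b"
        using w by (auto simp: xi yj prod_cat_def)
      then show ?thesis
        using i j a b No M Nm e_in idn_in[OF M] by (auto simp: xi yj Xo_def Xm_def pair_cat_def)
    qed
    fix z w w' assume z: "z \<in> Ob (prod_cat J pair_cat)"
      and w: "w \<in> Hom (prod_cat J pair_cat) x y" and w': "w' \<in> Hom (prod_cat J pair_cat) y z"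
    obtain h d where zh: "z = (h, d)" by force
    then have h: "h \<in> Ob J" and d: "d = 0 \<or> d = 1"
      using z by (auto simp: prod_cat_def pair_cat_def)
    obtain u v where uv: "w = (u, v)" "u \<in> Hom J i j" "v \<in> Hom pair_cat a b"
      using w by (auto simp: xi yj prod_cat_def)
    obtain u' v' where uv': "w' = (u', v')" "u' \<in> Hom J j h" "v' \<in> Hom pair_cat b d"
      using w' by (auto simp: yj zh prod_cat_def)
    show "Xm x z (w' \<cdot>\<^bsub>prod_cat J pair_cat\<^esub> w) = Xm y z w' \<cdot> Xm x y w"
      using uv uv' a b d Nm_cmp[OF i j h uv(2) uv'(2)] e_Nm[OF i j uv(2)]
        cmp_zero_left[OF No[OF i] No[OF j] M Nm[OF i j uv(2)]]
        idn_left[OF No[OF i] M e_in[OF i]] idn_left[OF No[OF i] M zero_in[OF No[OF i] M]]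
        idn_left[OF M M idn_in[OF M]]
      by (auto simp: xi yj zh Xm_def prod_cat_def pair_cat_def)
  qed
  have d2: "\<forall>a\<in>Ob pair_cat. is_colimit J C (\<lambda>i. Xo (i, a)) (\<lambda>i j u. Xm (i, a) (j, a) (u, Idn pair_cat a))
      (Co a) (\<lambda>i. c i a)"
    using colim constant_colimit[OF J(2) M] by (simp add: pair_cat_def Xo_def Xm_def Co_def c_def)
  have d3: "diagram pair_cat C Co Cm"
    using L M f idn_in[OF L] idn_in[OF M] idn_left[OF L M f] idn_right[OF L M f] idn_left[OF L L idn_in[OF L]]
      idn_left[OF M M idn_in[OF M]] idn_left[OF L M zero_in[OF L M]] idn_right[OF L M zero_in[OF L M]]
    by (auto simp: diagram_def pair_cat_def Co_def Cm_def)
  have d4: "\<forall>i\<in>Ob J. \<forall>a\<in>Ob pair_cat. \<forall>b\<in>Ob pair_cat. \<forall>v\<in>Hom pair_cat a b.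
      Cm a b v \<cdot> c i a = c i b \<cdot> Xm (i, a) (i, b) (Idn J i, v)"
  proof
    fix i assume i: "i \<in> Ob J"
    show "\<forall>a\<in>Ob pair_cat. \<forall>b\<in>Ob pair_cat. \<forall>v\<in>Hom pair_cat a b.
      Cm a b v \<cdot> c i a = c i b \<cdot> Xm (i, a) (i, b) (Idn J i, v)"
      using fl[OF i] Nm_idn[OF i] idn_left[OF No[OF i] L l[OF i]] idn_right[OF No[OF i] L l[OF i]]
        idn_left[OF No[OF i] M e_in[OF i]] idn_left[OF No[OF i] M zero_in[OF No[OF i] M]]
        cmp_zero_left[OF No[OF i] L M l[OF i]]
      by (auto simp: pair_cat_def Cm_def c_def Xm_def)
  qed
  have d5: "\<forall>i\<in>Ob J. is_limit pair_cat C (\<lambda>a. Xo (i, a)) (\<lambda>a b v. Xm (i, a) (i, b) (Idn J i, v)) Z (\<lambda>a. p i a)"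
  proof
    fix i assume i: "i \<in> Ob J"
    note Ni = No[OF i]
    show "is_limit pair_cat C (\<lambda>a. Xo (i, a)) (\<lambda>a b v. Xm (i, a) (i, b) (Idn J i, v)) Z (\<lambda>a. p i a)"
      unfolding is_limit_def
    proof (intro conjI allI impI)
      show "cone pair_cat C (\<lambda>a. Xo (i, a)) (\<lambda>a b v. Xm (i, a) (i, b) (Idn J i, v)) Z (\<lambda>a. p i a)"
        using Z Ni M Nm_idn[OF i] cmp_zero_right[OF Z Ni M e_in[OF i]] cmp_zero_right[OF Z Ni Ni idn_in[OF Ni]]
          cmp_zero_right[OF Z M M idn_in[OF M]] cmp_zero_right[OF Z Ni M zero_in[OF Ni M]]
        by (auto simp: cone_def pair_cat_def Xo_def Xm_def p_def)
      fix N n assume "cone pair_cat C (\<lambda>a. Xo (i, a)) (\<lambda>a b v. Xm (i, a) (i, b) (Idn J i, v)) N n"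
      then have N: "N \<in> Ob C" and n: "n 0 \<in> Hom C N (No i)" "n 1 \<in> Hom C N M"
        and n0: "e i \<cdot> n 0 = n 1" "Zero C (No i) M \<cdot> n 0 = n 1"
        unfolding cone_def by (auto simp: pair_cat_def Xo_def Xm_def dest: bspec[of _ _ 0] bspec[of _ _ 1])
      have n1: "n 1 = Zero C N M"
        using cmp_zero_left[OF N Ni M n(1)] n0 by simp
      then have "n 0 = Zero C N (No i)"
        using monic_iff_kernel_zero[OF Ni M e_in[OF i]] e[OF i] N n n0 by simp
      then show "\<exists>!h. h \<in> Hom C N Z \<and> (\<forall>a\<in>Ob pair_cat. p i a \<cdot> h = n a)"
        using N Z Ni M n1 cmp_zero_left[OF N Z Ni zero_in[OF N Z]] cmp_zero_left[OF N Z M zero_in[OF N Z]] Z_to[OF N]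
        by (intro ex1I[of _ "Zero C N Z"]) (auto simp: pair_cat_def p_def Xo_def)
    qed
  qed
  have d6: "diagram J C (\<lambda>_. Z) (\<lambda>_ _ _. Idn C Z)"
    using Z idn_in[OF Z] idn_left[OF Z Z idn_in[OF Z]] by (simp add: diagram_def)
  have d7: "\<forall>i\<in>Ob J. \<forall>j\<in>Ob J. \<forall>u\<in>Hom J i j. \<forall>a\<in>Ob pair_cat.
      p j a \<cdot> Idn C Z = Xm (i, a) (j, a) (u, Idn pair_cat a) \<cdot> p i a"
  proof (intro ballI)
    fix i j u a assume i: "i \<in> Ob J" and j: "j \<in> Ob J" and u: "u \<in> Hom J i j" and a: "a \<in> Ob pair_cat"
    show "p j a \<cdot> Idn C Z = Xm (i, a) (j, a) (u, Idn pair_cat a) \<cdot> p i a"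
      using a cmp_zero_left[OF Z Z No[OF j] idn_in[OF Z]] cmp_zero_left[OF Z Z M idn_in[OF Z]]
        cmp_zero_right[OF Z No[OF i] No[OF j] Nm[OF i j u]] cmp_zero_right[OF Z M M idn_in[OF M]]
      by (auto simp: pair_cat_def p_def Xo_def Xm_def)
  qed
  have d8: "is_limit pair_cat C Co Cm K \<pi>"
    unfolding is_limit_def
  proof (intro conjI allI impI)
    show "cone pair_cat C Co Cm K \<pi>"
      using K L M idn_left[OF K(1) L K(2)] idn_left[OF K(1) M zero_in[OF K(1) M]] cmp_zero_left[OF K(1) L M K(2)]
      by (auto simp: cone_def pair_cat_def Co_def Cm_def \<pi>_def)
    fix N n assume "cone pair_cat C Co Cm N n"
    then have N: "N \<in> Ob C" and n: "n 0 \<in> Hom C N L" "n 1 \<in> Hom C N M"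
      and n0: "f \<cdot> n 0 = n 1" "Zero C L M \<cdot> n 0 = n 1"
      unfolding cone_def by (auto simp: pair_cat_def Co_def Cm_def dest: bspec[of _ _ 0] bspec[of _ _ 1])
    have n1: "n 1 = Zero C N M"
      using cmp_zero_left[OF N L M n(1)] n0 by simp
    then obtain h where h: "h \<in> Hom C N K" "k \<cdot> h = n 0" and un: "\<And>h'. \<lbrakk>h' \<in> Hom C N K; k \<cdot> h' = n 0\<rbrakk> \<Longrightarrow> h' = h"
      using K_fac[OF N n(1)] n0 by auto
    show "\<exists>!h. h \<in> Hom C N K \<and> (\<forall>a\<in>Ob pair_cat. \<pi> a \<cdot> h = n a)"
    proof (rule ex1I[of _ h])
      show "h \<in> Hom C N K \<and> (\<forall>a\<in>Ob pair_cat. \<pi> a \<cdot> h = n a)"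
        using h n1 cmp_zero_left[OF N K(1) M h(1)] by (simp add: pair_cat_def \<pi>_def)
      fix h' assume h': "h' \<in> Hom C N K \<and> (\<forall>a\<in>Ob pair_cat. \<pi> a \<cdot> h' = n a)"
      show "h' = h"
        by (rule un) (use h' in \<open>simp_all add: pair_cat_def \<pi>_def\<close>)
    qed
  qed
  note d = J(1,2) finite_pair_cat d1 d2 d3 d4 d5 d6 d7 d8 constant_colimit[OF J(2) Z]
  have "\<exists>h. iso_arr C Z K h \<and> (\<forall>i\<in>Ob J. \<forall>a\<in>Ob pair_cat. \<pi> a \<cdot> h \<cdot> Idn C Z = c i a \<cdot> p i a)"
    by (rule comm[unfolded filtered_colimits_commute_finite_limits_def, THEN spec[where x = J],
        THEN spec[where x = pair_cat],
        THEN spec[where x = Xo],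
        THEN spec[where x = Xm],
        THEN spec[where x = Co],
        THEN spec[where x = Cm],
        THEN spec[where x = c],
        THEN spec[where x = "\<lambda>_. Z"],
        THEN spec[where x = "\<lambda>_ _ _. Idn C Z"],
        THEN spec[where x = p],
        THEN spec[where x = K],
        THEN spec[where x = \<pi>],
        THEN spec[where x = Z],
        THEN spec[where x = "\<lambda>_. Idn C Z"], THEN mp])
      (intro conjI d)
  then obtain h g where h: "h \<in> Hom C Z K" and g: "g \<in> Hom C K Z" and hg: "h \<cdot> g = Idn C K"
    unfolding iso_arr_def by blast
  \<comment> \<open>The kernel \<open>K\<close> is isomorphic to \<open>Z\<close>, so its identity
    is a composite through a zero object and vanishes.\<close>
  have "g = Zero C K Z"
    using Z_to[OF K(1) g] zero_in[OF K(1) Z] by blast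
  then have idn: "Idn C K = Zero C K K"
    using hg cmp_zero_right[OF K(1) Z K(1) h] by simp
  have k: "k = Zero C K L"
    using idn_right[OF K(1) L K(2)] cmp_zero_right[OF K(1) K(1) L K(2)] idn by simp
  show ?thesis
    unfolding monic_iff_kernel_zero[OF L M f]
  proof (intro ballI impI)
    fix W g assume W: "W \<in> Ob C" and g: "g \<in> Hom C W L" and fg: "f \<cdot> g = Zero C W M"
    then obtain h where h: "h \<in> Hom C W K" "k \<cdot> h = g"
      using K_fac by blast
    then show "g = Zero C W L"
      using cmp_zero_left[OF W K(1) L h(1)] k by simp
  qed
qed

end

section \<open>Objects generated by a simple generator\<close>

context preadditive_category
begin

text \<open>Monicity as triviality of the kernel. For an arrow out of a power of the generator this
  is linear independence of its components.\<close>

definition monic_arr :: "('o, 'm) arrow \<Rightarrow> bool" where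
  "monic_arr e \<longleftrightarrow> arr e \<and> (\<forall>g. arr g \<longrightarrow> tgt g = src e \<longrightarrow> e \<bullet> g = zer (src g) (tgt e) \<longrightarrow> g = zer (src g) (src e))"

lemma monic_arr_iff:
  assumes "X \<in> Ob C" "Y \<in> Ob C"
  shows "monic C X Y f \<longleftrightarrow> monic_arr (Arrow X Y f)"
proof (cases "f \<in> Hom C X Y")
  case f: True
  let ?F = "Arrow X Y f"
  have zer: "?F \<bullet> Arrow W X g = zer W Y \<longleftrightarrow> f \<cdot> g = Zero C W Y"
    "Arrow W X g = zer W X \<longleftrightarrow> g = Zero C W X" for W g
    by (simp_all add: comp_def zer_def)
  show ?thesis
    unfolding monic_iff_kernel_zero[OF assms f] monic_arr_def
  proof (intro iffI conjI allI impI ballI)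
    fix g assume *: "\<forall>W\<in>Ob C. \<forall>g\<in>Hom C W X. f \<cdot> g = Zero C W Y \<longrightarrow> g = Zero C W X"
      and g: "arr g" "tgt g = src ?F" "?F \<bullet> g = zer (src g) (tgt ?F)"
    have "g = Arrow (src g) X (mor g)"
      using g(2) by (intro arrow_eqI) simp_all
    then show "g = zer (src g) (src ?F)"
      using * zer[of "src g" "mor g"] g arr_mor[OF g(1)] arr_src[OF g(1)] by (metis arrow.sel(1,2))
  next
    fix W g assume *: "arr ?F \<and> (\<forall>g. arr g \<longrightarrow> tgt g = src ?F \<longrightarrow>
        ?F \<bullet> g = zer (src g) (tgt ?F) \<longrightarrow> g = zer (src g) (src ?F))"
      and g: "W \<in> Ob C" "g \<in> Hom C W X" "f \<cdot> g = Zero C W Y"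
    show "g = Zero C W X"
      using conjunct2[OF *, rule_format, of "Arrow W X g"] g zer[of W g] assms by simp
  qed (use f assms in simp)
next
  case False
  then show ?thesis
    by (simp add: monic_def monic_arr_def)
qed

lemma monic_arr_zero:
  "\<lbrakk>monic_arr e; arr g; tgt g = src e; e \<bullet> g = zer (src g) (tgt e)\<rbrakk> \<Longrightarrow> g = zer (src g) (src e)"
  by (simp add: monic_arr_def)

end

text \<open>What the linear algebra uses of the modules over \<open>K(A)\<close>: \<open>G\<close>
  is a generator whose nonzero endomorphisms have right inverses, and by \<open>strong\<close> a
  monomorphism along which all arrows from \<open>G\<close> lift is invertible.\<close>

locale simple_generator = preadditive_category C for C :: "('o, 'm, 'x) abcat_scheme" (structure) +
  fixes G :: 'o
  assumes G [simp]: "G \<in> Ob C"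
    and zero_ob: "\<exists>Z\<in>Ob C. \<forall>X\<in>Ob C. (\<forall>f\<in>Hom C X Z. \<forall>g\<in>Hom C X Z. f = g) \<and> (\<forall>f\<in>Hom C Z X. \<forall>g\<in>Hom C Z X. f = g)"
    and biproduct_ex: "\<lbrakk>X \<in> Ob C; Y \<in> Ob C\<rbrakk> \<Longrightarrow> \<exists>P i j p q. biproduct C X Y P i j p q"
    and kernel_ex: "\<lbrakk>X \<in> Ob C; Y \<in> Ob C; f \<in> Hom C X Y\<rbrakk> \<Longrightarrow> \<exists>K k. is_kernel C X Y f K k"
    and generator: "\<lbrakk>X \<in> Ob C; Y \<in> Ob C; c \<in> Hom C X Y; \<And>x. x \<in> Hom C G X \<Longrightarrow> c \<cdot> x = Zero C G Y\<rbrakk>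
      \<Longrightarrow> c = Zero C X Y"
    and division: "\<lbrakk>u \<in> Hom C G G; u \<noteq> Zero C G G\<rbrakk> \<Longrightarrow> \<exists>v\<in>Hom C G G. u \<cdot> v = Idn C G"
    and strong: "\<lbrakk>X \<in> Ob C; Y \<in> Ob C; monic C X Y f; \<And>x. x \<in> Hom C G Y \<Longrightarrow> \<exists>y\<in>Hom C G X. f \<cdot> y = x\<rbrakk>
      \<Longrightarrow> iso_arr C X Y f"
begin

lemma generator_arr:
  assumes c: "arr c" "c \<noteq> zer (src c) (tgt c)"
  obtains x where "arr x" "src x = G" "tgt x = src c" "c \<bullet> x \<noteq> zer G (tgt c)"
proof -
  have "mor c \<noteq> Zero C (src c) (tgt c)"
    using c(2) by (metis arrow.collapse zer_def)
  then obtain x where x: "x \<in> Hom C G (src c)" "mor c \<cdot> x \<noteq> Zero C G (tgt c)"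
    using generator[of "src c" "tgt c" "mor c"] arr_mor[OF c(1)] arr_src[OF c(1)] arr_tgt[OF c(1)] by auto
  show ?thesis
  proof (rule that[of "Arrow G (src c) x"])
    show "c \<bullet> Arrow G (src c) x \<noteq> zer G (tgt c)"
      using x(2) by (metis arrow.sel(3) comp_simps(3) zer_simps(3))
  qed (use x c in simp_all)
qed

lemma division_arr:
  assumes "arr u" "src u = G" "tgt u = G" "u \<noteq> zer G G"
  obtains v where "arr v" "src v = G" "tgt v = G" "u \<bullet> v = ide G"
proof -
  have "mor u \<noteq> Zero C G G"
    using assms(2-4) by (metis arrow.collapse zer_def)
  then obtain v where v: "v \<in> Hom C G G" "mor u \<cdot> v = Idn C G"
    using division[of "mor u"] arr_mor[OF assms(1)] assms(2,3) by auto
  show ?thesis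
  proof (rule that[of "Arrow G G v"])
    show "u \<bullet> Arrow G G v = ide G"
      by (rule arrow_eqI) (use v assms in simp_all)
  qed (use v in simp_all)
qed

text \<open>Exchange argument: in a relation between \<open>x\<close> and the independent family \<open>e\<close> the coefficient of
  \<open>x\<close> is zero or invertible.\<close>

lemma monic_arr_extend:
  assumes bip: "biproduct C X G Q i j p q" and e: "monic_arr e" "src e = X" "tgt e = M"
    and x: "arr x" "src x = G" "tgt x = M"
    and indep: "\<not> (\<exists>y. arr y \<and> src y = G \<and> tgt y = X \<and> e \<bullet> y = x)"
  shows "monic_arr ((e \<bullet> p) \<boxplus> (x \<bullet> q))"
proof -
  interpret biproduct C X G Q i j p q by (rule bip)
  have e_arr: "arr e" using e by (simp add: monic_arr_def)
  have M: "M \<in> Ob C" using e_arr e(3) arr_tgt by blast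
  let ?e = "(e \<bullet> p) \<boxplus> (x \<bullet> q)"
  have e': "arr ?e" "src ?e = Q" "tgt ?e = M"
    using e_arr e x by simp_all
  show ?thesis
    unfolding monic_arr_def
  proof (intro conjI allI impI, rule e'(1), rule ccontr)
    fix g assume g: "arr g" "tgt g = src ?e" "?e \<bullet> g = zer (src g) (tgt ?e)" and nz: "g \<noteq> zer (src g) (src ?e)"
    \<comment> \<open>A nonzero arrow killed by \<open>?e\<close> stays nonzero on some arrow from
      \<open>G\<close>. This yields a relation \<open>v\<close> whose coefficient at
      \<open>x\<close> is an endomorphism of \<open>G\<close>.\<close>
    then obtain w where w: "arr w" "src w = G" "tgt w = src g" "g \<bullet> w \<noteq> zer G Q"
      using generator_arr[of g] e' by metis
    define v where "v = g \<bullet> w"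
    have v: "arr v" "src v = G" "tgt v = Q" and v_nz: "v \<noteq> zer G Q"
      using g(1,2) w e' by (simp_all add: v_def)
    have "?e \<bullet> v = zer (src g) M \<bullet> w"
      unfolding v_def using g e' w by (intro comp_reassoc) simp_all
    also have "\<dots> = zer G M"
      using w M by simp
    finally have sum0: "(e \<bullet> p \<bullet> v) \<boxplus> (x \<bullet> q \<bullet> v) = zer G M"
      using plus_comp[of v "e \<bullet> p" "x \<bullet> q"] v e_arr e(2,3) x by simp
    show False
    proof (cases "q \<bullet> v = zer G G")
      case True
      then have "e \<bullet> p \<bullet> v = zer G M"
        using sum0 v e_arr e x by simp
      then have pv: "p \<bullet> v = zer G X"
        using monic_arr_zero[OF e(1), of "p \<bullet> v"] v e by simp
      have "v = zer G Q"
        using decompose[OF v(1,3)] unfolding pv True by simp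
      then show False using v_nz by simp
    next
      case False
      \<comment> \<open>Multiplying the relation by a right inverse of the coefficient of
        \<open>x\<close> gives \<open>e(p v r) + x = 0\<close>; then \<open>x\<close> is the image
        of \<open>- p v r\<close> under \<open>e\<close>, against \<open>indep\<close>.\<close>
      obtain r where r: "arr r" "src r = G" "tgt r = G" "(q \<bullet> v) \<bullet> r = ide G"
        by (rule division_arr[of "q \<bullet> v"]) (use v False in simp_all)
      let ?a = "p \<bullet> v \<bullet> r"
      have a: "arr ?a" "src ?a = G" "tgt ?a = X"
        using v r by simp_all
      have "x \<bullet> q \<bullet> v \<bullet> r = x \<bullet> ((q \<bullet> v) \<bullet> r)"
        using v r(1-3) by simp
      then have xr: "x \<bullet> q \<bullet> v \<bullet> r = x"
        unfolding r(4) using x by simp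
      have "((e \<bullet> p \<bullet> v) \<boxplus> (x \<bullet> q \<bullet> v)) \<bullet> r = zer G M"
        unfolding sum0 using r M by simp
      then have "(e \<bullet> ?a) \<boxplus> (x \<bullet> q \<bullet> v \<bullet> r) = zer G M"
        using v r(1-3) e_arr e(2,3) x by (simp add: plus_comp)
      then have eax: "(e \<bullet> ?a) \<boxplus> x = zer G M"
        unfolding xr .
      obtain n where n: "n \<in> Hom C G X" "Plus C n (mor ?a) = Zero C G X" "Plus C (mor ?a) n = Zero C G X"
        by (rule negative_hom[of G X "mor ?a"]) (use a arr_mor[OF a(1)] in auto)
      let ?n = "Arrow G X n"
      have na: "?a \<boxplus> ?n = zer G X"
        by (rule arrow_eqI) (use n a in simp_all)
      have n': "arr ?n" using n by simp
      have "(e \<bullet> ?a) \<boxplus> (e \<bullet> ?n) = e \<bullet> (?a \<boxplus> ?n)"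
        using comp_plus[OF a(1) n' e_arr] a e by simp
      also have "\<dots> = (e \<bullet> ?a) \<boxplus> x"
        unfolding na eax using e e_arr by simp
      finally have "(e \<bullet> ?n) \<boxplus> (e \<bullet> ?a) = x \<boxplus> (e \<bullet> ?a)"
        using plus_comm[of "e \<bullet> ?a" "e \<bullet> ?n"] plus_comm[of "e \<bullet> ?a" x] a n' e e_arr x by (simp del: arr_Arrow)
      then have "e \<bullet> ?n = x"
        by (rule plus_cancel[rotated -1]) (use a n' e e_arr x in \<open>simp_all del: arr_Arrow\<close>)
      then show False using indep n' by auto
    qed
  qed
qed

end

section \<open>Powers of the generator and the directed family of monomorphisms out of them\<close>

context simple_generator
begin

abbreviation power_with :: "nat \<Rightarrow> 'o \<Rightarrow> (nat \<Rightarrow> 'm) \<Rightarrow> bool" where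
  "power_with n P inc \<equiv> is_coproduct C {..<n} (\<lambda>_. G) P inc"

lemma power_with_factor:
  "\<lbrakk>power_with n P inc; N \<in> Ob C; \<And>m. m < n \<Longrightarrow> x m \<in> Hom C G N\<rbrakk>
    \<Longrightarrow> \<exists>!h. h \<in> Hom C P N \<and> (\<forall>m<n. h \<cdot> inc m = x m)"
  using is_coproduct_factor[of C "{..<n}" "\<lambda>_. G" P inc N x] by (simp add: Ball_def)

lemma power_with_zero: "\<exists>P inc. power_with 0 P inc"
proof -
  obtain Z where Z: "Z \<in> Ob C" "\<And>X f g. \<lbrakk>X \<in> Ob C; f \<in> Hom C Z X; g \<in> Hom C Z X\<rbrakk> \<Longrightarrow> f = g"
    using zero_ob by blast
  have "\<exists>!h. h \<in> Hom C Z N" if "N \<in> Ob C" for N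
    using that Z zero_in by blast
  then have "power_with 0 Z inc" for inc
    using Z(1) by (simp add: is_coproduct_def)
  then show ?thesis by blast
qed

lemma power_with_Suc:
  assumes P: "power_with n P inc" and bip: "biproduct C P G Q i j p q"
  shows "power_with (Suc n) Q (\<lambda>m. if m < n then mor i \<cdot> inc m else mor j)"
proof -
  interpret biproduct C P G Q i j p q by (rule bip)
  let ?inc = "\<lambda>m. if m < n then mor i \<cdot> inc m else mor j"
  have inc: "\<And>m. m < n \<Longrightarrow> inc m \<in> Hom C G P"
    using P by (auto simp: is_coproduct_def)
  note fac = power_with_factor[OF P]
  have hom: "mor i \<in> Hom C P Q" "mor j \<in> Hom C G Q"
    using arr_mor[of i] arr_mor[of j] by simp_all
  show ?thesis
    unfolding is_coproduct_def
  proof (intro conjI ballI allI impI)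
    show "?inc m \<in> Hom C G Q" if "m \<in> {..<Suc n}" for m
      using hom inc cmp_in[of G P Q "inc m" "mor i"] by simp
    fix N x assume N: "N \<in> Ob C" and x: "\<forall>m\<in>{..<Suc n}. x m \<in> Hom C G N"
    obtain h where h: "h \<in> Hom C P N" "\<And>m. m < n \<Longrightarrow> h \<cdot> inc m = x m"
      and h_un: "\<And>h'. \<lbrakk>h' \<in> Hom C P N; \<And>m. m < n \<Longrightarrow> h' \<cdot> inc m = x m\<rbrakk> \<Longrightarrow> h' = h"
    proof -
      have "\<exists>!h. h \<in> Hom C P N \<and> (\<forall>m<n. h \<cdot> inc m = x m)"
        by (rule fac[OF N]) (use x in simp)
      then show thesis
        using that by blast
    qed
    let ?H = "Arrow P N h" and ?X = "Arrow G N (x n)"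
    have HX: "arr ?H" "arr ?X"
      using h(1) N x by simp_all
    define K where "K = (?H \<bullet> p) \<boxplus> (?X \<bullet> q)"
    have K: "arr K" "src K = Q" "tgt K = N"
      using HX by (simp_all add: K_def del: arr_Arrow)
    have Ki: "K \<bullet> i = ?H" and Kj: "K \<bullet> j = ?X"
      using HX N by (simp_all add: K_def plus_comp del: arr_Arrow)
    have Ki': "mor K \<cdot> mor i = h" and Kj': "mor K \<cdot> mor j = x n"
      using arg_cong[OF Ki, of mor] arg_cong[OF Kj, of mor] by simp_all
    have K_in: "mor K \<in> Hom C Q N"
      using arr_mor[OF K(1)] K by simp
    have assoc: "F \<cdot> (mor i \<cdot> inc m) = (F \<cdot> mor i) \<cdot> inc m" if "F \<in> Hom C Q N" "m < n" for F m
      using cmp_assoc[of G P Q N "inc m" "mor i" F] that hom inc N by simp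
    show "\<exists>!h. h \<in> Hom C Q N \<and> (\<forall>m\<in>{..<Suc n}. h \<cdot> ?inc m = x m)"
    proof (rule ex1I[of _ "mor K"])
      show "mor K \<in> Hom C Q N \<and> (\<forall>m\<in>{..<Suc n}. mor K \<cdot> ?inc m = x m)"
        using K_in h(2) assoc[OF K_in] Ki' Kj' by (auto simp: less_Suc_eq)
      fix F assume F: "F \<in> Hom C Q N \<and> (\<forall>m\<in>{..<Suc n}. F \<cdot> ?inc m = x m)"
      have "F \<cdot> mor i = h"
      proof (rule h_un)
        show "F \<cdot> mor i \<in> Hom C P N"
          using cmp_in[of P Q N "mor i" F] hom F N by simp
        fix m assume m: "m < n"
        then show "(F \<cdot> mor i) \<cdot> inc m = x m"
          using F assoc[of F m] by (auto dest: bspec[of _ _ m])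
      qed
      moreover have "F \<cdot> mor j = x n"
        using F by (auto dest: bspec[of _ _ n])
      ultimately have eq: "Arrow Q N F \<bullet> i = K \<bullet> i" "Arrow Q N F \<bullet> j = K \<bullet> j"
        unfolding Ki Kj by (auto intro!: arrow_eqI)
      have "Arrow Q N F = K"
      proof (rule jointly_epicD[OF epic_ij])
        show "Arrow Q N F \<bullet> (if b then i else j) = K \<bullet> (if b then i else j)" for b
          by (cases b) (simp_all only: if_True if_False eq)
      qed (use F N K in simp_all)
      then show "F = mor K" by auto
    qed
  qed simp
qed

text \<open>The powers are chosen one after the other, so that \<open>P (Suc n)\<close> is a
  biproduct with the same \<open>P n\<close>; this lets a monomorphism out of \<open>P n\<close> be
  extended by one vector.\<close>

lemma powers_exist:
  obtains P inc where "\<And>n. power_with n (P n) (inc n)"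
    "\<And>n. \<exists>i j p q. biproduct C (P n) G (P (Suc n)) i j p q"
proof -
  have "\<exists>f. \<forall>n. power_with n (fst (f n)) (snd (f n)) \<and>
      (\<exists>i j p q. biproduct C (fst (f n)) G (fst (f (Suc n))) i j p q)"
  proof (rule dependent_nat_choice)
    show "\<exists>x. power_with 0 (fst x) (snd x)"
      using power_with_zero by simp
    fix x n assume x: "power_with n (fst x) (snd x)"
    then have "fst x \<in> Ob C" by (simp add: is_coproduct_def)
    then obtain Q i j p q where bip: "biproduct C (fst x) G Q i j p q"
      using biproduct_ex G by blast
    show "\<exists>y. power_with (Suc n) (fst y) (snd y) \<and> (\<exists>i j p q. biproduct C (fst x) G (fst y) i j p q)"
      using power_with_Suc[OF x bip] bip by (intro exI[of _ "(Q, _)"]) auto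
  qed
  then obtain f where "\<forall>n. power_with n (fst (f n)) (snd (f n)) \<and>
      (\<exists>i j p q. biproduct C (fst (f n)) G (fst (f (Suc n))) i j p q)" ..
  then show ?thesis
    using that[of "\<lambda>n. fst (f n)" "\<lambda>n. snd (f n)"] by blast
qed

text \<open>The vectors of \<open>xs\<close> are treated one by one: one that factors through the
  current monomorphism changes nothing, any other is adjoined by \<open>monic_arr_extend\<close>.
  Both directedness and covering of the family come from this.\<close>

lemma monic_arr_dominate:
  assumes bip: "\<And>n. \<exists>i j p q. biproduct C (P n) G (P (Suc n)) i j p q"
    and e: "monic_arr e" "src e = P n" "tgt e = M"
    and xs: "\<And>x. x \<in> set xs \<Longrightarrow> arr x \<and> src x = G \<and> tgt x = M"
  shows "\<exists>m e'. monic_arr e' \<and> src e' = P m \<and> tgt e' = M \<and> (\<exists>t. arr t \<and> tgt t = src e' \<and> e' \<bullet> t = e) \<and>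
    (\<forall>x\<in>set xs. \<exists>y. arr y \<and> tgt y = src e' \<and> e' \<bullet> y = x)"
  using xs
proof (induction xs)
  case Nil
  have "arr e" using e by (simp add: monic_arr_def)
  then show ?case
    using e arr_src[of e] by (intro exI[of _ n] exI[of _ e]) (auto intro!: exI[of _ "ide (src e)"])
next
  case (Cons x xs)
  then obtain m e' t where e': "monic_arr e'" "src e' = P m" "tgt e' = M" and t: "arr t" "tgt t = src e'" "e' \<bullet> t = e"
    and ys: "\<forall>x\<in>set xs. \<exists>y. arr y \<and> tgt y = src e' \<and> e' \<bullet> y = x"
    by auto
  have x: "arr x" "src x = G" "tgt x = M"
    using Cons.prems by simp_all
  have e'_arr: "arr e'" using e' by (simp add: monic_arr_def)
  show ?case
  proof (cases "\<exists>y. arr y \<and> src y = G \<and> tgt y = P m \<and> e' \<bullet> y = x")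
    case True
    then have "\<forall>x\<in>set (x # xs). \<exists>y. arr y \<and> tgt y = src e' \<and> e' \<bullet> y = x"
      using ys e'(2) by auto
    then show ?thesis
      using e' t by blast
  next
    case False
    obtain i j p q where bip': "biproduct C (P m) G (P (Suc m)) i j p q"
      using bip by blast
    then interpret biproduct C "P m" G "P (Suc m)" i j p q .
    define e'' where "e'' = (e' \<bullet> p) \<boxplus> (x \<bullet> q)"
    have monic_arr: "monic_arr e''"
      unfolding e''_def by (rule monic_arr_extend[OF bip' e' x False])
    have e'': "arr e''" "src e'' = P (Suc m)" "tgt e'' = M"
      using e'_arr e' x by (simp_all add: e''_def)
    have M: "M \<in> Ob C"
      using x arr_tgt by blast
    have i: "e'' \<bullet> i = e'" and j: "e'' \<bullet> j = x"
      using e'_arr e' x M by (simp_all add: e''_def plus_comp)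
    have through: "\<exists>z. arr z \<and> tgt z = src e'' \<and> e'' \<bullet> z = f"
      if "arr y" "tgt y = src e'" "e' \<bullet> y = f" for y f
    proof (intro exI[of _ "i \<bullet> y"] conjI)
      show "e'' \<bullet> i \<bullet> y = f"
        using comp_reassoc[OF i, of y] that e'' e' by simp
    qed (use that e'' e' in simp_all)
    have "\<exists>z. arr z \<and> tgt z = src e'' \<and> e'' \<bullet> z = e"
      by (rule through[OF t])
    moreover have "\<exists>z. arr z \<and> tgt z = src e'' \<and> e'' \<bullet> z = x'" if x': "x' \<in> set (x # xs)" for x'
    proof (cases "x' = x")
      case True
      then show ?thesis using j e'' by (intro exI[of _ j]) simp
    next
      case False
      then show ?thesis using ys through x' by auto
    qed
    ultimately show ?thesis
      using monic_arr e'' by blast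
  qed
qed

text \<open>The union of the family is \<open>M\<close>, so the identity of the finitely generated \<open>M\<close> factors through
  one of its members.\<close>

lemma directed_union_iso:
  fixes I :: "'u set"
  assumes u: "(UNIV :: nat set) \<prec> (UNIV :: 'u set)" and small: "I \<prec> (UNIV :: 'u set)" and ne: "I \<noteq> {}"
    and colims: "has_filtered_colimits TYPE('u) C"
    and comm: "filtered_colimits_commute_finite_limits TYPE('u) C"
    and M: "M \<in> Ob C" and fg: "finitely_generated TYPE('u) C M"
    and N: "\<And>a. a \<in> I \<Longrightarrow> N a \<in> Ob C" and e: "\<And>a. a \<in> I \<Longrightarrow> monic C (N a) M (e a)"
    and directed: "\<And>a b. \<lbrakk>a \<in> I; b \<in> I\<rbrakk> \<Longrightarrow>
      \<exists>c\<in>I. (\<exists>t\<in>Hom C (N a) (N c). e c \<cdot> t = e a) \<and> (\<exists>t\<in>Hom C (N b) (N c). e c \<cdot> t = e b)"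
    and cover: "\<And>x. x \<in> Hom C G M \<Longrightarrow> \<exists>a\<in>I. \<exists>y\<in>Hom C G (N a). e a \<cdot> y = x"
  shows "\<exists>a\<in>I. iso_arr C (N a) M (e a)"
proof -
  define rel where "rel a b \<longleftrightarrow> (\<exists>t\<in>Hom C (N a) (N b). e b \<cdot> t = e a)" for a b
  \<comment> \<open>The choice is unique because \<open>e b\<close> is monic, and uniqueness makes
    the transition arrows functorial.\<close>
  define Nm where "Nm a b = (SOME t. t \<in> Hom C (N a) (N b) \<and> e b \<cdot> t = e a)" for a b
  let ?J = "thin_cat I rel"
  have e_in: "\<And>a. a \<in> I \<Longrightarrow> e a \<in> Hom C (N a) M"
    and e_cancel: "\<And>a W g h. \<lbrakk>a \<in> I; W \<in> Ob C; g \<in> Hom C W (N a); h \<in> Hom C W (N a); e a \<cdot> g = e a \<cdot> h\<rbrakk> \<Longrightarrow> g = h"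
    using e unfolding monic_def by blast+
  have Nm: "Nm a b \<in> Hom C (N a) (N b)" "e b \<cdot> Nm a b = e a" if "rel a b" for a b
    using someI_ex[of "\<lambda>t. t \<in> Hom C (N a) (N b) \<and> e b \<cdot> t = e a"] that unfolding rel_def Nm_def by blast+
  have refl: "rel a a" if "a \<in> I" for a
    unfolding rel_def using idn_in[OF N[OF that]] idn_right[OF N[OF that] M e_in[OF that]] by blast
  have comp: "Nm b c \<cdot> Nm a b \<in> Hom C (N a) (N c)" "e c \<cdot> (Nm b c \<cdot> Nm a b) = e a"
    if "a \<in> I" "b \<in> I" "c \<in> I" "rel a b" "rel b c" for a b c
    using cmp_in[of "N a" "N b" "N c" "Nm a b" "Nm b c"] cmp_assoc[of "N a" "N b" "N c" M "Nm a b" "Nm b c" "e c"]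
      Nm[OF that(4)] Nm[OF that(5)] N e_in M that by simp_all
  have trans: "rel a c" if "a \<in> I" "b \<in> I" "c \<in> I" "rel a b" "rel b c" for a b c
    using comp[OF that] unfolding rel_def by blast
  have J: "small_cat TYPE('u) ?J"
    by (rule small_thin_cat[OF u small]) (fact refl, fact trans)
  have fJ: "filtered ?J"
    by (rule filtered_thin_cat[OF ne]) (use directed refl in \<open>auto simp: rel_def\<close>)
  have dJ: "diagram ?J C N (\<lambda>a b _. Nm a b)"
  proof (rule diagram_thin_cat)
    fix a assume a: "a \<in> I"
    show "Nm a a = Idn C (N a)"
      using e_cancel[OF a N[OF a] Nm(1)[OF refl[OF a]] idn_in[OF N[OF a]]] Nm(2)[OF refl[OF a]]
        idn_right[OF N[OF a] M e_in[OF a]] by simp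
  next
    fix a b c assume abc: "a \<in> I" "b \<in> I" "c \<in> I" "rel a b" "rel b c"
    show "Nm a c = Nm b c \<cdot> Nm a b"
      using e_cancel[OF abc(3) N[OF abc(1)] Nm(1)[OF trans[OF abc]] comp(1)[OF abc]] comp(2)[OF abc]
        Nm(2)[OF trans[OF abc]] by simp
  qed (use N Nm in auto)
  obtain L l where colim: "is_colimit ?J C N (\<lambda>a b _. Nm a b) L l"
    using colims J fJ dJ unfolding has_filtered_colimits_def by blast
  then have L: "L \<in> Ob C" and l: "\<And>a. a \<in> I \<Longrightarrow> l a \<in> Hom C (N a) L"
    by (auto simp: is_colimit_def cocone_def)
  have "cocone ?J C N (\<lambda>a b _. Nm a b) M e"
    using M e_in Nm(2) by (simp add: cocone_thin_cat)
  then obtain f where f: "f \<in> Hom C L M" "\<And>a. a \<in> I \<Longrightarrow> f \<cdot> l a = e a"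
    using colimit_factor[OF colim, of M e] by auto
  obtain K k where K: "is_kernel C L M f K k"
    using kernel_ex[OF L M f(1)] by blast
  obtain Z where Z: "Z \<in> Ob C" and Z': "\<And>X f g. \<lbrakk>X \<in> Ob C; f \<in> Hom C X Z; g \<in> Hom C X Z\<rbrakk> \<Longrightarrow> f = g"
    using zero_ob by blast
  have mono_f: "monic C L M f"
    by (rule directed_union_monic[OF comm J fJ dJ colim M _ _ f(1) _ K Z Z']) (use e Nm f in auto)
  \<comment> \<open>The arrow \<open>f\<close> is monic, and every arrow from \<open>G\<close> lifts
    along it since some member of the family already lifts it.\<close>
  have "iso_arr C L M f"
  proof (rule strong[OF L M mono_f])
    fix x assume "x \<in> Hom C G M"
    then obtain a y where y: "a \<in> I" "y \<in> Hom C G (N a)" "e a \<cdot> y = x"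
      using cover by blast
    have "f \<cdot> (l a \<cdot> y) = x"
      using cmp_assoc[OF G N[OF y(1)] L M y(2) l[OF y(1)] f(1)] f(2)[OF y(1)] y(3) by simp
    then show "\<exists>y\<in>Hom C G L. f \<cdot> y = x"
      using cmp_in[OF G N[OF y(1)] L y(2) l[OF y(1)]] by blast
  qed
  then obtain g where g: "g \<in> Hom C M L" "f \<cdot> g = Idn C M"
    unfolding iso_arr_def by blast
  have "\<exists>a\<in>Ob ?J. \<exists>s\<in>Hom C M (N a). l a \<cdot> s = g"
  proof (rule finitely_generated_factor[OF fg M J fJ dJ _ colim g(1)])
    fix a b t assume ab: "a \<in> Ob ?J" "b \<in> Ob ?J" "t \<in> Hom ?J a b"
    then have a: "a \<in> I" and b: "b \<in> I" and r: "rel a b" by auto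
    show "monic C (N a) (N b) (Nm a b)"
      unfolding monic_def
    proof (intro conjI ballI impI Nm(1)[OF r])
      fix W v w assume W: "W \<in> Ob C" "v \<in> Hom C W (N a)" "w \<in> Hom C W (N a)" "Nm a b \<cdot> v = Nm a b \<cdot> w"
      have "e a \<cdot> v = e a \<cdot> w"
        using cmp_assoc[OF W(1) N[OF a] N[OF b] M W(2) Nm(1)[OF r] e_in[OF b]]
          cmp_assoc[OF W(1) N[OF a] N[OF b] M W(3) Nm(1)[OF r] e_in[OF b]] Nm(2)[OF r] W(4) by simp
      then show "v = w"
        by (rule e_cancel[OF a W(1-3)])
    qed
  qed
  then obtain a s where a: "a \<in> I" and s: "s \<in> Hom C M (N a)" "l a \<cdot> s = g"
    by auto
  have es: "e a \<cdot> s = Idn C M"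
    using cmp_assoc[OF M N[OF a] L M s(1) l[OF a] f(1)] f(2)[OF a] s(2) g(2) by simp
  \<comment> \<open>A monic arrow with a right inverse is invertible: \<open>e a\<close> is
    cancelled on the left.\<close>
  have "e a \<cdot> (s \<cdot> e a) = e a \<cdot> Idn C (N a)"
    using cmp_assoc[OF N[OF a] M N[OF a] M e_in[OF a] s(1) e_in[OF a]] es
      idn_left[OF N[OF a] M e_in[OF a]] idn_right[OF N[OF a] M e_in[OF a]] by simp
  then have "s \<cdot> e a = Idn C (N a)"
    by (rule e_cancel[OF a N[OF a] cmp_in[OF N[OF a] M N[OF a] e_in[OF a] s(1)] idn_in[OF N[OF a]]])
  then show ?thesis
    using a s(1) es e_in unfolding iso_arr_def by blast
qed

text \<open>The directed family consists of all monomorphisms from the chosen powers into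
  \<open>M\<close>. Besides directedness and covering, its size has to be controlled.\<close>

theorem finitely_generated_free:
  assumes u: "(UNIV :: nat set) \<prec> (UNIV :: 'u set)"
    and colims: "has_filtered_colimits TYPE('u) C"
    and comm: "filtered_colimits_commute_finite_limits TYPE('u) C"
    and M: "M \<in> Ob C" and fg: "finitely_generated TYPE('u) C M"
    and small: "Hom C G M \<prec> (UNIV :: 'u set)"
  shows "\<exists>n P. is_power C G n P \<and> isomorphic C M P"
proof -
  obtain P inc where P: "\<And>n. power_with n (P n) (inc n)"
    and bip: "\<And>n. \<exists>i j p q. biproduct C (P n) G (P (Suc n)) i j p q"
    using powers_exist by blast
  have P_ob [simp]: "\<And>n. P n \<in> Ob C" and inc: "\<And>n m. m < n \<Longrightarrow> inc n m \<in> Hom C G (P n)"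
    using P by (auto simp: is_coproduct_def)
  note fac = power_with_factor[OF P]
  define S where "S = {(n, f). monic C (P n) M f}"
  have S_in: "f \<in> Hom C (P n) M" if "(n, f) \<in> S" for n f
    using that by (simp add: S_def monic_def)
  \<comment> \<open>An arrow out of a power is determined by its list of components, which embeds
    \<open>S\<close> into the lists over the small set \<open>Hom C G M\<close>.\<close>
  define code where "code = (\<lambda>(n, f). map (\<lambda>m. f \<cdot> inc n m) [0..<n])"
  have in_M: "f \<cdot> inc n m \<in> Hom C G M" if "(n, f) \<in> S" "m < n" for n f m
    using cmp_in[OF G P_ob M inc[OF that(2)] S_in[OF that(1)]] .
  have "inj_on code S"
  proof (rule inj_onI, clarify)
    fix n f n' f' assume f: "(n, f) \<in> S" and f': "(n', f') \<in> S" and eq: "code (n, f) = code (n', f')"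
    have n: "n' = n"
      using arg_cong[OF eq, of length] by (simp add: code_def)
    have "f' \<cdot> inc n m = f \<cdot> inc n m" if "m < n" for m
      using arg_cong[OF eq, of "\<lambda>xs. xs ! m"] that by (simp add: code_def n)
    then have "f = f'"
      using fac[OF M, of n "\<lambda>m. f \<cdot> inc n m"] in_M[OF f] S_in[OF f] S_in[OF f'] n by auto
    then show "n = n' \<and> f = f'" using n by simp
  qed
  moreover have "code ` S \<subseteq> lists (Hom C G M)"
    using in_M by (auto simp: code_def)
  ultimately have "S \<lesssim> lists (Hom C G M)"
    unfolding lepoll_def by blast
  then have S_small: "S \<prec> (UNIV :: 'u set)"
    using lists_lesspoll[OF u small] lesspoll_trans1 by blast
  then obtain \<psi> :: "nat \<times> 'm \<Rightarrow> 'u" where \<psi>: "inj_on \<psi> S"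
    using lesspoll_imp_lepoll unfolding lepoll_def by blast
  \<comment> \<open>Indices have to be elements of \<open>'u\<close>, so \<open>S\<close> is copied
    there along an injection and decoded by \<open>dec\<close>.\<close>
  define I where "I = \<psi> ` S"
  define dec where "dec = inv_into S \<psi>"
  have dec: "dec (\<psi> s) = s" if "s \<in> S" for s
    using that \<psi> by (simp add: dec_def)
  have I_small: "I \<prec> (UNIV :: 'u set)"
    unfolding I_def using S_small \<psi> by simp
  let ?N = "\<lambda>a. P (fst (dec a))" and ?e = "\<lambda>a. snd (dec a)"
  have Ex_I: "(\<exists>a\<in>I. Q (dec a)) \<longleftrightarrow> (\<exists>s\<in>S. Q s)" for Q
    using dec by (auto simp: I_def)
  have I_S: "dec a \<in> S" if "a \<in> I" for a
    using that dec by (auto simp: I_def)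
  have dominate: "\<exists>m f'. (m, f') \<in> S \<and> (\<exists>t\<in>Hom C (P n) (P m). f' \<cdot> t = f) \<and> (\<forall>x\<in>set xs. \<exists>y\<in>Hom C G (P m). f' \<cdot> y = x)"
    if f: "(n, f) \<in> S" and xs: "set xs \<subseteq> Hom C G M" for n f xs
  proof -
    have "monic_arr (Arrow (P n) M f)"
      using f M by (simp add: S_def monic_arr_iff)
    moreover have "arr x \<and> src x = G \<and> tgt x = M" if "x \<in> set (map (Arrow G M) xs)" for x
      using that xs M by auto
    ultimately have "\<exists>m e'. monic_arr e' \<and> src e' = P m \<and> tgt e' = M \<and>
        (\<exists>t. arr t \<and> tgt t = src e' \<and> e' \<bullet> t = Arrow (P n) M f) \<and>
        (\<forall>x\<in>set (map (Arrow G M) xs). \<exists>y. arr y \<and> tgt y = src e' \<and> e' \<bullet> y = x)"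
      by (intro monic_arr_dominate bip) simp_all
    then obtain m e' t where e': "monic_arr e'" "src e' = P m" "tgt e' = M"
      and t: "arr t" "tgt t = src e'" "e' \<bullet> t = Arrow (P n) M f"
      and ys: "\<forall>x\<in>set (map (Arrow G M) xs). \<exists>y. arr y \<and> tgt y = src e' \<and> e' \<bullet> y = x"
      by (elim exE conjE)
    have "Arrow (P m) M (mor e') = e'"
      using e' by (intro arrow_eqI) simp_all
    then have S: "(m, mor e') \<in> S"
      using e' M by (simp add: S_def monic_arr_iff)
    have through: "mor y \<in> Hom C X (P m) \<and> mor e' \<cdot> mor y = x"
      if "arr y" "tgt y = src e'" "e' \<bullet> y = Arrow X M x" for X y x
      using arr_mor[OF that(1)] that(2) e'(2) arg_cong[OF that(3), of src] arg_cong[OF that(3), of mor] by simp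
    show ?thesis
    proof (intro exI conjI)
      show "(m, mor e') \<in> S" by (rule S)
      show "\<exists>t\<in>Hom C (P n) (P m). mor e' \<cdot> t = f"
        using through[OF t] by blast
      show "\<forall>x\<in>set xs. \<exists>y\<in>Hom C G (P m). mor e' \<cdot> y = x"
      proof
        fix x assume "x \<in> set xs"
        then obtain y where "arr y" "tgt y = src e'" "e' \<bullet> y = Arrow G M x"
          using ys by auto
        then show "\<exists>y\<in>Hom C G (P m). mor e' \<cdot> y = x"
          using through by blast
      qed
    qed
  qed
  \<comment> \<open>The empty power is a zero object, so the zero arrow out of it is monic and the
    family is not empty.\<close>
  have zero_S: "\<exists>f. (0, f) \<in> S"
  proof -
    have "f = g" if "X \<in> Ob C" "f \<in> Hom C (P 0) X" "g \<in> Hom C (P 0) X" for X f g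
      using fac[OF that(1), of 0 undefined] that(2,3) by auto
    then have "Idn C (P 0) = Zero C (P 0) (P 0)"
      using idn_in zero_in P_ob by blast
    then have "g = Zero C W (P 0)" if "W \<in> Ob C" "g \<in> Hom C W (P 0)" for W g
      using idn_left[OF that(1) P_ob that(2)] cmp_zero_left[OF that(1) P_ob P_ob that(2)] by simp
    then have "monic C (P 0) M (Zero C (P 0) M)"
      using monic_iff_kernel_zero[OF P_ob M zero_in[OF P_ob M]] by blast
    then show ?thesis by (auto simp: S_def)
  qed
  have "\<exists>a\<in>I. iso_arr C (?N a) M (?e a)"
  proof (rule directed_union_iso[OF u I_small _ colims comm M fg])
    show "I \<noteq> {}"
      using zero_S by (auto simp: I_def)
    show "monic C (?N a) M (?e a)" if "a \<in> I" for a
      using I_S[OF that] by (auto simp: S_def)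
    show "\<exists>c\<in>I. (\<exists>t\<in>Hom C (?N a) (?N c). ?e c \<cdot> t = ?e a) \<and> (\<exists>t\<in>Hom C (?N b) (?N c). ?e c \<cdot> t = ?e b)"
      if ab: "a \<in> I" "b \<in> I" for a b
    proof -
      obtain n f n' f' where f: "dec a = (n, f)" "dec b = (n', f')" by force
      then have S: "(n, f) \<in> S" "(n', f') \<in> S"
        using I_S ab by force+
      \<comment> \<open>A monomorphism dominating \<open>f\<close> and all components of
        \<open>f'\<close> also dominates \<open>f'\<close>, because lifts of the components assemble
        to an arrow out of \<open>P n'\<close>.\<close>
      obtain m e' t where e': "(m, e') \<in> S" "t \<in> Hom C (P n) (P m)" "e' \<cdot> t = f"
        and "\<forall>x\<in>set (map (\<lambda>k. f' \<cdot> inc n' k) [0..<n']). \<exists>y\<in>Hom C G (P m). e' \<cdot> y = x"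
        using dominate[OF S(1), of "map (\<lambda>k. f' \<cdot> inc n' k) [0..<n']"] in_M[OF S(2)] by fastforce
      then have "\<forall>k. \<exists>y. k < n' \<longrightarrow> y \<in> Hom C G (P m) \<and> e' \<cdot> y = f' \<cdot> inc n' k"
        by auto
      then obtain y where y: "\<And>k. k < n' \<Longrightarrow> y k \<in> Hom C G (P m)" "\<And>k. k < n' \<Longrightarrow> e' \<cdot> y k = f' \<cdot> inc n' k"
        by metis
      obtain h where h: "h \<in> Hom C (P n') (P m)" "\<And>k. k < n' \<Longrightarrow> h \<cdot> inc n' k = y k"
        using fac[OF P_ob[of m], of n' y] y(1) by blast
      have eh: "e' \<cdot> h \<in> Hom C (P n') M"
        using cmp_in[OF P_ob P_ob M h(1) S_in[OF e'(1)]] .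
      have "(e' \<cdot> h) \<cdot> inc n' k = f' \<cdot> inc n' k" if "k < n'" for k
        using cmp_assoc[OF G P_ob P_ob M inc[OF that] h(1) S_in[OF e'(1)]] h(2)[OF that] y(2)[OF that] by simp
      then have "e' \<cdot> h = f'"
        using fac[OF M, of n' "\<lambda>k. f' \<cdot> inc n' k"] in_M[OF S(2)] eh S_in[OF S(2)] by auto
      then show ?thesis
        unfolding Ex_I[of "\<lambda>c. (\<exists>t\<in>Hom C (?N a) (P (fst c)). snd c \<cdot> t = ?e a) \<and> (\<exists>t\<in>Hom C (?N b) (P (fst c)). snd c \<cdot> t = ?e b)"]
        using e' h(1) by (intro bexI[of _ "(m, e')"]) (auto simp: f)
    qed
    show "\<exists>a\<in>I. \<exists>y\<in>Hom C G (?N a). ?e a \<cdot> y = x" if xM: "x \<in> Hom C G M" for x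
    proof -
      \<comment> \<open>Adjoining \<open>x\<close> to the empty family gives a member through which
        \<open>x\<close> factors.\<close>
      obtain f where f: "(0, f) \<in> S"
        using zero_S by blast
      obtain m f' y where "(m, f') \<in> S" "y \<in> Hom C G (P m)" "f' \<cdot> y = x"
        using dominate[OF f, of "[x]"] xM by auto
      then show ?thesis
        unfolding Ex_I[of "\<lambda>a. \<exists>y\<in>Hom C G (P (fst a)). snd a \<cdot> y = x"]
        by (intro bexI[of _ "(m, f')"]) auto
    qed
  qed simp
  then obtain n f where nf: "iso_arr C (P n) M f" by blast
  then have "isomorphic C M (P n)"
    unfolding isomorphic_def iso_arr_def by blast
  moreover have "is_power C G n (P n)"
    unfolding is_power_def using P by blast
  ultimately show ?thesis by blast
qed

end

section \<open>The fraction algebra\<close>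

context preadditive_category
begin

text \<open>A finitely presented subobject is a quotient of a power of \<open>G\<close>, so
  \<open>c\<close> vanishes on it as soon as it kills all arrows from \<open>G\<close>; and
  \<open>M\<close> is the colimit of such subobjects.\<close>

lemma generator_of_presentations:
  assumes gen: "generated_by_fg_subobjects TYPE('u) C"
    and pres: "\<And>N. \<lbrakk>N \<in> Ob C; finitely_generated TYPE('u) C N\<rbrakk> \<Longrightarrow> finitely_presented C G N"
    and G: "G \<in> Ob C" and M: "M \<in> Ob C" and N: "N \<in> Ob C" and c: "c \<in> Hom C M N"
    and zero: "\<And>x. x \<in> Hom C G M \<Longrightarrow> c \<cdot> x = Zero C G N"
  shows "c = Zero C M N"
proof -
  obtain S where S: "S \<subseteq> fg_subobjects TYPE('u) C M"
    and colim: "is_colimit (subobject_cat C S) C fst (\<lambda>_ _ f. f) M snd"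
    using gen M unfolding generated_by_fg_subobjects_def by blast
  have ce: "c \<cdot> e = Zero C X N" if "(X, e) \<in> S" for X e
  proof -
    have X: "X \<in> Ob C" and e: "e \<in> Hom C X M" and fg: "finitely_generated TYPE('u) C X"
      using S that by (auto simp: fg_subobjects_def monic_def)
    obtain n P Q q \<epsilon> where Q: "is_power C G n Q" and P: "P \<in> Ob C" and q: "q \<in> Hom C P Q"
      and coker: "is_cokernel C P Q q X \<epsilon>"
      using pres[OF X fg] unfolding finitely_presented_def is_power_def is_coproduct_def by blast
    obtain inc where cop: "is_coproduct C {..<n} (\<lambda>_. G) Q inc"
      using Q unfolding is_power_def by blast
    have Q_ob: "Q \<in> Ob C" and inc: "\<And>i. i \<in> {..<n} \<Longrightarrow> inc i \<in> Hom C G Q"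
      using cop unfolding is_coproduct_def by blast+
    have \<epsilon>: "\<epsilon> \<in> Hom C Q X"
      using coker unfolding is_cokernel_def by blast
    have ce: "c \<cdot> e \<in> Hom C X N"
      by (rule cmp_in[OF X M N e c])
    have cee: "(c \<cdot> e) \<cdot> \<epsilon> \<in> Hom C Q N"
      by (rule cmp_in[OF Q_ob X N \<epsilon> ce])
    have on_inc: "((c \<cdot> e) \<cdot> \<epsilon>) \<cdot> inc i = Zero C G N" if i: "i \<in> {..<n}" for i
    proof -
      have ei: "\<epsilon> \<cdot> inc i \<in> Hom C G X"
        by (rule cmp_in[OF G Q_ob X inc[OF i] \<epsilon>])
      have "((c \<cdot> e) \<cdot> \<epsilon>) \<cdot> inc i = c \<cdot> (e \<cdot> (\<epsilon> \<cdot> inc i))"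
        using cmp_assoc[OF G Q_ob X N inc[OF i] \<epsilon> ce] cmp_assoc[OF G X M N ei e c] by simp
      then show ?thesis
        using zero[OF cmp_in[OF G X M ei e]] by simp
    qed
    have "\<exists>!h. h \<in> Hom C Q N \<and> (\<forall>i\<in>{..<n}. h \<cdot> inc i = Zero C G N)"
      using is_coproduct_factor[OF cop N, of "\<lambda>_. Zero C G N"] zero_in[OF G N] by simp
    moreover have "(c \<cdot> e) \<cdot> \<epsilon> \<in> Hom C Q N \<and> (\<forall>i\<in>{..<n}. ((c \<cdot> e) \<cdot> \<epsilon>) \<cdot> inc i = Zero C G N)"
      using cee on_inc by blast
    moreover have "Zero C Q N \<in> Hom C Q N \<and> (\<forall>i\<in>{..<n}. Zero C Q N \<cdot> inc i = Zero C G N)"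
      using zero_in[OF Q_ob N] cmp_zero_left[OF G Q_ob N inc] by blast
    ultimately have "(c \<cdot> e) \<cdot> \<epsilon> = Zero C Q N"
      by (rule ex1_eqD)
    then have "c \<cdot> e \<in> Hom C X N \<and> (c \<cdot> e) \<cdot> \<epsilon> = Zero C Q N"
      using ce by blast
    moreover have "\<exists>!h. h \<in> Hom C X N \<and> h \<cdot> \<epsilon> = Zero C Q N"
      using coker N zero_in[OF Q_ob N] cmp_zero_left[OF P Q_ob N q] unfolding is_cokernel_def by blast
    moreover have "Zero C X N \<in> Hom C X N \<and> Zero C X N \<cdot> \<epsilon> = Zero C Q N"
      using zero_in[OF X N] cmp_zero_left[OF Q_ob X N \<epsilon>] by blast
    ultimately show ?thesis
      by (intro ex1_eqD[where P = "\<lambda>h. h \<in> Hom C X N \<and> h \<cdot> \<epsilon> = Zero C Q N"])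
  qed
  have Sub: "X \<in> Ob C" "e \<in> Hom C X M" if "(X, e) \<in> S" for X e
    using S that by (auto simp: fg_subobjects_def monic_def)
  have "cocone (subobject_cat C S) C fst (\<lambda>_ _ f. f) N (\<lambda>s. Zero C (fst s) N)"
    unfolding cocone_def subobject_cat_def using N Sub
    by (auto intro!: cmp_zero_left)
  then have "\<exists>!h. h \<in> Hom C M N \<and> (\<forall>s\<in>S. h \<cdot> snd s = Zero C (fst s) N)"
    using colim by (simp add: is_colimit_def subobject_cat_def)
  moreover have "c \<in> Hom C M N \<and> (\<forall>s\<in>S. c \<cdot> snd s = Zero C (fst s) N)"
    using c ce by auto
  moreover have "Zero C M N \<in> Hom C M N \<and> (\<forall>s\<in>S. Zero C M N \<cdot> snd s = Zero C (fst s) N)"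
    using zero_in[OF M N] Sub cmp_zero_left[OF _ M N] by auto
  ultimately show ?thesis
    by (rule ex1_eqD)
qed

text \<open>\<open>G\<close> is the cokernel of the zero arrow from its power with exponent
  \<open>0\<close> to its power with exponent \<open>1\<close>.\<close>

lemma finitely_presented_self:
  assumes Z: "Z \<in> Ob C" "\<And>X f g. \<lbrakk>X \<in> Ob C; f \<in> Hom C Z X; g \<in> Hom C Z X\<rbrakk> \<Longrightarrow> f = g" and G: "G \<in> Ob C"
  shows "finitely_presented C G G"
proof -
  have "\<exists>!h. h \<in> Hom C Z N" if "N \<in> Ob C" for N
    using that Z zero_in by blast
  then have "is_power C G 0 Z"
    using Z(1) by (simp add: is_power_def is_coproduct_def)
  moreover have "is_power C G 1 G"
    unfolding is_power_def is_coproduct_def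
  proof (intro exI[of _ "\<lambda>_. Idn C G"] conjI ballI allI impI)
    fix N n assume N: "N \<in> Ob C" and "\<forall>i\<in>{..<1::nat}. n i \<in> Hom C G N"
    then have n: "n 0 \<in> Hom C G N" by simp
    show "\<exists>!h. h \<in> Hom C G N \<and> (\<forall>i\<in>{..<1}. h \<cdot> Idn C G = n i)"
    proof (rule ex1I[of _ "n 0"])
      show "n 0 \<in> Hom C G N \<and> (\<forall>i\<in>{..<1}. n 0 \<cdot> Idn C G = n i)"
        using n idn_right[OF G N n] by simp
      fix h assume "h \<in> Hom C G N \<and> (\<forall>i\<in>{..<1::nat}. h \<cdot> Idn C G = n i)"
      then show "h = n 0" using idn_right[OF G N, of h] by simp
    qed
  qed (use G idn_in in auto)
  moreover have "is_cokernel C Z G (Zero C Z G) G (Idn C G)"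
    unfolding is_cokernel_def
  proof (intro conjI ballI impI)
    fix W g assume W: "W \<in> Ob C" and g: "g \<in> Hom C G W"
    show "\<exists>!h. h \<in> Hom C G W \<and> h \<cdot> Idn C G = g"
      by (rule ex1I[of _ g]) (use g idn_right[OF G W] in auto)
  qed (use G Z idn_in cmp_zero_right in auto)
  ultimately show ?thesis
    unfolding finitely_presented_def using zero_in[OF Z(1) G] by blast
qed

end

section \<open>Scalars that become invertible in an algebra\<close>

context monoid_arrow
begin

lemma algebra_module_ob [simp]: "algebra_module C B l \<in> Ob (Mod C A)"
  by (simp add: algebra_module_eq)

lemma fst_algebra_module [simp]: "fst (algebra_module C B l) = Carr B"
  by (simp add: algebra_module_def)

lemma str_Hom_algebra: "l \<in> Hom (Mod C A) (regular_module A) (algebra_module C B l)"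
  using str_Hom by (simp add: algebra_module_eq)

text \<open>\<open>s'\<close> is the image of \<open>s\<close> under the map of endomorphism rings
  induced by \<open>l\<close>, that is, its base change to \<open>B\<close>; the equation with
  \<open>l\<close> characterises it.\<close>

lemma multiplication:
  assumes s: "s \<in> Hom (Mod C A) (regular_module A) (regular_module A)"
  obtains s' where "s' \<in> Hom (Mod C B) (regular_module B) (regular_module B)" "s' \<cdot> l = l \<cdot> s"
proof -
  have "l \<cdot> s \<in> Hom (Mod C A) (regular_module A) (restrict (regular_module B))"
    using A.Mod.cmp_in[OF A.regular_ob A.regular_ob _ s str_Hom] by simp
  then show ?thesis
    using extend[OF B.regular_ob] that by blast
qed

text \<open>The arrows \<open>x\<close> and \<open>y\<close> live over \<open>B\<close> and
  \<open>l\<close> over \<open>A\<close>; associativity is taken in \<open>Mod C A\<close> after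
  restriction of scalars.\<close>

lemma regular_cmp_assoc:
  assumes "x \<in> Hom (Mod C B) (regular_module B) (regular_module B)"
    and "y \<in> Hom (Mod C B) (regular_module B) (regular_module B)"
  shows "(x \<cdot> y) \<cdot> l = x \<cdot> (y \<cdot> l)"
  using A.Mod.cmp_assoc[OF A.regular_ob restrict_ob restrict_ob restrict_ob str_Hom
      restrict_Hom[OF _ _ assms(2)] restrict_Hom[OF _ _ assms(1)]] by simp

lemma regular_cmp_assoc':
  assumes "x \<in> Hom (Mod C B) (regular_module B) (regular_module B)"
    and "s \<in> Hom (Mod C A) (regular_module A) (regular_module A)"
  shows "(x \<cdot> l) \<cdot> s = x \<cdot> (l \<cdot> s)"
  using A.Mod.cmp_assoc[OF A.regular_ob A.regular_ob restrict_ob restrict_ob assms(2) str_Hom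
      restrict_Hom[OF _ _ assms(1)]] by simp

lemma regular_cmp_in:
  assumes "x \<in> Hom (Mod C B) (regular_module B) (regular_module B)"
    and "y \<in> Hom (Mod C B) (regular_module B) (regular_module B)"
  shows "x \<cdot> y \<in> Hom (Mod C B) (regular_module B) (regular_module B)"
  using B.Mod.cmp_in[OF B.regular_ob B.regular_ob B.regular_ob assms(2,1)] by simp

text \<open>An arrow \<open>r\<close> with \<open>r \<cdot> s = l\<close> is
  \<open>a \<mapsto> a / s\<close>. Its extension \<open>r'\<close> satisfies
  \<open>r' \<cdot> s' = 1\<close> by uniqueness of extensions, and endomorphisms of the regular
  module commute.\<close>

lemma multiplication_inverse:
  assumes s: "s \<in> Hom (Mod C A) (regular_module A) (regular_module A)"
    and r: "r \<in> Hom (Mod C A) (regular_module A) (algebra_module C B l)" "r \<cdot> s = l"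
    and s': "s' \<in> Hom (Mod C B) (regular_module B) (regular_module B)" "s' \<cdot> l = l \<cdot> s"
  obtains r' where "r' \<in> Hom (Mod C B) (regular_module B) (regular_module B)" "s' \<cdot> r' = Idn C (Carr B)"
proof -
  obtain r' where r': "r' \<in> Hom (Mod C B) (regular_module B) (regular_module B)" "r' \<cdot> l = r"
    using extend[OF B.regular_ob] r(1) by (auto simp: algebra_module_eq)
  have "(r' \<cdot> s') \<cdot> l = l"
    using regular_cmp_assoc[OF r'(1) s'(1)] regular_cmp_assoc'[OF r'(1) s] s'(2) r'(2) r(2) by simp
  also have "l = Idn C (Carr B) \<cdot> l"
    using A.Mod.idn_left[OF A.regular_ob restrict_ob str_Hom] by simp
  finally have "r' \<cdot> s' = Idn C (Carr B)"
    using extend_unique[OF B.regular_ob regular_cmp_in[OF r'(1) s'(1)]] B.Mod.idn_in[OF B.regular_ob] by simp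
  then have "s' \<cdot> r' = Idn C (Carr B)"
    using B.endomorphism_commute[OF r'(1) s'(1)] by simp
  then show ?thesis using that r'(1) by blast
qed

text \<open>After extension to \<open>B\<close>, precomposition with \<open>s\<close> becomes
  multiplication by the unit \<open>s'\<close>.\<close>

lemma invertible_cancel:
  assumes s: "s \<in> Hom (Mod C A) (regular_module A) (regular_module A)"
    and r: "r \<in> Hom (Mod C A) (regular_module A) (algebra_module C B l)" "r \<cdot> s = l"
    and x: "x \<in> Hom (Mod C A) (regular_module A) (algebra_module C B l)"
    and y: "y \<in> Hom (Mod C A) (regular_module A) (algebra_module C B l)"
    and eq: "x \<cdot> s = y \<cdot> s"
  shows "x = y"
proof -
  let ?E = "Hom (Mod C B) (regular_module B) (regular_module B)"
  obtain s' where s': "s' \<in> ?E" "s' \<cdot> l = l \<cdot> s"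
    using multiplication[OF s] .
  obtain r' where r': "r' \<in> ?E" "s' \<cdot> r' = Idn C (Carr B)"
    using multiplication_inverse[OF s r s'] .
  obtain x' where x': "x' \<in> ?E" "x' \<cdot> l = x"
    using extend[OF B.regular_ob] x by (auto simp: algebra_module_eq)
  obtain y' where y': "y' \<in> ?E" "y' \<cdot> l = y"
    using extend[OF B.regular_ob] y by (auto simp: algebra_module_eq)
  have *: "(z \<cdot> s') \<cdot> l = (z \<cdot> l) \<cdot> s" if "z \<in> ?E" for z
    using regular_cmp_assoc[OF that s'(1)] regular_cmp_assoc'[OF that s] s'(2) by simp
  have "x' \<cdot> s' = y' \<cdot> s'"
    using extend_unique[OF B.regular_ob regular_cmp_in[OF x'(1) s'(1)] regular_cmp_in[OF y'(1) s'(1)]]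
      *[OF x'(1)] *[OF y'(1)] x'(2) y'(2) eq by simp
  moreover have "(z \<cdot> s') \<cdot> r' = z" if "z \<in> ?E" for z
    using B.Mod.cmp_assoc[OF B.regular_ob B.regular_ob B.regular_ob B.regular_ob r'(1) s'(1) that]
      r'(2) B.Mod.idn_right[OF B.regular_ob B.regular_ob that] by simp
  ultimately have "x' = y'"
    using x'(1) y'(1) by metis
  then show ?thesis using x' y' by simp
qed

text \<open>A linear arrow out of \<open>A\<close> is determined by its value at the unit, and
  \<open>l\<close> preserves the unit.\<close>

lemma unital_unique:
  assumes f: "f \<in> Hom (Mod C A) (regular_module A) (algebra_module C B l)" and eq: "f \<cdot> Eta A = Eta B"
  shows "f = l"
proof -
  have F: "A.lin (regular_module A) (algebra_module C B l) (Arrow (Carr A) (Carr B) f)"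
    and L: "A.lin (regular_module A) (algebra_module C B l) (Arrow (Carr A) (Carr B) l)"
    using A.lin_arrow[OF A.regular_ob algebra_module_ob f] A.lin_arrow[OF A.regular_ob algebra_module_ob str_Hom_algebra]
    by simp_all
  have "Arrow (Carr A) (Carr B) f = Arrow (Carr A) (Carr B) l"
  proof (rule A.lin_regular_unique[OF algebra_module_ob F L])
    show "Arrow (Carr A) (Carr B) f \<bullet> A.unt = Arrow (Carr A) (Carr B) l \<bullet> A.unt"
      by (rule arrow_eqI) (use eq l in \<open>simp_all add: Comm_def\<close>)
  qed
  then show ?thesis by simp
qed

end

section \<open>The fraction algebra as one filtered colimit of copies of the monoid object\<close>

lemma (in domain) nonzero_pow:
  "\<lbrakk>s \<in> carrier R; s \<noteq> \<zero>\<rbrakk> \<Longrightarrow> s [^] (n::nat) \<noteq> \<zero>"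
  by (induction n) (auto simp: integral_iff)

lemma nat_cat_simps [simp]: "Ob nat_cat = UNIV" "u \<in> Hom nat_cat m n \<longleftrightarrow> m \<le> n"
  by (simp_all add: nat_cat_def)

text \<open>The objects and arrows bound by existential quantifiers in
  \<open>is_fraction_algebra\<close> and \<open>is_localization\<close> become parameters:
  \<open>lam s\<close> is the family of legs of the sequence defining \<open>Loc s\<close>, and
  \<open>legs\<close> are those of the outer colimit.\<close>

locale fraction_algebra = monoid_arrow C A K k
  for C :: "('o, 'm) moncat" (structure) and A K :: "('o, 'm) monoid_object" and k :: 'm +
  fixes Loc :: "'m \<Rightarrow> ('o, 'm) monoid_object" and loc :: "'m \<Rightarrow> 'm" and can :: "'m \<Rightarrow> 'm \<Rightarrow> 'm"
    and legs :: "'m \<Rightarrow> 'm" and lam :: "'m \<Rightarrow> nat \<Rightarrow> 'm"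
  assumes integral: "domain (End_ring C A)"
    and localization: "\<And>s. s \<in> Ob (divisibility_cat (End_ring C A)) \<Longrightarrow> monoid_arrow C A (Loc s) (loc s)"
    and lam_0: "\<And>s. s \<in> Ob (divisibility_cat (End_ring C A)) \<Longrightarrow> lam s 0 = loc s"
    and lam_colim: "\<And>s. s \<in> Ob (divisibility_cat (End_ring C A)) \<Longrightarrow>
      is_colimit nat_cat (Mod C A) (\<lambda>_. regular_module A) (\<lambda>m n _. s [^]\<^bsub>End_ring C A\<^esub> (n - m))
        (algebra_module C (Loc s) (loc s)) (lam s)"
    and can: "\<And>s s' t. \<lbrakk>s \<in> Ob (divisibility_cat (End_ring C A)); s' \<in> Ob (divisibility_cat (End_ring C A));
        t \<in> Hom (divisibility_cat (End_ring C A)) s s'\<rbrakk> \<Longrightarrow> can s s' \<cdot> loc s = loc s'"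
    and legs_Comm: "\<And>s. s \<in> Ob (divisibility_cat (End_ring C A)) \<Longrightarrow> legs s \<in> Hom (Comm C) (Loc s) K"
    and can_in: "\<And>s s' t. \<lbrakk>s \<in> Ob (divisibility_cat (End_ring C A)); s' \<in> Ob (divisibility_cat (End_ring C A));
        t \<in> Hom (divisibility_cat (End_ring C A)) s s'\<rbrakk> \<Longrightarrow>
        can s s' \<in> Hom (Mod C A) (algebra_module C (Loc s) (loc s)) (algebra_module C (Loc s') (loc s'))"
    and legs_colim: "is_colimit (divisibility_cat (End_ring C A)) (Mod C A) (\<lambda>s. algebra_module C (Loc s) (loc s))
        (\<lambda>s s' t. can s s') (algebra_module C K k) legs"
begin

abbreviation "E \<equiv> End_ring C A"
abbreviation "V \<equiv> carrier (End_ring C A) - {\<zero>\<^bsub>End_ring C A\<^esub>}"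
abbreviation "regA \<equiv> regular_module A"
abbreviation "KA \<equiv> algebra_module C K k"
abbreviation "BA s \<equiv> algebra_module C (Loc s) (loc s)"

sublocale E: domain E
  by (rule integral)

lemma E_simps [simp]: "carrier E = Hom (Mod C A) regA regA" "x \<otimes>\<^bsub>E\<^esub> y = x \<cdot> y"
    "\<one>\<^bsub>E\<^esub> = Idn C (Carr A)" "\<zero>\<^bsub>E\<^esub> = Zero C (Carr A) (Carr A)"
  by (simp_all add: End_ring_def endomorphism_ring_def)

lemma Ob_div [simp]: "Ob (divisibility_cat E) = V"
  by (simp add: divisibility_cat_def)

lemma Hom_div: "t \<in> V \<Longrightarrow> t \<in> Hom (divisibility_cat E) s (s \<cdot> t)"
  by (simp add: divisibility_cat_def)

lemma V_mult: "\<lbrakk>s \<in> V; t \<in> V\<rbrakk> \<Longrightarrow> s \<cdot> t \<in> V"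
  using E.integral_iff[of s t] E.m_closed[of s t] by auto

lemma V_pow: "s \<in> V \<Longrightarrow> s [^]\<^bsub>E\<^esub> (n::nat) \<in> V"
  using E.nonzero_pow[of s n] E.nat_pow_closed[of s n] by auto

lemma V_E: "s \<in> V \<Longrightarrow> s \<in> Hom (Mod C A) regA regA"
  by simp

lemma E_comm: "\<lbrakk>s \<in> V; t \<in> V\<rbrakk> \<Longrightarrow> s \<cdot> t = t \<cdot> s"
  using E.m_comm[of s t] by simp

lemma lam_in: "s \<in> V \<Longrightarrow> lam s m \<in> Hom (Mod C A) regA (BA s)"
  using colimit_leg[OF lam_colim[of s], of m] by simp

lemma lam_pow: "\<lbrakk>s \<in> V; m \<le> n\<rbrakk> \<Longrightarrow> lam s n \<cdot> s [^]\<^bsub>E\<^esub> (n - m) = lam s m"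
  using colimit_leg_cmp[OF lam_colim[of s], of m n "()"] by simp

text \<open>The leg at stage \<open>m\<close> is thus \<open>a \<mapsto> a / s^m\<close>.\<close>

lemma lam_loc: "s \<in> V \<Longrightarrow> lam s m \<cdot> s [^]\<^bsub>E\<^esub> m = loc s"
  using lam_pow[of s 0 m] lam_0[of s] by simp

lemma BA_ob: "s \<in> V \<Longrightarrow> BA s \<in> Ob (Mod C A)"
  using monoid_arrow.algebra_module_ob[OF localization] by simp

lemma legs_in: "s \<in> V \<Longrightarrow> legs s \<in> Hom (Mod C A) (BA s) KA"
  using colimit_leg[OF legs_colim, of s] by simp

lemma lam_unique:
  assumes s: "s \<in> V" and N: "N \<in> Ob (Mod C A)" and f: "f \<in> Hom (Mod C A) (BA s) N" and g: "g \<in> Hom (Mod C A) (BA s) N"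
    and eq: "\<And>m. f \<cdot> lam s m = g \<cdot> lam s m"
  shows "f = g"
proof -
  have "cocone nat_cat (Mod C A) (\<lambda>_. regA) (\<lambda>m n _. s [^]\<^bsub>E\<^esub> (n - m)) N (\<lambda>m. f \<cdot> lam s m)"
    unfolding cocone_def
  proof (intro conjI ballI N)
    fix m show "f \<cdot> lam s m \<in> Hom (Mod C A) regA N"
      using A.Mod.cmp_in[OF A.regular_ob BA_ob[OF s] N lam_in[OF s] f] by simp
  next
    fix m n u assume "u \<in> Hom nat_cat m n"
    then have mn: "m \<le> n" by simp
    show "(f \<cdot> lam s n) \<cdot>\<^bsub>Mod C A\<^esub> s [^]\<^bsub>E\<^esub> (n - m) = f \<cdot> lam s m"
      using A.Mod.cmp_assoc[OF A.regular_ob A.regular_ob BA_ob[OF s] N V_E[OF V_pow[OF s]] lam_in[OF s] f, of n "n - m"]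
        lam_pow[OF s mn] by simp
  qed
  then have "\<exists>!h. h \<in> Hom (Mod C A) (BA s) N \<and> (\<forall>i\<in>Ob nat_cat. h \<cdot>\<^bsub>Mod C A\<^esub> lam s i = f \<cdot> lam s i)"
    by (rule colimit_factor[OF lam_colim, rotated]) (use s in simp)
  then show ?thesis
    by (rule ex1_eqD) (use f g eq in simp_all)
qed

text \<open>Both \<open>loc s\<close> and \<open>legs s\<close> preserve units, and \<open>k\<close>
  is the only linear arrow from \<open>A\<close> to \<open>K\<close> that does.\<close>

lemma legs_loc: "s \<in> V \<Longrightarrow> legs s \<cdot> loc s = k"
proof (rule unital_unique)
  assume s: "s \<in> V"
  interpret S: monoid_arrow C A "Loc s" "loc s"
    by (rule localization) (use s in simp)
  show "legs s \<cdot> loc s \<in> Hom (Mod C A) regA KA"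
    using A.Mod.cmp_in[OF A.regular_ob BA_ob[OF s] _ S.str_Hom_algebra legs_in[OF s]] by simp
  have "(legs s \<cdot> loc s) \<cdot> Eta A = legs s \<cdot> (loc s \<cdot> Eta A)"
    by (rule cmp_assoc[of "Unit_ob C" "Carr A" "Carr (Loc s)" "Carr K"])
      (use S.l legs_Comm[of s] s A.monoid_raw(3) in \<open>simp_all add: Comm_def\<close>)
  then show "(legs s \<cdot> loc s) \<cdot> Eta A = Eta K"
    using S.l legs_Comm[of s] s by (simp add: Comm_def)
qed

text \<open>The arrow \<open>a \<mapsto> a / s\<close>. Stage \<open>1\<close> is taken because
  stage \<open>0\<close> is the structure arrow of the localisation and every further stage divides
  by \<open>s\<close> once more.\<close>

definition inv_leg :: "'m \<Rightarrow> 'm" where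
  "inv_leg s = legs s \<cdot> lam s 1"

lemma legs_lam_in: "s \<in> V \<Longrightarrow> legs s \<cdot> lam s m \<in> Hom (Mod C A) regA KA"
proof -
  assume s: "s \<in> V"
  show ?thesis
    using A.Mod.cmp_in[OF A.regular_ob BA_ob[OF s] algebra_module_ob lam_in[OF s] legs_in[OF s]] by simp
qed

lemma inv_leg_in: "s \<in> V \<Longrightarrow> inv_leg s \<in> Hom (Mod C A) regA KA"
  unfolding inv_leg_def by (rule legs_lam_in)

lemma legs_lam_pow:
  assumes s: "s \<in> V"
  shows "(legs s \<cdot> lam s m) \<cdot> s [^]\<^bsub>E\<^esub> m = k"
  using A.Mod.cmp_assoc[OF A.regular_ob A.regular_ob BA_ob[OF s] algebra_module_ob V_E[OF V_pow[OF s]] lam_in[OF s] legs_in[OF s]]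
    lam_loc[OF s] legs_loc[OF s] by simp

lemma pow_1: "s \<in> V \<Longrightarrow> s [^]\<^bsub>E\<^esub> (1 :: nat) = s"
  using E.nat_pow_Suc[of s 0] E.nat_pow_0[of s] E.l_one[of s] by (simp del: E_simps)

lemma inv_leg: "s \<in> V \<Longrightarrow> inv_leg s \<cdot> s = k"
  using legs_lam_pow[of s 1] unfolding inv_leg_def by (simp only: pow_1)

text \<open>Both sides are \<open>a \<mapsto> a / s^m\<close>: they agree after precomposition with
  \<open>s^m\<close>, which is cancellable for arrows into \<open>K\<close>.\<close>

lemma legs_lam:
  assumes s: "s \<in> V"
  shows "legs s \<cdot> lam s m = inv_leg (s [^]\<^bsub>E\<^esub> m)"
proof -
  note sm = V_pow[OF s, of m]
  show ?thesis
    by (rule invertible_cancel[OF V_E[OF sm] inv_leg_in[OF sm] inv_leg[OF sm] legs_lam_in[OF s] inv_leg_in[OF sm]])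
      (simp only: legs_lam_pow[OF s] inv_leg[OF sm])
qed

text \<open>The identity \<open>1 / s^m = t^m / (s t)^m\<close> in the localisation at
  \<open>s \<cdot> t\<close>. It is checked after multiplication by \<open>s^m\<close>, which is
  invertible there.\<close>

lemma can_lam:
  assumes s: "s \<in> V" and t: "t \<in> V"
  shows "can s (s \<cdot> t) \<cdot> lam s m = lam (s \<cdot> t) m \<cdot> t [^]\<^bsub>E\<^esub> m"
proof -
  let ?st = "s \<cdot> t"
  have st: "?st \<in> V" by (rule V_mult[OF s t])
  interpret ST: monoid_arrow C A "Loc ?st" "loc ?st"
    by (rule localization) (use st in simp)
  note sm = V_pow[OF s, of m] and tm = V_pow[OF t, of m]
  have can': "can s ?st \<in> Hom (Mod C A) (BA s) (BA ?st)"
    using can_in[of s ?st t] s st Hom_div[OF t] by simp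
  have r: "lam ?st m \<cdot> t [^]\<^bsub>E\<^esub> m \<in> Hom (Mod C A) regA (BA ?st)"
    using A.Mod.cmp_in[OF A.regular_ob A.regular_ob _ V_E[OF tm] lam_in[OF st]] by simp
  have "?st [^]\<^bsub>E\<^esub> m = t [^]\<^bsub>E\<^esub> m \<cdot> s [^]\<^bsub>E\<^esub> m"
    using E.nat_pow_distrib[of t s m] s t E_comm[OF s t] by simp
  then have r': "(lam ?st m \<cdot> t [^]\<^bsub>E\<^esub> m) \<cdot> s [^]\<^bsub>E\<^esub> m = loc ?st"
    using A.Mod.cmp_assoc[OF A.regular_ob A.regular_ob A.regular_ob BA_ob[OF st] V_E[OF sm] V_E[OF tm] lam_in[OF st]]
      lam_loc[OF st, of m] by simp
  have x: "can s ?st \<cdot> lam s m \<in> Hom (Mod C A) regA (BA ?st)"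
    using A.Mod.cmp_in[OF A.regular_ob BA_ob[OF s] BA_ob[OF st] lam_in[OF s] can'] by simp
  have "(can s ?st \<cdot> lam s m) \<cdot> s [^]\<^bsub>E\<^esub> m = loc ?st"
    using A.Mod.cmp_assoc[OF A.regular_ob A.regular_ob BA_ob[OF s] BA_ob[OF st] V_E[OF sm] lam_in[OF s] can']
      lam_loc[OF s] can[of s ?st t] s st Hom_div[OF t] by simp
  then show ?thesis
    using ST.invertible_cancel[OF V_E[OF sm] r r' x r] r' by simp
qed

text \<open>The fraction algebra is the colimit of copies of \<open>A\<close> itself, with transition arrow \<open>t\<close>
  from the copy at \<open>s\<close> to that at \<open>s \<cdot> t\<close>; the leg at \<open>s\<close> is \<open>a \<mapsto> a / s\<close>.\<close>

lemma inv_leg_universal: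
  assumes N: "N \<in> Ob (Mod C A)" and n: "\<And>s. s \<in> V \<Longrightarrow> n s \<in> Hom (Mod C A) regA N"
    and step: "\<And>s t. \<lbrakk>s \<in> V; t \<in> V\<rbrakk> \<Longrightarrow> n (s \<cdot> t) \<cdot> t = n s"
  shows "\<exists>!h. h \<in> Hom (Mod C A) KA N \<and> (\<forall>s\<in>V. h \<cdot> inv_leg s = n s)"
proof -
  \<comment> \<open>The localisation at \<open>s\<close> sees only the values of \<open>n\<close> at
    powers of \<open>s\<close>; by \<open>step\<close> these form a cocone on its defining
    sequence.\<close>
  have "\<exists>h. h \<in> Hom (Mod C A) (BA s) N \<and> (\<forall>m. h \<cdot> lam s m = n (s [^]\<^bsub>E\<^esub> m))" if s: "s \<in> V" for s
  proof -
    have "n (s [^]\<^bsub>E\<^esub> j) \<cdot> s [^]\<^bsub>E\<^esub> (j - i) = n (s [^]\<^bsub>E\<^esub> i)" if "i \<le> j" for i j :: nat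
    proof -
      have "s [^]\<^bsub>E\<^esub> j = s [^]\<^bsub>E\<^esub> i \<cdot> s [^]\<^bsub>E\<^esub> (j - i)"
        using E.nat_pow_mult[of s i "j - i"] s that by simp
      then show ?thesis
        using step[OF V_pow[OF s, of i] V_pow[OF s, of "j - i"]] by simp
    qed
    then have "cocone nat_cat (Mod C A) (\<lambda>_. regA) (\<lambda>m n _. s [^]\<^bsub>E\<^esub> (n - m)) N (\<lambda>m. n (s [^]\<^bsub>E\<^esub> m))"
      using N n[OF V_pow[OF s]] by (simp add: cocone_def)
    then have "\<exists>!h. h \<in> Hom (Mod C A) (BA s) N \<and> (\<forall>i\<in>Ob nat_cat. h \<cdot>\<^bsub>Mod C A\<^esub> lam s i = n (s [^]\<^bsub>E\<^esub> i))"
      by (rule colimit_factor[OF lam_colim, rotated]) (use s in simp)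
    then show ?thesis
      by auto
  qed
  then obtain h where h: "\<And>s. s \<in> V \<Longrightarrow> h s \<in> Hom (Mod C A) (BA s) N"
    and h_lam: "\<And>s m. s \<in> V \<Longrightarrow> h s \<cdot> lam s m = n (s [^]\<^bsub>E\<^esub> m)"
    by metis
  \<comment> \<open>Arrows out of a localisation are compared on the legs \<open>lam s m\<close>,
    where \<open>can_lam\<close> reduces the claim to \<open>step\<close> at \<open>s^m\<close> and
    \<open>t^m\<close>, using \<open>(s t)^m = s^m t^m\<close>.\<close>
  have h_can: "h (s \<cdot> t) \<cdot> can s (s \<cdot> t) = h s" if s: "s \<in> V" and t: "t \<in> V" for s t
  proof (rule lam_unique[OF s N])
    note st = V_mult[OF s t]
    have can': "can s (s \<cdot> t) \<in> Hom (Mod C A) (BA s) (BA (s \<cdot> t))"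
      using can_in[of s "s \<cdot> t" t] s st Hom_div[OF t] by simp
    show "h (s \<cdot> t) \<cdot> can s (s \<cdot> t) \<in> Hom (Mod C A) (BA s) N"
      using A.Mod.cmp_in[OF BA_ob[OF s] BA_ob[OF st] N can' h[OF st]] by simp
    fix m
    note sm = V_pow[OF s, of m] and tm = V_pow[OF t, of m]
    have "(h (s \<cdot> t) \<cdot> can s (s \<cdot> t)) \<cdot> lam s m = h (s \<cdot> t) \<cdot> (lam (s \<cdot> t) m \<cdot> t [^]\<^bsub>E\<^esub> m)"
      using A.Mod.cmp_assoc[OF A.regular_ob BA_ob[OF s] BA_ob[OF st] N lam_in[OF s] can' h[OF st]]
        can_lam[OF s t] by simp
    also have "\<dots> = n ((s \<cdot> t) [^]\<^bsub>E\<^esub> m) \<cdot> t [^]\<^bsub>E\<^esub> m"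
      using A.Mod.cmp_assoc[OF A.regular_ob A.regular_ob BA_ob[OF st] N V_E[OF tm] lam_in[OF st] h[OF st]]
        h_lam[OF st] by simp
    also have "(s \<cdot> t) [^]\<^bsub>E\<^esub> m = s [^]\<^bsub>E\<^esub> m \<cdot> t [^]\<^bsub>E\<^esub> m"
      using E.nat_pow_distrib[of s t m] s t by simp
    also have "n (s [^]\<^bsub>E\<^esub> m \<cdot> t [^]\<^bsub>E\<^esub> m) \<cdot> t [^]\<^bsub>E\<^esub> m = h s \<cdot> lam s m"
      using step[OF sm tm] h_lam[OF s] by simp
    finally show "(h (s \<cdot> t) \<cdot> can s (s \<cdot> t)) \<cdot> lam s m = h s \<cdot> lam s m" .
  qed (use h s in simp)
  have "cocone (divisibility_cat E) (Mod C A) BA (\<lambda>s s' t. can s s') N h"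
    unfolding cocone_def using N h h_can by (auto simp: divisibility_cat_def)
  then have H: "\<exists>!g. g \<in> Hom (Mod C A) KA N \<and> (\<forall>s\<in>V. g \<cdot> legs s = h s)"
    using colimit_factor[OF legs_colim] by simp
  \<comment> \<open>The leg of \<open>K\<close> at \<open>s\<close> restricted to stage
    \<open>m\<close> is \<open>inv_leg\<close> at \<open>s^m\<close>, which gives one direction; the
    other is the case \<open>m = 1\<close>.\<close>
  have legs_iff: "(\<forall>s\<in>V. g \<cdot> inv_leg s = n s) \<longleftrightarrow> (\<forall>s\<in>V. g \<cdot> legs s = h s)"
    if g: "g \<in> Hom (Mod C A) KA N" for g
  proof (intro iffI ballI)
    have assoc: "(g \<cdot> legs s) \<cdot> lam s m = g \<cdot> inv_leg (s [^]\<^bsub>E\<^esub> m)" if "s \<in> V" for s m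
      using A.Mod.cmp_assoc[OF A.regular_ob BA_ob[OF that] algebra_module_ob N lam_in[OF that] legs_in[OF that] g]
        legs_lam[OF that] by simp
    {
      fix s assume inv: "\<forall>s\<in>V. g \<cdot> inv_leg s = n s" and s: "s \<in> V"
      show "g \<cdot> legs s = h s"
      proof (rule lam_unique[OF s N _ h[OF s]])
        show "g \<cdot> legs s \<in> Hom (Mod C A) (BA s) N"
          using A.Mod.cmp_in[OF BA_ob[OF s] algebra_module_ob N legs_in[OF s] g] by simp
        show "(g \<cdot> legs s) \<cdot> lam s m = h s \<cdot> lam s m" for m
          unfolding assoc[OF s] h_lam[OF s] using inv V_pow[OF s] by blast
      qed
    next
      fix s assume "\<forall>s\<in>V. g \<cdot> legs s = h s" and s: "s \<in> V"
      then have "g \<cdot> legs s = h s" by blast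
      then show "g \<cdot> inv_leg s = n s"
        using assoc[OF s, of 1] h_lam[OF s, of 1] pow_1[OF s] by metis
    }
  qed
  have "(g \<in> Hom (Mod C A) KA N \<and> (\<forall>s\<in>V. g \<cdot> inv_leg s = n s)) =
      (g \<in> Hom (Mod C A) KA N \<and> (\<forall>s\<in>V. g \<cdot> legs s = h s))" for g
    using legs_iff by blast
  then show ?thesis
    using H by presburger
qed

text \<open>The rule \<open>(a t) / (s t) = a / s\<close>, checked after multiplication by
  \<open>s\<close>.\<close>

lemma inv_leg_step:
  assumes s: "s \<in> V" and t: "t \<in> V"
  shows "inv_leg (s \<cdot> t) \<cdot> t = inv_leg s"
proof -
  note st = V_mult[OF s t]
  have x: "inv_leg (s \<cdot> t) \<cdot> t \<in> Hom (Mod C A) regA KA"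
    using A.Mod.cmp_in[OF A.regular_ob A.regular_ob algebra_module_ob V_E[OF t] inv_leg_in[OF st]] by simp
  have "(inv_leg (s \<cdot> t) \<cdot> t) \<cdot> s = k"
    using A.Mod.cmp_assoc[OF A.regular_ob A.regular_ob A.regular_ob algebra_module_ob V_E[OF s] V_E[OF t] inv_leg_in[OF st]]
      inv_leg[OF st] E_comm[OF s t] by simp
  then show ?thesis
    using invertible_cancel[OF V_E[OF s] inv_leg_in[OF s] inv_leg[OF s] x inv_leg_in[OF s]] inv_leg[OF s] by simp
qed

text \<open>The stage of the colimit through which \<open>x\<close> factors supplies the denominator
  \<open>s\<close>, and the factor itself is the numerator \<open>a\<close>.\<close>

lemma fraction:
  assumes u: "(UNIV :: nat set) \<prec> (UNIV :: 'u set)"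
    and small: "Hom (Mod C A) regA regA \<prec> (UNIV :: 'u set)"
    and fg: "finitely_generated TYPE('u) (Mod C A) regA"
    and generator: "\<And>M N c. \<lbrakk>M \<in> Ob (Mod C A); N \<in> Ob (Mod C A); c \<in> Hom (Mod C A) M N;
      \<And>x. x \<in> Hom (Mod C A) regA M \<Longrightarrow> c \<cdot> x = Zero C (Carr A) (fst N)\<rbrakk> \<Longrightarrow> c = Zero C (fst M) (fst N)"
    and x: "x \<in> Hom (Mod C A) regA KA"
  obtains s a where "s \<in> V" "a \<in> Hom (Mod C A) regA regA" "inv_leg s \<cdot> a = x"
proof -
  let ?E = "Hom (Mod C A) regA regA"
  have V_small: "V \<prec> (UNIV :: 'u set)"
    using small subset_imp_lepoll[of V ?E] lesspoll_trans1 by auto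
  then obtain \<psi> :: "'m \<Rightarrow> 'u" where \<psi>: "inj_on \<psi> V"
    using lesspoll_imp_lepoll unfolding lepoll_def by blast
  define I where "I = \<psi> ` V"
  define dec where "dec = inv_into V \<psi>"
  have dec: "dec (\<psi> s) = s" if "s \<in> V" for s
    using that \<psi> by (simp add: dec_def)
  have dec_V: "dec a \<in> V" if "a \<in> I" for a
    using that dec unfolding I_def by force
  have \<psi>_I: "\<psi> s \<in> I" if "s \<in> V" for s
    using that by (simp add: I_def)
  have I_small: "I \<prec> (UNIV :: 'u set)"
    unfolding I_def using V_small \<psi> by simp
  define rel where "rel a b \<longleftrightarrow> (\<exists>t\<in>V. dec b = dec a \<cdot> t)" for a b
  \<comment> \<open>In a domain the quotient of two nonzero elements is unique if it exists. So the
    divisibility category is thin, and its copy in \<open>'u\<close> is given by a preorder with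
    these quotients as transition arrows.\<close>
  define dv where "dv a b = (SOME t. t \<in> V \<and> dec b = dec a \<cdot> t)" for a b
  have dv: "dv a b \<in> V" "dec b = dec a \<cdot> dv a b" if "rel a b" for a b
    using someI_ex[of "\<lambda>t. t \<in> V \<and> dec b = dec a \<cdot> t"] that unfolding rel_def dv_def by blast+
  have cancel: "t = t'" if "s \<in> V" "t \<in> V" "t' \<in> V" "s \<cdot> t = s \<cdot> t'" for s t t'
    using E.m_lcancel[of s t t'] that by simp
  have one: "Idn C (Carr A) \<in> V"
    using E.one_closed E.one_not_zero by simp
  have r_one: "s \<cdot> Idn C (Carr A) = s" if "s \<in> V" for s
    using E.r_one[of s] that by simp
  have assoc: "(s \<cdot> t) \<cdot> r = s \<cdot> (t \<cdot> r)" if "s \<in> V" "t \<in> V" "r \<in> V" for s t r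
    using E.m_assoc[of s t r] that by simp
  have refl: "rel a a" if "a \<in> I" for a
    unfolding rel_def using one r_one[OF dec_V[OF that]] by metis
  have comp: "dec c = dec a \<cdot> (dv a b \<cdot> dv b c)" "dv a b \<cdot> dv b c \<in> V"
    if "a \<in> I" "rel a b" "rel b c" for a b c
    using dv(2)[OF that(2)] dv(2)[OF that(3)] assoc[OF dec_V[OF that(1)] dv(1)[OF that(2)] dv(1)[OF that(3)]]
      V_mult[OF dv(1)[OF that(2)] dv(1)[OF that(3)]] by metis+
  have trans: "rel a c" if "a \<in> I" "b \<in> I" "c \<in> I" "rel a b" "rel b c" for a b c
    using comp[OF that(1,4,5)] unfolding rel_def by metis
  let ?J = "thin_cat I rel"
  have J: "small_cat TYPE('u) ?J"
    by (rule small_thin_cat[OF u I_small]) (fact refl, fact trans)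
  have fJ: "filtered ?J"
  proof (rule filtered_thin_cat)
    show "I \<noteq> {}" using \<psi>_I[OF one] by blast
    fix a b assume a: "a \<in> I" and b: "b \<in> I"
    have "dec (\<psi> (dec a \<cdot> dec b)) = dec a \<cdot> dec b" "dec a \<cdot> dec b \<in> V"
      using dec V_mult dec_V a b by metis+
    moreover have "dec a \<cdot> dec b = dec b \<cdot> dec a"
      using E_comm dec_V a b by metis
    ultimately show "\<exists>c\<in>I. rel a c \<and> rel b c"
      unfolding rel_def using dec_V a b \<psi>_I by metis
  qed (fact refl)
  have dJ: "diagram ?J (Mod C A) (\<lambda>_. regA) (\<lambda>a b _. dv a b)"
  proof (rule diagram_thin_cat)
    fix a assume a: "a \<in> I"
    show "dv a a = Idn (Mod C A) regA"
      using cancel[OF dec_V[OF a] dv(1)[OF refl[OF a]] one] dv(2)[OF refl[OF a]] r_one[OF dec_V[OF a]] by simp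
  next
    fix a b c assume abc: "a \<in> I" "b \<in> I" "c \<in> I" "rel a b" "rel b c"
    note r = trans[OF abc]
    have "dv a c = dv a b \<cdot> dv b c"
      using cancel[OF dec_V[OF abc(1)] dv(1)[OF r] comp(2)[OF abc(1,4,5)]] dv(2)[OF r] comp(1)[OF abc(1,4,5)] by simp
    then show "dv a c = dv b c \<cdot>\<^bsub>Mod C A\<^esub> dv a b"
      using E_comm[OF dv(1)[OF abc(4)] dv(1)[OF abc(5)]] by simp
  qed (use dv(1) in auto)
  have colim: "is_colimit ?J (Mod C A) (\<lambda>_. regA) (\<lambda>a b _. dv a b) KA (\<lambda>a. inv_leg (dec a))"
    unfolding is_colimit_def
  proof (intro conjI allI impI)
    show "cocone ?J (Mod C A) (\<lambda>_. regA) (\<lambda>a b _. dv a b) KA (\<lambda>a. inv_leg (dec a))"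
      unfolding cocone_thin_cat
    proof (intro conjI ballI impI algebra_module_ob)
      fix a assume a: "a \<in> I"
      show "inv_leg (dec a) \<in> Hom (Mod C A) regA KA"
        by (rule inv_leg_in[OF dec_V[OF a]])
      fix b assume r: "rel a b"
      show "inv_leg (dec b) \<cdot>\<^bsub>Mod C A\<^esub> dv a b = inv_leg (dec a)"
        using inv_leg_step[OF dec_V[OF a] dv(1)[OF r]] dv(2)[OF r] by simp
    qed
    fix N n assume "cocone ?J (Mod C A) (\<lambda>_. regA) (\<lambda>a b _. dv a b) N n"
    then have N: "N \<in> Ob (Mod C A)" and n: "\<And>a. a \<in> I \<Longrightarrow> n a \<in> Hom (Mod C A) regA N"
      and n_step: "\<And>a b. \<lbrakk>a \<in> I; b \<in> I; rel a b\<rbrakk> \<Longrightarrow> n b \<cdot> dv a b = n a"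
      by (simp_all add: cocone_thin_cat)
    have "\<exists>!h. h \<in> Hom (Mod C A) KA N \<and> (\<forall>s\<in>V. h \<cdot> inv_leg s = n (\<psi> s))"
    proof (rule inv_leg_universal[OF N])
      show "n (\<psi> s) \<in> Hom (Mod C A) regA N" if "s \<in> V" for s
        by (rule n[OF \<psi>_I[OF that]])
      fix s t assume s: "s \<in> V" and t: "t \<in> V"
      have d: "dec (\<psi> (s \<cdot> t)) = dec (\<psi> s) \<cdot> t"
        using dec[OF s] dec[OF V_mult[OF s t]] by simp
      then have r: "rel (\<psi> s) (\<psi> (s \<cdot> t))"
        unfolding rel_def using t by blast
      have "dv (\<psi> s) (\<psi> (s \<cdot> t)) = t"
        using cancel[OF s dv(1)[OF r] t] dv(2)[OF r] d dec[OF s] by simp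
      then show "n (\<psi> (s \<cdot> t)) \<cdot> t = n (\<psi> s)"
        using n_step[OF \<psi>_I[OF s] \<psi>_I[OF V_mult[OF s t]] r] by simp
    qed
    moreover have "(\<forall>s\<in>V. h \<cdot> inv_leg s = n (\<psi> s)) \<longleftrightarrow> (\<forall>a\<in>Ob ?J. h \<cdot>\<^bsub>Mod C A\<^esub> inv_leg (dec a) = n a)" for h
      unfolding thin_cat_simps(1) A.Mod_simps(2)
    proof (intro iffI ballI)
      fix a assume *: "\<forall>s\<in>V. h \<cdot> inv_leg s = n (\<psi> s)" and "a \<in> I"
      then obtain s where "s \<in> V" "a = \<psi> s" unfolding I_def by blast
      then show "h \<cdot> inv_leg (dec a) = n a"
        using * dec by metis
    next
      fix s assume *: "\<forall>a\<in>I. h \<cdot> inv_leg (dec a) = n a" and "s \<in> V"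
      then show "h \<cdot> inv_leg s = n (\<psi> s)"
        using \<psi>_I dec by metis
    qed
    ultimately show "\<exists>!h. h \<in> Hom (Mod C A) KA N \<and> (\<forall>a\<in>Ob ?J. h \<cdot>\<^bsub>Mod C A\<^esub> inv_leg (dec a) = n a)"
      by simp
  qed
  \<comment> \<open>A kernel element of \<open>s\<close> is tested on arrows from the generator
    \<open>A\<close>; the composite is an endomorphism annihilated by \<open>s\<close>, hence zero
    in the domain.\<close>
  have monic: "monic (Mod C A) regA regA s" if s: "s \<in> V" for s
    unfolding A.Mod.monic_iff_kernel_zero[OF A.regular_ob A.regular_ob V_E[OF s]]
  proof (intro ballI impI)
    fix W g assume W: "W \<in> Ob (Mod C A)" and g: "g \<in> Hom (Mod C A) W regA"
      and sg: "s \<cdot>\<^bsub>Mod C A\<^esub> g = Zero (Mod C A) W regA"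
    have "g = Zero C (fst W) (fst regA)"
    proof (rule generator[OF W A.regular_ob g])
      fix w assume w: "w \<in> Hom (Mod C A) regA W"
      have gw: "g \<cdot> w \<in> ?E"
        using A.Mod.cmp_in[OF A.regular_ob W A.regular_ob w g] by simp
      have "s \<cdot> (g \<cdot> w) = Zero C (Carr A) (Carr A)"
        using A.Mod.cmp_assoc[OF A.regular_ob W A.regular_ob A.regular_ob w g V_E[OF s]] sg
          A.Mod.cmp_zero_left[OF A.regular_ob W A.regular_ob w] by simp
      then show "g \<cdot> w = Zero C (Carr A) (fst regA)"
        using E.integral_iff[of s "g \<cdot> w"] s gw by simp
    qed
    then show "g = Zero (Mod C A) W regA" by simp
  qed
  have "\<exists>a\<in>Ob ?J. \<exists>g\<in>?E. inv_leg (dec a) \<cdot>\<^bsub>Mod C A\<^esub> g = x"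
    by (rule A.Mod.finitely_generated_factor[OF fg A.regular_ob J fJ dJ _ colim x]) (use monic dv(1) in auto)
  then show ?thesis
    using that dec_V by auto
qed

text \<open>Writing \<open>v \<cdot> k\<close> as \<open>a / s\<close> gives
  \<open>v \<cdot> s' = a'\<close> for the extended scalars. As \<open>a\<close> is nonzero,
  \<open>a'\<close> has an inverse \<open>r\<close>, and \<open>s' \<cdot> r\<close> inverts
  \<open>v\<close>.\<close>

lemma division:
  assumes u: "(UNIV :: nat set) \<prec> (UNIV :: 'u set)"
    and small: "Hom (Mod C A) regA regA \<prec> (UNIV :: 'u set)"
    and fg: "finitely_generated TYPE('u) (Mod C A) regA"
    and generator: "\<And>M N c. \<lbrakk>M \<in> Ob (Mod C A); N \<in> Ob (Mod C A); c \<in> Hom (Mod C A) M N;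
      \<And>x. x \<in> Hom (Mod C A) regA M \<Longrightarrow> c \<cdot> x = Zero C (Carr A) (fst N)\<rbrakk> \<Longrightarrow> c = Zero C (fst M) (fst N)"
    and v: "v \<in> Hom (Mod C K) (regular_module K) (regular_module K)" and nz: "v \<noteq> Zero C (Carr K) (Carr K)"
  shows "\<exists>w\<in>Hom (Mod C K) (regular_module K) (regular_module K). v \<cdot> w = Idn C (Carr K)"
proof -
  let ?F = "Hom (Mod C K) (regular_module K) (regular_module K)"
  have "v \<cdot> k \<in> Hom (Mod C A) regA KA"
    using A.Mod.cmp_in[OF A.regular_ob restrict_ob restrict_ob str_Hom restrict_Hom[OF _ _ v]]
    by (simp add: algebra_module_eq)
  then obtain s a where s: "s \<in> V" and a: "a \<in> Hom (Mod C A) regA regA" and sa: "inv_leg s \<cdot> a = v \<cdot> k"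
    using fraction[OF u small fg generator] by blast
  \<comment> \<open>If \<open>a\<close> were zero, so would be \<open>v \<cdot> k\<close>, and then
    \<open>v\<close>, because extensions along \<open>k\<close> are unique.\<close>
  have a_V: "a \<in> V"
  proof -
    have "a \<noteq> Zero C (Carr A) (Carr A)"
    proof
      assume "a = Zero C (Carr A) (Carr A)"
      then have "v \<cdot> k = Zero C (Carr A) (Carr K)"
        using A.Mod.cmp_zero_right[OF A.regular_ob A.regular_ob algebra_module_ob inv_leg_in[OF s]] sa by simp
      also have "\<dots> = Zero C (Carr K) (Carr K) \<cdot> k"
        using A.Mod.cmp_zero_left[OF A.regular_ob algebra_module_ob algebra_module_ob str_Hom_algebra] by simp
      finally have "v = Zero C (Carr K) (Carr K)"
        using extend_unique[OF B.regular_ob v] B.Mod.zero_in[OF B.regular_ob B.regular_ob] by simp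
      then show False using nz by simp
    qed
    then show ?thesis using a by simp
  qed
  obtain s' where s': "s' \<in> ?F" "s' \<cdot> k = k \<cdot> s"
    using multiplication[OF V_E[OF s]] .
  obtain a' where a': "a' \<in> ?F" "a' \<cdot> k = k \<cdot> a"
    using multiplication[OF a] .
  obtain r where r: "r \<in> ?F" "a' \<cdot> r = Idn C (Carr K)"
    using multiplication_inverse[OF a inv_leg_in[OF a_V] inv_leg[OF a_V] a'] .
  have "(v \<cdot> s') \<cdot> k = (v \<cdot> k) \<cdot> s"
    using regular_cmp_assoc[OF v s'(1)] regular_cmp_assoc'[OF v V_E[OF s]] s'(2) by simp
  also have "\<dots> = inv_leg s \<cdot> (a \<cdot> s)"
    using A.Mod.cmp_assoc[OF A.regular_ob A.regular_ob A.regular_ob algebra_module_ob V_E[OF s] a inv_leg_in[OF s]]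
      sa by simp
  also have "\<dots> = inv_leg s \<cdot> (s \<cdot> a)"
    using E_comm[OF a_V s] by simp
  also have "\<dots> = a' \<cdot> k"
    using A.Mod.cmp_assoc[OF A.regular_ob A.regular_ob A.regular_ob algebra_module_ob a V_E[OF s] inv_leg_in[OF s]]
      inv_leg[OF s] a'(2) by simp
  finally have "v \<cdot> s' = a'"
    using extend_unique[OF B.regular_ob regular_cmp_in[OF v s'(1)] a'(1)] by simp
  then have "v \<cdot> (s' \<cdot> r) = Idn C (Carr K)"
    using B.Mod.cmp_assoc[OF B.regular_ob B.regular_ob B.regular_ob B.regular_ob r(1) s'(1) v] r(2) by simp
  then show ?thesis
    using regular_cmp_in[OF s'(1) r(1)] by blast
qed

end

text \<open>The canonical arrows are given as arrows of monoid objects under \<open>A\<close>. Their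
  linearity over \<open>A\<close> has to be derived: they are multiplicative and carry
  \<open>loc s\<close> to \<open>loc s'\<close>, through which \<open>A\<close> acts.\<close>

lemma fraction_algebra_exists:
  assumes C: "abelian_closed_symmetric_monoidal_category C" and A: "A \<in> Ob (Comm C)"
    and int: "integral_monoid C A" and frac: "is_fraction_algebra C A K k"
  obtains Loc loc can legs lam where "fraction_algebra C A K k Loc loc can legs lam"
proof -
  let ?J = "divisibility_cat (End_ring C A)"
  interpret abelian_closed_symmetric_monoidal_category C by (rule C)
  note frac' = frac[unfolded is_fraction_algebra_def Let_def]
  note K = conjunct1[OF frac'] conjunct1[OF conjunct2[OF frac']]
  have "\<exists>B l c legs.
         (\<forall>s\<in>Ob ?J. is_localization C A s (B s) (l s)) \<and>
         (\<forall>s\<in>Ob ?J. \<forall>s'\<in>Ob ?J. \<forall>t\<in>Hom ?J s s'.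
            c s s' \<in> Hom (Comm C) (B s) (B s') \<and> c s s' \<cdot>\<^bsub>C\<^esub> l s = l s') \<and>
         (\<forall>s\<in>Ob ?J. legs s \<in> Hom (Comm C) (B s) K) \<and>
         is_colimit ?J (Mod C A) (\<lambda>s. algebra_module C (B s) (l s)) (\<lambda>s s' t. c s s')
           (algebra_module C K k) legs"
    by (rule conjunct2[OF conjunct2[OF frac']])
  then obtain Loc loc can legs where
    locs': "\<forall>s\<in>Ob ?J. is_localization C A s (Loc s) (loc s)"
    and can': "\<forall>s\<in>Ob ?J. \<forall>s'\<in>Ob ?J. \<forall>t\<in>Hom ?J s s'.
      can s s' \<in> Hom (Comm C) (Loc s) (Loc s') \<and> can s s' \<cdot>\<^bsub>C\<^esub> loc s = loc s'"
    and legs': "\<forall>s\<in>Ob ?J. legs s \<in> Hom (Comm C) (Loc s) K"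
    and colim: "is_colimit ?J (Mod C A) (\<lambda>s. algebra_module C (Loc s) (loc s)) (\<lambda>s s' t. can s s')
           (algebra_module C K k) legs"
    by (elim exE conjE)
  note locs = locs'[rule_format] and can = can'[rule_format] and legs = legs'[rule_format]
  have "\<exists>lam. \<forall>s. s \<in> Ob ?J \<longrightarrow> lam s 0 = loc s \<and> is_colimit nat_cat (Mod C A) (\<lambda>_. regular_module A)
      (\<lambda>m n _. s [^]\<^bsub>End_ring C A\<^esub> (n - m)) (algebra_module C (Loc s) (loc s)) (lam s)"
    using locs unfolding is_localization_def by (intro choice) blast
  then obtain lam where lam: "\<And>s. s \<in> Ob ?J \<Longrightarrow> lam s 0 = loc s \<and> is_colimit nat_cat (Mod C A) (\<lambda>_. regular_module A)
      (\<lambda>m n _. s [^]\<^bsub>End_ring C A\<^esub> (n - m)) (algebra_module C (Loc s) (loc s)) (lam s)"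
    by blast
  have monoid: "monoid_in_category C R" if "R \<in> Ob (Comm C)" for R
    using that by unfold_locales
  have arrow: "monoid_arrow C A R f" if "R \<in> Ob (Comm C)" "f \<in> Hom (Comm C) A R" for R f
    using monoid[OF A] monoid[OF that(1)] that(2) C
    by (simp add: monoid_arrow_def monoid_arrow_axioms_def)
  have loc_arrow: "monoid_arrow C A (Loc s) (loc s)" if "s \<in> Ob ?J" for s
    using arrow locs[OF that] by (simp add: is_localization_def)
  have can_in: "can s s' \<in> Hom (Mod C A) (algebra_module C (Loc s) (loc s)) (algebra_module C (Loc s') (loc s'))"
    if s: "s \<in> Ob ?J" and s': "s' \<in> Ob ?J" and t: "t \<in> Hom ?J s s'" for s s' t
  proof -
    interpret S: monoid_arrow C A "Loc s" "loc s" by (rule loc_arrow[OF s])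
    interpret S': monoid_arrow C A "Loc s'" "loc s'" by (rule loc_arrow[OF s'])
    interpret T: monoid_arrow C "Loc s" "Loc s'" "can s s'"
      by unfold_locales (use can[OF s s' t] in simp)
    have str: "T.str \<bullet> S.str = S'.str"
      by (rule arrow_eqI) (use can[OF s s' t] in simp_all)
    have "S.A.lin (algebra_module C (Loc s) (loc s)) (algebra_module C (Loc s') (loc s')) T.str"
    proof (rule S.A.linI)
      have "T.str \<bullet> S.B.mul \<bullet> (S.str \<diamond> ide (Carr (Loc s))) =
          (S'.B.mul \<bullet> (T.str \<diamond> T.str)) \<bullet> (S.str \<diamond> ide (Carr (Loc s)))"
        by (intro comp_reassoc T.str_mul) simp_all
      also have "\<dots> = S'.B.mul \<bullet> ((T.str \<bullet> S.str) \<diamond> T.str)"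
        by (simp add: tensor_comp)
      also have "\<dots> = (S'.B.mul \<bullet> (S'.str \<diamond> ide (Carr (Loc s')))) \<bullet> (ide (Carr A) \<diamond> T.str)"
        unfolding str by (simp add: tensor_comp)
      finally show "T.str \<bullet> S.A.act (algebra_module C (Loc s) (loc s)) =
          S.A.act (algebra_module C (Loc s') (loc s')) \<bullet> (ide (Carr A) \<diamond> T.str)"
        by (simp add: S.algebra_module_eq S'.algebra_module_eq)
    qed simp_all
    then show ?thesis
      using S.A.Hom_Mod_mor[OF S.algebra_module_ob S'.algebra_module_ob] by fastforce
  qed
  have "fraction_algebra C A K k Loc loc can legs lam"
    using arrow[OF K] int lam can_in legs colim can loc_arrow
    by (intro fraction_algebra.intro fraction_algebra_axioms.intro) (auto simp: integral_monoid_def)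
  then show ?thesis using that by blast
qed

text \<open>What remains is to check the assumptions of \<open>simple_generator\<close> for the
  regular module of \<open>K\<close>; each of them is inherited from \<open>A\<close> through
  restriction of scalars or from the construction of modules in \<open>C\<close>.\<close>

theorem proposition2p8:
  fixes C :: "('o, 'm) moncat"
    and A K :: "('o, 'm) monoid_object"
    and k :: 'm
    and M :: "'o \<times> 'm"
  assumes universe: "(UNIV :: nat set) \<prec> (UNIV :: 'u set)"
    and "abelian_closed_symmetric_monoidal_category C"
    and "locally_small TYPE('u) C"
    and "\<And>R. R \<in> Ob (Comm C) \<Longrightarrow> has_filtered_colimits TYPE('u) (Mod C R)"
    and "locally_finitely_generated TYPE('u) C"
    and "\<And>R. R \<in> Ob (Comm C) \<Longrightarrow> filtered_colimits_commute_finite_limits TYPE('u) (Mod C R)"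
    and "A \<in> Ob (Comm C)"
    and "noetherian_monoid TYPE('u) C A"
    and "integral_monoid C A"
    and "is_fraction_algebra C A K k"
    and "M \<in> Ob (Mod C K)"
    and "finitely_generated TYPE('u) (Mod C K) M"
  shows "\<exists>q P. is_power (Mod C K) (regular_module K) q P \<and> isomorphic (Mod C K) M P"
proof -
  obtain Loc loc can legs lam where "fraction_algebra C A K k Loc loc can legs lam"
    using fraction_algebra_exists assms by metis
  then interpret fraction_algebra C A K k Loc loc can legs lam .
  have small: "Hom (Mod C R) X Y \<prec> (UNIV :: 'u set)"
    if "R \<in> Ob (Comm C)" "X \<in> Ob (Mod C R)" "Y \<in> Ob (Mod C R)" for R X Y
  proof -
    interpret R: monoid_in_category C R by unfold_locales (rule that)
    have "Hom (Mod C R) X Y \<subseteq> Hom C (fst X) (fst Y)"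
      using R.Hom_Mod_in[OF that(2,3)] by blast
    moreover have "Hom C (fst X) (fst Y) \<prec> (UNIV :: 'u set)"
      using assms(3) R.module_ob[OF that(2)] R.module_ob[OF that(3)] by (simp add: locally_small_def small_set_def)
    ultimately show ?thesis
      using subset_imp_lepoll lesspoll_trans1 by blast
  qed
  have genA: "c = Zero C (fst X) (fst Y)"
    if "X \<in> Ob (Mod C A)" "Y \<in> Ob (Mod C A)" "c \<in> Hom (Mod C A) X Y"
      "\<And>x. x \<in> Hom (Mod C A) regA X \<Longrightarrow> c \<cdot>\<^bsub>C\<^esub> x = Zero C (Carr A) (fst Y)" for X Y c
    using A.Mod.generator_of_presentations[OF _ _ A.regular_ob that(1-3), where 'u = 'u] that(4) assms(5,7,8)
    by (simp add: locally_finitely_generated_def noetherian_monoid_def)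
  obtain Z where "Z \<in> Ob (Mod C A)" "\<And>X f g. \<lbrakk>X \<in> Ob (Mod C A); f \<in> Hom (Mod C A) Z X; g \<in> Hom (Mod C A) Z X\<rbrakk> \<Longrightarrow> f = g"
    using A.Mod_zero_object by metis
  then have "finitely_presented (Mod C A) regA regA"
    by (rule A.Mod.finitely_presented_self[OF _ _ A.regular_ob])
  \<comment> \<open>Here the Noetherian condition is used from finitely presented to finitely
    generated; \<open>genA\<close> rests on the converse direction.\<close>
  then have fgA: "finitely_generated TYPE('u) (Mod C A) regA"
    using assms(8) A.regular_ob by (simp add: noetherian_monoid_def)
  have genK: "c = Zero C (fst X) (fst Y)"
    if X: "X \<in> Ob (Mod C K)" and Y: "Y \<in> Ob (Mod C K)" and c: "c \<in> Hom (Mod C K) X Y"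
      and zero: "\<And>x. x \<in> Hom (Mod C K) (regular_module K) X \<Longrightarrow> c \<cdot>\<^bsub>C\<^esub> x = Zero C (Carr K) (fst Y)" for X Y c
  proof -
    have "c = Zero C (fst (restrict X)) (fst (restrict Y))"
    proof (rule genA[OF restrict_ob[OF X] restrict_ob[OF Y] restrict_Hom[OF X Y c]])
      fix x assume "x \<in> Hom (Mod C A) regA (restrict X)"
      \<comment> \<open>An arrow from \<open>A\<close> into the restriction of \<open>X\<close> is
        \<open>v \<cdot> k\<close> for some \<open>K\<close>-linear \<open>v\<close>, and
        \<open>c\<close> kills \<open>v\<close> by assumption.\<close>
      then obtain v where v: "v \<in> Hom (Mod C K) (regular_module K) X" "v \<cdot>\<^bsub>C\<^esub> k = x"
        using extend[OF X] by blast
      have "c \<cdot>\<^bsub>C\<^esub> x = (c \<cdot>\<^bsub>C\<^esub> v) \<cdot>\<^bsub>C\<^esub> k"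
        using A.Mod.cmp_assoc[OF A.regular_ob restrict_ob restrict_ob restrict_ob str_Hom
            restrict_Hom[OF _ X v(1)] restrict_Hom[OF X Y c]] X Y v(2) by simp
      then show "c \<cdot>\<^bsub>C\<^esub> x = Zero C (Carr A) (fst (restrict Y))"
        using zero[OF v(1)] A.Mod.cmp_zero_left[OF A.regular_ob restrict_ob restrict_ob str_Hom, of Y] Y by simp
    qed
    then show ?thesis by simp
  qed
  interpret SG: simple_generator "Mod C K" "regular_module K"
  proof (intro simple_generator.intro simple_generator_axioms.intro B.Mod.preadditive_category_axioms B.regular_ob)
    obtain Z where "Z \<in> Ob (Mod C K)"
      "\<And>X f g. \<lbrakk>X \<in> Ob (Mod C K); f \<in> Hom (Mod C K) X Z; g \<in> Hom (Mod C K) X Z\<rbrakk> \<Longrightarrow> f = g"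
      "\<And>X f g. \<lbrakk>X \<in> Ob (Mod C K); f \<in> Hom (Mod C K) Z X; g \<in> Hom (Mod C K) Z X\<rbrakk> \<Longrightarrow> f = g"
      using B.Mod_zero_object by metis
    then show "\<exists>Z\<in>Ob (Mod C K). \<forall>X\<in>Ob (Mod C K). (\<forall>f\<in>Hom (Mod C K) X Z. \<forall>g\<in>Hom (Mod C K) X Z. f = g) \<and>
        (\<forall>f\<in>Hom (Mod C K) Z X. \<forall>g\<in>Hom (Mod C K) Z X. f = g)"
      by blast
    show "\<exists>P i j p q. biproduct (Mod C K) X Y P i j p q" if "X \<in> Ob (Mod C K)" "Y \<in> Ob (Mod C K)" for X Y
      by (rule B.Mod_biproduct[OF that])
    show "\<exists>L l. is_kernel (Mod C K) X Y f L l"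
      if "X \<in> Ob (Mod C K)" "Y \<in> Ob (Mod C K)" "f \<in> Hom (Mod C K) X Y" for X Y f
      by (rule B.Mod_kernel[OF that])
    show "c = Zero (Mod C K) X Y"
      if "X \<in> Ob (Mod C K)" "Y \<in> Ob (Mod C K)" "c \<in> Hom (Mod C K) X Y"
        "\<And>x. x \<in> Hom (Mod C K) (regular_module K) X \<Longrightarrow> c \<cdot>\<^bsub>Mod C K\<^esub> x = Zero (Mod C K) (regular_module K) Y" for X Y c
      using genK[OF that(1-3)] that(4) by simp
    show "\<exists>v\<in>Hom (Mod C K) (regular_module K) (regular_module K). u \<cdot>\<^bsub>Mod C K\<^esub> v = Idn (Mod C K) (regular_module K)"
      if "u \<in> Hom (Mod C K) (regular_module K) (regular_module K)"
        "u \<noteq> Zero (Mod C K) (regular_module K) (regular_module K)" for u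
      using that(2) unfolding B.Mod_simps B.fst_regular
      by (intro division[OF universe small[OF assms(7) A.regular_ob A.regular_ob] fgA _ that(1)] genA)
    show "iso_arr (Mod C K) X Y f"
      if "X \<in> Ob (Mod C K)" "Y \<in> Ob (Mod C K)" "monic (Mod C K) X Y f"
        "\<And>x. x \<in> Hom (Mod C K) (regular_module K) Y \<Longrightarrow>
          \<exists>y\<in>Hom (Mod C K) (regular_module K) X. f \<cdot>\<^bsub>Mod C K\<^esub> y = x" for X Y f
      by (rule B.iso_of_generator[OF _ B.regular_ob that(1-3)]) (use genK that(4) in auto)
  qed
  show ?thesis
    by (rule SG.finitely_generated_free[OF universe assms(4)[OF B.monoid] assms(6)[OF B.monoid] assms(11,12)
          small[OF B.monoid B.regular_ob assms(11)]])
qed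

end
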